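(* Let $P_t$ be the external price, $z_t$ the mispricing process with invariant distribution $\pi$, and $A_\pm,F_\pm,A=A_++A_-,F=F_++F_-$, $\mathsf{ARB}_T$, $\mathsf{FEE}_T$, $\mathsf{P}_{\mathsf{trade}}$ be as defined in the context. Given initial price $P_0=P>0$, suppose that $z_{0^-}=z$ is distributed according to the stationary distribution $\pi(\cdot)$. Then the instantaneous rate of arbitrage profit $\overline{\mathsf{ARB}}:=\lim_{T\to0}\frac{\mathsf{E}[\mathsf{ARB}_T]}{T}$ is given by $$ \overline{\mathsf{ARB}}=\lambda\,\mathsf{E}_\pi[A(P,z)]=\lambda\,\mathsf{P}_{\mathsf{trade}}\,\frac{\sqrt{2\lambda}}{\sigma}\int_0^\infty\frac{A_+(P,x+\gamma)+A_-(P,-x-\gamma)}{2}\,e^{-\sqrt{2\lambda}\,x/\sigma}\,dx, $$ and the instantaneous rate of fees $\overline{\mathsf{FEE}}:=\lim_{T\to0}\frac{\mathsf{E}[\mathsf{FEE}_T]}{T}$ is given by $$ \overline{\mathsf{FEE}}=\lambda\,\mathsf{E}_\pi[F(P,z)]=\lambda\,\mathsf{P}_{\mathsf{trade}}\,\frac{\sqrt{2\lambda}}{\sigma}\int_0^\infty\frac{F_+(P,x+\gamma)+F_-(P,-x-\gamma)}{2}\,e^{-\sqrt{2\lambda}\,x/\sigma}\,dx. $$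
   Context: Model. Fix $\sigma,\lambda,\gamma>0$. The external price satisfies $dP_t/P_t=\mu\,dt+\sigma\,dB_t$ with $\mu=\frac12\sigma^2$, $B$ a standard Brownian motion. Arbitrageurs arrive at the arrival times $0<\tau_1<\tau_2<\cdots$ of a Poisson process $N_t$ of rate $\lambda$, independent of $B$. The mispricing process $z_t$ satisfies $dz_t=\sigma\,dB_t$ between arrivals and $z_{\tau_i}=\max(\min(z_{\tau_i^-},\gamma),-\gamma)$ at arrivals; $z_{0^-}$ is independent of $(B,N)$. Stationary distribution. With $\eta=\sqrt{2\lambda}\gamma/\sigma$, $z_t$ has the unique invariant distribution $\pi$ which is uniform on $[-\gamma,\gamma]$ with total mass $\eta/(1+\eta)$, and for which $z-\gamma$ given $z>\gamma$, and $-\gamma-z$ given $z<-\gamma$, are exponential with parameter $\sqrt{2\lambda}/\sigma$, each of these two regions having mass $\frac12\frac1{1+\eta}$. Set $\mathsf{P}_{\mathsf{trade}}=\frac{1}{1+\sqrt{2\lambda}\gamma/\sigma}$. Pool. $f:\mathbb{R}_+^2\to\mathbb{R}$ is a bonding function and $L\in\mathbb{R}$; $V(P)=\min\{Px+y:(x,y)\in\mathbb{R}^2_+,\ f(x,y)=L\}$. Assume: (i) an optimal solution $(x^*(P),y^*(P))$ exists for every $P\ge0$; (ii) $V$ is everywhere twice continuously differentiable; (iii) $\mathsf{E}[\int_0^t x^*(P_s)^2P_s^2\,ds]<\infty$ for all $t\ge0$. Profit and fee per arrival ($\mathbb{I}$ denotes an indicator): $A_+(P,z)=\big[P\{x^*(Pe^{-z})-x^*(Pe^{-\gamma})\}+e^{\gamma}\{y^*(Pe^{-z})-y^*(Pe^{-\gamma})\}\big]\mathbb{I}_{\{z>\gamma\}}\ge0$,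 $A_-(P,z)=\big[e^{\gamma}P\{x^*(Pe^{-z})-x^*(Pe^{\gamma})\}+\{y^*(Pe^{-z})-y^*(Pe^{\gamma})\}\big]\mathbb{I}_{\{z<-\gamma\}}\ge0$, $F_+(P,z)=-(e^{\gamma}-1)\big[y^*(Pe^{-z})-y^*(Pe^{-\gamma})\big]\mathbb{I}_{\{z>\gamma\}}\ge0$, $F_-(P,z)=-(e^{\gamma}-1)P\big[x^*(Pe^{-z})-x^*(Pe^{\gamma})\big]\mathbb{I}_{\{z<-\gamma\}}\ge0$. $\mathsf{ARB}_T=\sum_{i=1}^{N_T}A(P_{\tau_i},z_{\tau_i^-})$ and $\mathsf{FEE}_T=\sum_{i=1}^{N_T}F(P_{\tau_i},z_{\tau_i^-})$. All expectations are of non-negative quantities and may take the value $+\infty$. *)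

theory Defs
  imports "HOL-Probability.Probability"
begin

section \<open>Stochastic processes\<close>

definition indep_increments ::
  "'a measure \<Rightarrow> 'b measure \<Rightarrow> (real \<Rightarrow> 'a \<Rightarrow> 'b::minus) \<Rightarrow> bool" where
  "indep_increments M K X \<longleftrightarrow>
     (\<forall>(n::nat) t. 0 \<le> t 0 \<and> (\<forall>i<n. t i < t (Suc i)) \<longrightarrow>
        prob_space.indep_vars M (\<lambda>_. K) (\<lambda>i \<omega>. X (t (Suc i)) \<omega> - X (t i) \<omega>) {..<n})"

definition brownian_motion :: "'a measure \<Rightarrow> (real \<Rightarrow> 'a \<Rightarrow> real) \<Rightarrow> bool" where
  "brownian_motion M B \<longleftrightarrow>
     (\<forall>t\<ge>0. B t \<in> borel_measurable M) \<and>
     (\<forall>\<omega>\<in>space M. B 0 \<omega> = 0 \<and> continuous_on {0..} (\<lambda>t. B t \<omega>)) \<and>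
     indep_increments M borel B \<and>
     (\<forall>s t. 0 \<le> s \<and> s < t \<longrightarrow>
        distributed M lborel (\<lambda>\<omega>. B t \<omega> - B s \<omega>) (normal_density 0 (sqrt (t - s))))"

text \<open>The truncated subtraction of \<^typ>\<open>nat\<close> is harmless below, since the paths are nondecreasing.\<close>

definition poisson_process :: "'a measure \<Rightarrow> real \<Rightarrow> (real \<Rightarrow> 'a \<Rightarrow> nat) \<Rightarrow> bool" where
  "poisson_process M rate N \<longleftrightarrow>
     (\<forall>t\<ge>0. N t \<in> measurable M (count_space UNIV)) \<and>
     (\<forall>\<omega>\<in>space M. N 0 \<omega> = 0 \<and> mono_on {0..} (\<lambda>t. N t \<omega>) \<and>
        (\<forall>t\<ge>0. continuous (at_right t) (\<lambda>u. N u \<omega>))) \<and>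
     indep_increments M (count_space UNIV) N \<and>
     (\<forall>s t. 0 \<le> s \<and> s < t \<longrightarrow>
        distr M (count_space UNIV) (\<lambda>\<omega>. N t \<omega> - N s \<omega>)
          = measure_pmf (poisson_pmf (rate * (t - s))))"

text \<open>Arrival times are numbered from 1; the value at index 0 is irrelevant.\<close>

definition arrival_times :: "'a measure \<Rightarrow> (real \<Rightarrow> 'a \<Rightarrow> nat) \<Rightarrow> (nat \<Rightarrow> 'a \<Rightarrow> real) \<Rightarrow> bool" where
  "arrival_times M N \<tau> \<longleftrightarrow>
     (\<forall>\<omega>\<in>space M. 0 < \<tau> 1 \<omega> \<and> (\<forall>i\<ge>1. \<tau> i \<omega> < \<tau> (Suc i) \<omega>) \<and>
        (\<forall>i\<ge>1. \<forall>t\<ge>0. \<tau> i \<omega> \<le> t \<longleftrightarrow> i \<le> N t \<omega>))"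

text \<open>A process as a random element of the space of functions on \<open>[0,\<infinity>)\<close>.\<close>

abbreviation trajectory :: "(real \<Rightarrow> 'a \<Rightarrow> 'b) \<Rightarrow> 'a \<Rightarrow> real \<Rightarrow> 'b" where
  "trajectory X \<omega> \<equiv> (\<lambda>t\<in>{0..}. X t \<omega>)"

abbreviation B_space :: "(real \<Rightarrow> real) measure" where
  "B_space \<equiv> PiM {0..} (\<lambda>_. borel)"

abbreviation N_space :: "(real \<Rightarrow> nat) measure" where
  "N_space \<equiv> PiM {0..} (\<lambda>_. count_space UNIV)"

text \<open>
  The constant \<^const>\<open>prob_space.indep_var\<close> requires both random elements to have values in
  the same type; this is the version for two different types.
\<close>

definition indep_random_elements ::
  "'a measure \<Rightarrow> 'b measure \<Rightarrow> ('a \<Rightarrow> 'b) \<Rightarrow> 'c measure \<Rightarrow> ('a \<Rightarrow> 'c) \<Rightarrow> bool" where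
  "indep_random_elements M K X K' Y \<longleftrightarrow>
     X \<in> measurable M K \<and> Y \<in> measurable M K' \<and>
     prob_space.indep_set M {X -` A \<inter> space M | A. A \<in> sets K} {Y -` A \<inter> space M | A. A \<in> sets K'}"

section \<open>The external price\<close>

definition partitions_vanishing_mesh :: "real \<Rightarrow> (nat \<Rightarrow> nat) \<Rightarrow> (nat \<Rightarrow> nat \<Rightarrow> real) \<Rightarrow> bool" where
  "partitions_vanishing_mesh t m s \<longleftrightarrow>
     (\<forall>n. s n 0 = 0 \<and> s n (m n) = t \<and> (\<forall>k<m n. s n k \<le> s n (Suc k))) \<and>
     (\<forall>\<epsilon>>0. \<forall>\<^sub>F n in sequentially. \<forall>k<m n. s n (Suc k) - s n k < \<epsilon>)"

text \<open>
  \<open>has_ito_integral M H X t Y\<close> says that the Ito integral of \<open>H\<close> against \<open>X\<close> over \<open>[0,t]\<close>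
  is \<open>Y\<close>. For continuous processes this is the limit in probability of the left-endpoint
  Riemann sums, along every sequence of partitions whose mesh tends to 0.
\<close>

definition has_ito_integral ::
  "'a measure \<Rightarrow> (real \<Rightarrow> 'a \<Rightarrow> real) \<Rightarrow> (real \<Rightarrow> 'a \<Rightarrow> real) \<Rightarrow> real \<Rightarrow> ('a \<Rightarrow> real) \<Rightarrow> bool" where
  "has_ito_integral M H X t Y \<longleftrightarrow>
     (\<forall>m s. partitions_vanishing_mesh t m s \<longrightarrow>
        (\<forall>\<epsilon>>0. (\<lambda>n. measure M {\<omega> \<in> space M.
             \<epsilon> < \<bar>(\<Sum>k<m n. H (s n k) \<omega> * (X (s n (Suc k)) \<omega> - X (s n k) \<omega>)) - Y \<omega>\<bar>})
           \<longlonglongrightarrow> 0))"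

text \<open>The equation \<open>dP\<^sub>t / P\<^sub>t = \<mu> dt + \<sigma> dB\<^sub>t\<close>, \<open>P\<^sub>0 = p0\<close>, in integrated form.\<close>

definition price_process ::
  "'a measure \<Rightarrow> real \<Rightarrow> real \<Rightarrow> (real \<Rightarrow> 'a \<Rightarrow> real) \<Rightarrow> real \<Rightarrow> (real \<Rightarrow> 'a \<Rightarrow> real) \<Rightarrow> bool" where
  "price_process M \<mu> \<sigma> B p0 P \<longleftrightarrow>
     (\<forall>t\<ge>0. P t \<in> borel_measurable M) \<and>
     (\<forall>\<omega>\<in>space M. P 0 \<omega> = p0 \<and> continuous_on {0..} (\<lambda>t. P t \<omega>) \<and> (\<forall>t\<ge>0. 0 < P t \<omega>)) \<and>
     (\<forall>t\<ge>0. has_ito_integral M (\<lambda>s \<omega>. 1 / P s \<omega>) P t (\<lambda>\<omega>. \<mu> * t + \<sigma> * B t \<omega>))"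

section \<open>The mispricing process\<close>

definition left_lim :: "(real \<Rightarrow> real) \<Rightarrow> real \<Rightarrow> real" where
  "left_lim z t = Lim (at_left t) z"

text \<open>
  Since \<open>dz = \<sigma> dB\<close> has a constant coefficient, it is stated pathwise through its increments
  over arrival-free intervals. All arrivals are after time 0, so \<open>z\<^sub>0\<close> equals the
  initial value \<open>z\<^sub>0\<^sub>-\<close>, written \<open>z0\<close>.
\<close>

definition mispricing_path ::
  "real \<Rightarrow> real \<Rightarrow> (real \<Rightarrow> real) \<Rightarrow> (nat \<Rightarrow> real) \<Rightarrow> real \<Rightarrow> (real \<Rightarrow> real) \<Rightarrow> bool" where
  "mispricing_path \<sigma> \<gamma> b a z0 z \<longleftrightarrow>
     z 0 = z0 \<and>
     (\<forall>s t. 0 \<le> s \<and> s \<le> t \<and> \<not> (\<exists>i\<ge>1. s < a i \<and> a i \<le> t) \<longrightarrow> z t = z s + \<sigma> * (b t - b s)) \<and>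
     (\<forall>i\<ge>1. z (a i) = max (min (left_lim z (a i)) \<gamma>) (- \<gamma>))"

definition stat_eta :: "real \<Rightarrow> real \<Rightarrow> real \<Rightarrow> real" where
  "stat_eta \<sigma> rate \<gamma> = sqrt (2 * rate) * \<gamma> / \<sigma>"

text \<open>
  Uniform part of mass \<open>\<eta>/(1+\<eta>)\<close> on \<open>[-\<gamma>,\<gamma>]\<close>; the overshoot \<open>\<bar>z\<bar> - \<gamma>\<close> on either side is
  exponential with parameter \<open>sqrt (2\<lambda>)/\<sigma>\<close> and mass \<open>1/(2(1+\<eta>))\<close>.
\<close>

definition stationary_density :: "real \<Rightarrow> real \<Rightarrow> real \<Rightarrow> real \<Rightarrow> real" where
  "stationary_density \<sigma> rate \<gamma> z =
     (if \<bar>z\<bar> \<le> \<gamma>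
      then stat_eta \<sigma> rate \<gamma> / (1 + stat_eta \<sigma> rate \<gamma>) * (1 / (2 * \<gamma>))
      else 1 / 2 * (1 / (1 + stat_eta \<sigma> rate \<gamma>)) *
           exponential_density (sqrt (2 * rate) / \<sigma>) (\<bar>z\<bar> - \<gamma>))"

definition stationary_dist :: "real \<Rightarrow> real \<Rightarrow> real \<Rightarrow> real measure" where
  "stationary_dist \<sigma> rate \<gamma> = density lborel (\<lambda>z. ennreal (stationary_density \<sigma> rate \<gamma> z))"

definition P_trade :: "real \<Rightarrow> real \<Rightarrow> real \<Rightarrow> real" where
  "P_trade \<sigma> rate \<gamma> = 1 / (1 + sqrt (2 * rate) * \<gamma> / \<sigma>)"

section \<open>The pool\<close>

definition feasible :: "(real \<Rightarrow> real \<Rightarrow> real) \<Rightarrow> real \<Rightarrow> (real \<times> real) set" where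
  "feasible f L = {(x, y). 0 \<le> x \<and> 0 \<le> y \<and> f x y = L}"

definition optimal_reserves ::
  "(real \<Rightarrow> real \<Rightarrow> real) \<Rightarrow> real \<Rightarrow> real \<Rightarrow> real \<Rightarrow> real \<Rightarrow> bool" where
  "optimal_reserves f L p x y \<longleftrightarrow>
     (x, y) \<in> feasible f L \<and> (\<forall>(x', y') \<in> feasible f L. p * x + y \<le> p * x' + y')"

text \<open>The infimum is a minimum whenever optimal reserves exist.\<close>

definition pool_value :: "(real \<Rightarrow> real \<Rightarrow> real) \<Rightarrow> real \<Rightarrow> real \<Rightarrow> real" where
  "pool_value f L p = (INF (x, y) \<in> feasible f L. p * x + y)"

definition twice_cont_diff_on :: "real set \<Rightarrow> (real \<Rightarrow> real) \<Rightarrow> bool" where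
  "twice_cont_diff_on S g \<longleftrightarrow>
     (\<exists>g' g''. (\<forall>x\<in>S. (g has_real_derivative g' x) (at x)) \<and>
               (\<forall>x\<in>S. (g' has_real_derivative g'' x) (at x)) \<and>
               continuous_on S g'')"

section \<open>Arbitrage profits and fees\<close>

text \<open>In what follows \<open>xs\<close>, \<open>ys\<close> are the optimal reserves \<open>x\<^sup>*\<close>, \<open>y\<^sup>*\<close> as functions of the price.\<close>

definition A_plus :: "(real \<Rightarrow> real) \<Rightarrow> (real \<Rightarrow> real) \<Rightarrow> real \<Rightarrow> real \<Rightarrow> real \<Rightarrow> real" where
  "A_plus xs ys \<gamma> P z =
     (P * (xs (P * exp (- z)) - xs (P * exp (- \<gamma>)))
      + exp \<gamma> * (ys (P * exp (- z)) - ys (P * exp (- \<gamma>)))) * indicator {z. z > \<gamma>} z"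

definition A_minus :: "(real \<Rightarrow> real) \<Rightarrow> (real \<Rightarrow> real) \<Rightarrow> real \<Rightarrow> real \<Rightarrow> real \<Rightarrow> real" where
  "A_minus xs ys \<gamma> P z =
     (exp \<gamma> * P * (xs (P * exp (- z)) - xs (P * exp \<gamma>))
      + (ys (P * exp (- z)) - ys (P * exp \<gamma>))) * indicator {z. z < - \<gamma>} z"

definition F_plus :: "(real \<Rightarrow> real) \<Rightarrow> real \<Rightarrow> real \<Rightarrow> real \<Rightarrow> real" where
  "F_plus ys \<gamma> P z =
     - (exp \<gamma> - 1) * (ys (P * exp (- z)) - ys (P * exp (- \<gamma>))) * indicator {z. z > \<gamma>} z"

definition F_minus :: "(real \<Rightarrow> real) \<Rightarrow> real \<Rightarrow> real \<Rightarrow> real \<Rightarrow> real" where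
  "F_minus xs \<gamma> P z =
     - (exp \<gamma> - 1) * P * (xs (P * exp (- z)) - xs (P * exp \<gamma>)) * indicator {z. z < - \<gamma>} z"

definition A_total :: "(real \<Rightarrow> real) \<Rightarrow> (real \<Rightarrow> real) \<Rightarrow> real \<Rightarrow> real \<Rightarrow> real \<Rightarrow> real" where
  "A_total xs ys \<gamma> P z = A_plus xs ys \<gamma> P z + A_minus xs ys \<gamma> P z"

definition F_total :: "(real \<Rightarrow> real) \<Rightarrow> (real \<Rightarrow> real) \<Rightarrow> real \<Rightarrow> real \<Rightarrow> real \<Rightarrow> real" where
  "F_total xs ys \<gamma> P z = F_plus ys \<gamma> P z + F_minus xs \<gamma> P z"

text \<open>With \<open>G\<close> the profit or the fee of one arrival, the total over all arrivals up to time \<open>T\<close>.\<close>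

definition cumulative ::
  "(real \<Rightarrow> real \<Rightarrow> real) \<Rightarrow> (real \<Rightarrow> 'a \<Rightarrow> nat) \<Rightarrow> (nat \<Rightarrow> 'a \<Rightarrow> real) \<Rightarrow>
   (real \<Rightarrow> 'a \<Rightarrow> real) \<Rightarrow> (real \<Rightarrow> 'a \<Rightarrow> real) \<Rightarrow> real \<Rightarrow> 'a \<Rightarrow> real" where
  "cumulative G N \<tau> P z T \<omega> =
     (\<Sum>i = 1..N T \<omega>. G (P (\<tau> i \<omega>) \<omega>) (left_lim (\<lambda>t. z t \<omega>) (\<tau> i \<omega>)))"

text \<open>
  Profits and fees are nonnegative, so that their expectations can be taken as integrals
  with values in \<^typ>\<open>ennreal\<close> without \<^const>\<open>ennreal\<close> truncating anything.
\<close>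

lemma optimal_reserves_exchange:
  assumes "optimal_reserves f L p x y" "optimal_reserves f L q x' y'"
  shows "p * x + y \<le> p * x' + y'" "q * x' + y' \<le> q * x + y"
  using assms by (auto simp: optimal_reserves_def)

lemma optimal_reserves_mono:
  assumes "optimal_reserves f L p x y" "optimal_reserves f L q x' y'" "0 \<le> p" "p < q"
  shows "x' \<le> x" "y \<le> y'"
proof -
  note e = optimal_reserves_exchange[OF assms(1,2)]
  have "(q - p) * (x' - x) \<le> 0"
    using e by (simp add: algebra_simps)
  then show x: "x' \<le> x"
    using assms(4) by (simp add: mult_le_0_iff)
  have "p * x' \<le> p * x"
    using x assms(3) by (rule mult_left_mono)
  then show "y \<le> y'"
    using e by linarith
qed

lemma
  assumes opt: "\<And>p. 0 \<le> p \<Longrightarrow> optimal_reserves f L p (xs p) (ys p)"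
    and "0 < P" "0 < \<gamma>"
  shows A_plus_nonneg: "0 \<le> A_plus xs ys \<gamma> P z"
    and A_minus_nonneg: "0 \<le> A_minus xs ys \<gamma> P z"
    and F_plus_nonneg: "0 \<le> F_plus ys \<gamma> P z"
    and F_minus_nonneg: "0 \<le> F_minus xs \<gamma> P z"
proof -
  have o: "optimal_reserves f L (P * exp u) (xs (P * exp u)) (ys (P * exp u))" for u
    using opt assms(2) by simp
  have "P * exp (- \<gamma>) * xs (P * exp (- \<gamma>)) + ys (P * exp (- \<gamma>))
      \<le> P * exp (- \<gamma>) * xs (P * exp (- z)) + ys (P * exp (- z))"
    by (rule optimal_reserves_exchange(1)[OF o o])
  then have "exp \<gamma> * (P * exp (- \<gamma>) * xs (P * exp (- \<gamma>)) + ys (P * exp (- \<gamma>)))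
      \<le> exp \<gamma> * (P * exp (- \<gamma>) * xs (P * exp (- z)) + ys (P * exp (- z)))"
    by (intro mult_left_mono) auto
  moreover have "exp \<gamma> * (P * exp (- \<gamma>) * x + y) = P * x + exp \<gamma> * y" for x y
    by (simp add: exp_minus field_simps)
  ultimately show "0 \<le> A_plus xs ys \<gamma> P z"
    by (simp add: A_plus_def right_diff_distrib indicator_def)
  show "0 \<le> A_minus xs ys \<gamma> P z"
    using optimal_reserves_exchange(1)[OF o[of \<gamma>] o[of "- z"]]
    by (simp add: A_minus_def algebra_simps indicator_def)
  show "0 \<le> F_plus ys \<gamma> P z"
  proof (cases "z > \<gamma>")
    case True
    then have "ys (P * exp (- z)) \<le> ys (P * exp (- \<gamma>))"
      using optimal_reserves_mono(2)[OF o[of "- z"] o[of "- \<gamma>"]] assms(2) by simp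
    then show ?thesis
      using True assms(3) by (simp add: F_plus_def mult_nonpos_nonpos)
  qed (simp add: F_plus_def)
  show "0 \<le> F_minus xs \<gamma> P z"
  proof (cases "z < - \<gamma>")
    case True
    then have "xs (P * exp (- z)) \<le> xs (P * exp \<gamma>)"
      using optimal_reserves_mono(1)[OF o[of \<gamma>] o[of "- z"]] assms(2) by simp
    then show ?thesis
      using True assms(2,3) by (simp add: F_minus_def mult_nonpos_nonpos mult_nonpos_nonneg)
  qed (simp add: F_minus_def)
qed

end

theory Submission
  imports Defs
begin

text \<open>
  The stochastic equation forces \<open>P\<^sub>t = p0 exp (\<sigma> B\<^sub>t)\<close>, so the pool's own price \<open>P\<^sub>t exp (- z\<^sub>t)\<close> does
  not move between arrivals. By independence, the first arrival, at time \<open>s\<close>, contributes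
  \<open>h(s) = E G(p0 exp (\<sigma> B\<^sub>s), z0 + \<sigma> B\<^sub>s)\<close>; it occurs before \<open>T\<close> with probability
  \<open>1 - exp (- \<lambda> T)\<close>, and \<open>h(s)\<close> tends to \<open>E G(p0, z0)\<close>. Since an optimum exists at price 0,
  \<open>x\<^sup>*\<close> is bounded and \<open>y\<^sup>*\<close> grows at most linearly. Hence everything but the term \<open>y\<^sup>*\<close> at the pool's own
  price is dominated by the price, and at the first arrival that term is \<open>y\<^sup>*(p0 exp (- z0))\<close>, which
  does not depend on \<open>s\<close>: either it is integrable and dominates, or both sides are infinite by Fatou's
  lemma. After an arrival \<open>\<bar>z\<bar> \<le> \<gamma>\<close>, so each later arrival has bounded expectation given its time, and
  the expected number of them up to \<open>T\<close> is \<open>O(T\<^sup>2)\<close>.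
\<close>

section \<open>Identification of the price process\<close>

text \<open>Integrals are taken in \<open>ennreal\<close> because the limits may really be infinite.
  Under \<pi> the variable \<open>exp (- z)\<close> has only moments of order below
  \<open>sqrt (2 * rate) / \<sigma>\<close>, while \<open>ys\<close> may grow like a power of the
  price with exponent below one, so the mean of \<open>ys (p0 * exp (- z))\<close> need not be
  finite. In the profit this term enters with coefficient one on the side
  \<open>z < - \<gamma>\<close>; in the fee it occurs only with a negative sign. Hence payoffs are
  bounded by a multiple of \<open>1 + exp b\<close> plus a monotone function \<open>D\<close> of the
  pool's log price \<open>b - v\<close>, with \<open>D = Y\<close> for profits and
  \<open>D = 0\<close> for fees. At the first arrival \<open>D\<close> is compared with the payoff
  at time 0 itself, so that no integrability has to be known beforehand; at later arrivals the
  clamping bounds the argument of \<open>D\<close>, and its linear growth suffices. The price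
  equation is given through limits in probability, so almost sure statements about it are reached
  along subsequences.\<close>

lemma exp_taylor_order2:
  fixes a :: real
  assumes "\<bar>a\<bar> \<le> 1"
  shows "\<bar>exp a - 1 - a - a\<^sup>2 / 2\<bar> \<le> \<bar>a\<bar> * a\<^sup>2"
proof -
  obtain s where s: "\<bar>s\<bar> \<le> \<bar>a\<bar>"
    "exp a = (\<Sum>m<3. a ^ m / fact m) + exp s / fact 3 * a ^ 3"
    using Maclaurin_exp_le[of a 3] by blast
  \<comment> \<open>This makes the Lagrange coefficient \<open>exp s / 6\<close> at most 1. The
    cubic remainder is kept as \<open>\<bar>a\<bar> * a\<^sup>2\<close> so that a small bound on
    \<open>\<bar>a\<bar>\<close> can be taken out of a sum of squares.\<close>
  have e3: "exp s \<le> 3"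
    using exp_le s(1) assms by (smt (verit) exp_le_cancel_iff)
  have "exp a - 1 - a - a\<^sup>2 / 2 = exp s / 6 * a ^ 3"
    unfolding s(2) by (simp add: eval_nat_numeral)
  also have "\<bar>\<dots>\<bar> = exp s / 6 * (\<bar>a\<bar> * a\<^sup>2)"
    by (simp add: abs_mult power3_eq_cube power2_eq_square)
  also have "exp s / 6 * (\<bar>a\<bar> * a\<^sup>2) \<le> 1 * (\<bar>a\<bar> * a\<^sup>2)"
    using e3 by (intro mult_right_mono) auto
  finally show ?thesis by simp
qed

section \<open>Uniform grids and quadratic variation along them\<close>

definition grid :: "real \<Rightarrow> nat \<Rightarrow> nat \<Rightarrow> real" where
  "grid t n k = real k * t / real (Suc n)"

lemma grid_0 [simp]: "grid t n 0 = 0"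
  and grid_last [simp]: "grid t n (Suc n) = t"
  by (simp_all add: grid_def)

lemma grid_diff: "grid t n (Suc k) - grid t n k = t / real (Suc n)"
  by (simp add: grid_def diff_divide_distrib[symmetric] left_diff_distrib[symmetric])

lemma grid_nonneg: "0 \<le> t \<Longrightarrow> 0 \<le> grid t n k"
  by (simp add: grid_def)

lemma grid_le: "0 \<le> t \<Longrightarrow> k \<le> Suc n \<Longrightarrow> grid t n k \<le> t"
  unfolding grid_def by (simp add: divide_le_eq mult.commute[of t] mult_right_mono)

lemma grid_mono_Suc: "0 \<le> t \<Longrightarrow> grid t n k \<le> grid t n (Suc k)"
  using grid_diff[of t n k] by (smt (verit) divide_nonneg_nonneg of_nat_0_le_iff)

lemma grid_mesh:
  assumes "\<epsilon> > 0" shows "\<forall>\<^sub>F n in sequentially. t / real (Suc n) < \<epsilon>"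
proof -
  have "(\<lambda>n. t * inverse (real (Suc n))) \<longlonglongrightarrow> t * 0"
    by (intro tendsto_intros LIMSEQ_inverse_real_of_nat)
  then show ?thesis using order_tendstoD(2) assms by (fastforce simp: divide_inverse)
qed

lemma grid_oscillation:
  fixes X :: "real \<Rightarrow> real"
  assumes "0 \<le> t" "continuous_on {0..t} X" "\<epsilon> > 0"
  shows "\<forall>\<^sub>F n in sequentially. \<forall>k<Suc n. \<bar>X (grid t n (Suc k)) - X (grid t n k)\<bar> < \<epsilon>"
proof -
  have "uniformly_continuous_on {0..t} X"
    using assms(2) compact_Icc compact_uniformly_continuous by blast
  then obtain d where d: "d > 0" and
    ud: "\<And>u v. u \<in> {0..t} \<Longrightarrow> v \<in> {0..t} \<Longrightarrow> dist v u < d \<Longrightarrow> dist (X v) (X u) < \<epsilon>"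
    using assms(3) unfolding uniformly_continuous_on_def by metis
  show ?thesis using grid_mesh[OF d, of t]
  proof eventually_elim
    case (elim n)
    show ?case
    proof (intro allI impI)
      fix k assume "k < Suc n"
      then show "\<bar>X (grid t n (Suc k)) - X (grid t n k)\<bar> < \<epsilon>"
        using ud[of "grid t n k" "grid t n (Suc k)"] elim assms(1)
          grid_nonneg[OF assms(1), of n] grid_le[OF assms(1), of _ n]
          grid_diff[of t n k] by (auto simp: dist_real_def)
    qed
  qed
qed

text \<open>
  Since \<open>C\<close> is monotone, \<open>X - y\<close> has bounded variation, so \<open>X\<close> and \<open>y\<close> have the same quadratic
  variation; and \<open>exp a - 1 - a\<close> is \<open>a\<^sup>2 / 2\<close> up to third order.
\<close>

lemma exp_sum_eq_half_quadratic_variation: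
  fixes t :: real and X y C :: "real \<Rightarrow> real" and r :: "nat \<Rightarrow> nat"
  defines "dX \<equiv> \<lambda>n k. X (grid t n (Suc k)) - X (grid t n k)"
  defines "dy \<equiv> \<lambda>n k. y (grid t n (Suc k)) - y (grid t n k)"
  assumes t: "0 \<le> t" and r: "strict_mono r"
    and contX: "continuous_on {0..t} X" and conty: "continuous_on {0..t} y"
    and C: "\<And>u. u \<in> {0..t} \<Longrightarrow> C u = \<mu> * u + y u - X u"
    and mono: "\<And>n k. k < Suc n \<Longrightarrow> C (grid t n k) \<le> C (grid t n (Suc k))"
    and c: "(\<lambda>i. \<Sum>k<Suc (r i). exp (dX (r i) k) - 1 - dX (r i) k) \<longlonglongrightarrow> c"
    and v: "(\<lambda>i. \<Sum>k<Suc (r i). (dy (r i) k)\<^sup>2) \<longlonglongrightarrow> v"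
  shows "c = v / 2"
proof -
  \<comment> \<open>\<open>W\<close> bounds the variation of \<open>X - y\<close> on the interval:
    the drift gives \<open>\<bar>\<mu>\<bar> * t\<close>, the monotone part
    \<open>C t - C 0\<close>. The \<open>d n k\<close> are its shares on the cells and add up to
    \<open>W\<close> on every grid.\<close>
  define W where "W = \<bar>\<mu>\<bar> * t + C t - C 0"
  define d where "d = (\<lambda>n k. \<bar>\<mu>\<bar> * (t / real (Suc n)) + (C (grid t n (Suc k)) - C (grid t n k)))"
  define S where "S = (\<lambda>n. \<Sum>k<Suc n. exp (dX n k) - 1 - dX n k)"
  define V where "V = (\<lambda>n. \<Sum>k<Suc n. (dy n k)\<^sup>2)"
  have sumd: "(\<Sum>k<Suc n. d n k) = W" for n
  proof -
    have "(\<Sum>k<Suc n. C (grid t n (Suc k)) - C (grid t n k)) = C t - C 0"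
      using sum_lessThan_telescope[of "\<lambda>k. C (grid t n k)" "Suc n"] by (simp del: sum.lessThan_Suc)
    then show ?thesis
      unfolding d_def W_def sum.distrib by (simp del: sum.lessThan_Suc)
  qed
  have d0: "0 \<le> d n k" if "k < Suc n" for n k
    using mono[OF that] t unfolding d_def by (simp add: add_nonneg_nonneg)
  have W0: "0 \<le> W" using sumd[of 0] d0 by (metis sum_nonneg lessThan_iff)
  have dXy: "\<bar>dX n k - dy n k\<bar> \<le> d n k" if "k < Suc n" for n k
  proof -
    have g: "grid t n k \<in> {0..t}" "grid t n (Suc k) \<in> {0..t}"
      using that t by (auto intro: grid_nonneg grid_le)
    have "dX n k - dy n k = \<mu> * (t / real (Suc n)) - (C (grid t n (Suc k)) - C (grid t n k))"
      unfolding dX_def dy_def C[OF g(1)] C[OF g(2)] grid_diff[of t n k, symmetric]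
      by (simp add: algebra_simps)
    moreover have "\<bar>\<mu> * (t / real (Suc n))\<bar> = \<bar>\<mu>\<bar> * (t / real (Suc n))"
      using t by (simp add: abs_mult)
    ultimately show ?thesis
      using mono[OF that] unfolding d_def by linarith
  qed
  \<comment> \<open>Per cell, Taylor's remainder costs \<open>e * b\<^sup>2 + 2 * e * d\<close>
    (using \<open>e \<le> 1\<close>) and replacing \<open>a\<^sup>2 / 2\<close> by
    \<open>b\<^sup>2 / 2\<close> costs \<open>e * d\<close>; the factors 2 and 5 leave room.\<close>
  have close: "\<forall>\<^sub>F n in sequentially. \<bar>S n - V n / 2\<bar> \<le> e * (2 * V n + 5 * W)"
    if e: "0 < e" "e \<le> 1" for e
    using grid_oscillation[OF t contX e(1)] grid_oscillation[OF t conty e(1)]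
  proof eventually_elim
    case (elim n)
    have "\<bar>(exp (dX n k) - 1 - dX n k) - (dy n k)\<^sup>2 / 2\<bar> \<le> e * (2 * (dy n k)\<^sup>2 + 5 * d n k)"
      if k: "k < Suc n" for k
    proof -
      let ?a = "dX n k" and ?b = "dy n k" and ?d = "d n k"
      have a: "\<bar>?a\<bar> \<le> e" and b: "\<bar>?b\<bar> \<le> e"
        using elim k unfolding dX_def dy_def by (auto intro: less_imp_le)
      have "\<bar>?a\<^sup>2 - ?b\<^sup>2\<bar> = \<bar>?a - ?b\<bar> * \<bar>?a + ?b\<bar>"
        by (simp add: power2_eq_square square_diff_square_factored abs_mult mult.commute)
      also have "\<dots> \<le> ?d * (2 * e)"
        using dXy[OF k] d0[OF k] a b by (intro mult_mono) auto
      finally have sq: "\<bar>?a\<^sup>2 - ?b\<^sup>2\<bar> \<le> 2 * e * ?d" by (simp only: mult_ac)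
      have "\<bar>exp ?a - 1 - ?a - ?a\<^sup>2 / 2\<bar> \<le> \<bar>?a\<bar> * ?a\<^sup>2"
        using exp_taylor_order2 a e by simp
      also have "\<dots> \<le> e * (?b\<^sup>2 + 2 * e * ?d)"
        using a sq by (intro mult_mono) auto
      also have "\<dots> \<le> e * (?b\<^sup>2 + 2 * ?d)"
        using e d0[OF k] by (intro mult_left_mono) (auto simp: mult_left_le_one_le)
      finally have "\<bar>exp ?a - 1 - ?a - ?a\<^sup>2 / 2\<bar> \<le> e * ?b\<^sup>2 + 2 * (e * ?d)"
        by (simp add: algebra_simps)
      moreover have "0 \<le> e * ?d" "0 \<le> e * ?b\<^sup>2" using e d0[OF k] by auto
      ultimately show ?thesis using sq unfolding distrib_left by linarith
    qed
    then have "\<bar>\<Sum>k<Suc n. (exp (dX n k) - 1 - dX n k) - (dy n k)\<^sup>2 / 2\<bar>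
        \<le> (\<Sum>k<Suc n. e * (2 * (dy n k)\<^sup>2 + 5 * d n k))"
      by (intro order_trans[OF sum_abs] sum_mono) auto
    moreover have "(\<Sum>k<Suc n. (exp (dX n k) - 1 - dX n k) - (dy n k)\<^sup>2 / 2) = S n - V n / 2"
      unfolding S_def V_def sum_divide_distrib sum_subtractf ..
    moreover have "(\<Sum>k<Suc n. e * (2 * (dy n k)\<^sup>2 + 5 * d n k)) = e * (2 * V n + 5 * W)"
      unfolding V_def sumd[of n, symmetric] sum_distrib_left[symmetric] sum.distrib ..
    ultimately show ?case by simp
  qed
  have "(\<lambda>i. S (r i) - V (r i) / 2) \<longlonglongrightarrow> 0"
  proof (rule LIMSEQ_I)
    fix e :: real assume e: "0 < e"
    have V0: "0 \<le> V n" for n unfolding V_def by (intro sum_nonneg) auto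
    have v0: "0 \<le> v" using LIMSEQ_le_const[of "\<lambda>i. V (r i)" v 0] v V0 unfolding V_def by blast
    \<comment> \<open>\<open>v + 1\<close> bounds \<open>V (r i)\<close> eventually, so
      \<open>K\<close> bounds the bracket in \<open>close\<close>, and \<open>e'\<close> makes the
      product at most \<open>e / 2\<close>.\<close>
    define K where "K = 2 * (v + 1) + 5 * W"
    have K: "K > 0" using v0 W0 unfolding K_def by (simp add: add_pos_nonneg)
    define e' where "e' = min 1 (e / (2 * K))"
    have e': "0 < e'" "e' \<le> 1" using e K unfolding e'_def by auto
    have "\<forall>\<^sub>F i in sequentially. \<bar>S (r i) - V (r i) / 2\<bar> \<le> e' * (2 * V (r i) + 5 * W)"
      using eventually_compose_filterlim[OF close[OF e'] filterlim_subseq[OF r]] .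
    moreover have "\<forall>\<^sub>F i in sequentially. V (r i) < v + 1"
      using order_tendstoD(2)[OF v, of "v + 1"] unfolding V_def by simp
    ultimately have "\<forall>\<^sub>F i in sequentially. norm (S (r i) - V (r i) / 2 - 0) < e"
    proof eventually_elim
      case (elim i)
      have "e' * (2 * V (r i) + 5 * W) \<le> e' * K"
        using elim e' unfolding K_def by (intro mult_left_mono) auto
      also have "\<dots> \<le> e / (2 * K) * K"
        using K unfolding e'_def by (intro mult_right_mono) auto
      also have "\<dots> < e" using K e by simp
      finally show ?case using elim by simp
    qed
    then show "\<exists>no. \<forall>n\<ge>no. norm (S (r n) - V (r n) / 2 - 0) < e"
      by (simp add: eventually_sequentially)
  qed
  moreover have "(\<lambda>i. S (r i) - V (r i) / 2) \<longlonglongrightarrow> c - v / 2"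
    using c v unfolding S_def V_def by (intro tendsto_intros) auto
  ultimately show ?thesis using LIMSEQ_unique by fastforce
qed

text \<open>Truncation at 1 turns convergence in probability into convergence in mean, which has an
  almost surely convergent subsequence; along it the values are eventually below 1, where the
  truncation has no effect.\<close>

lemma (in prob_space) tendsto_prob_AE_subseq:
  fixes Z :: "nat \<Rightarrow> 'a \<Rightarrow> real"
  assumes [measurable]: "\<And>n. Z n \<in> borel_measurable M"
    and lim: "\<And>\<epsilon>. 0 < \<epsilon> \<Longrightarrow> (\<lambda>n. prob {\<omega> \<in> space M. \<epsilon> < \<bar>Z n \<omega>\<bar>}) \<longlonglongrightarrow> 0"
  obtains r where "strict_mono r" "AE \<omega> in M. (\<lambda>n. Z (r n) \<omega>) \<longlonglongrightarrow> 0"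
proof -
  define W where "W = (\<lambda>n \<omega>. min 1 \<bar>Z n \<omega>\<bar>)"
  have int: "integrable M (W n)" for n
    by (rule integrable_const_bound[where B = 1]) (auto simp: W_def)
  have "(\<lambda>n. \<integral>\<omega>. norm (W n \<omega>) \<partial>M) \<longlonglongrightarrow> 0"
  proof (rule LIMSEQ_I)
    fix e :: real assume e: "0 < e"
    have "\<forall>\<^sub>F n in sequentially. prob {\<omega> \<in> space M. e / 2 < \<bar>Z n \<omega>\<bar>} < e / 2"
      using order_tendstoD(2)[OF lim[of "e / 2"], of "e / 2"] e by simp
    then have "\<forall>\<^sub>F n in sequentially. norm ((\<integral>\<omega>. norm (W n \<omega>) \<partial>M) - 0) < e"
    proof eventually_elim
      case (elim n)
      let ?A = "{\<omega> \<in> space M. e / 2 < \<bar>Z n \<omega>\<bar>}"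
      have A: "?A \<in> events" by measurable
      have iA: "integrable M (indicator ?A :: _ \<Rightarrow> real)"
        by (rule integrable_real_indicator[OF A]) (simp add: emeasure_eq_measure)
      have "(\<integral>\<omega>. norm (W n \<omega>) \<partial>M) \<le> (\<integral>\<omega>. e / 2 + indicator ?A \<omega> \<partial>M)"
      proof (rule integral_mono)
        show "integrable M (\<lambda>\<omega>. e / 2 + indicator ?A \<omega> :: real)"
          by (rule Bochner_Integration.integrable_add[OF integrable_const iA])
      qed (use int e in \<open>auto simp: W_def indicator_def\<close>)
      also have "\<dots> = e / 2 + prob ?A"
        unfolding Bochner_Integration.integral_add[OF integrable_const iA]
        by (simp add: prob_space Int_absorb2 subset_eq)
      finally have "(\<integral>\<omega>. norm (W n \<omega>) \<partial>M) < e" using elim by simp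
      moreover have "0 \<le> (\<integral>\<omega>. norm (W n \<omega>) \<partial>M)" by simp
      ultimately show ?case by simp
    qed
    then show "\<exists>no. \<forall>n\<ge>no. norm ((\<integral>\<omega>. norm (W n \<omega>) \<partial>M) - 0) < e"
      by (simp add: eventually_sequentially)
  qed
  from tendsto_L1_AE_subseq[OF int this]
  obtain r where r: "strict_mono r" "AE \<omega> in M. (\<lambda>n. W (r n) \<omega>) \<longlonglongrightarrow> 0" by blast
  have "(\<lambda>n. Z (r n) \<omega>) \<longlonglongrightarrow> 0" if "(\<lambda>n. W (r n) \<omega>) \<longlonglongrightarrow> 0" for \<omega>
  proof -
    have "\<forall>\<^sub>F n in sequentially. W (r n) \<omega> < 1"
      using order_tendstoD(2)[OF that, of 1] by simp
    then have "\<forall>\<^sub>F n in sequentially. W (r n) \<omega> = \<bar>Z (r n) \<omega>\<bar>"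
      by eventually_elim (auto simp: W_def)
    then have "(\<lambda>n. \<bar>Z (r n) \<omega>\<bar>) \<longlonglongrightarrow> 0" using that tendsto_cong by force
    then show ?thesis using tendsto_rabs_zero_iff by blast
  qed
  then have "AE \<omega> in M. (\<lambda>n. Z (r n) \<omega>) \<longlonglongrightarrow> 0"
    using r(2) by (auto elim: eventually_mono)
  with r(1) show thesis by (rule that)
qed

section \<open>Second moments and the quadratic variation of Brownian motion\<close>

lemma (in prob_space) expectation_square_sum_indep:
  fixes Y :: "nat \<Rightarrow> 'a \<Rightarrow> real"
  assumes indep: "indep_vars (\<lambda>_. borel) Y {..<n}"
    and sq: "\<And>k. k < n \<Longrightarrow> integrable M (\<lambda>\<omega>. (Y k \<omega>)\<^sup>2)"
    and int: "\<And>k. k < n \<Longrightarrow> integrable M (Y k)"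
    and zero: "\<And>k. k < n \<Longrightarrow> expectation (Y k) = 0"
  shows "integrable M (\<lambda>\<omega>. (\<Sum>k<n. Y k \<omega>)\<^sup>2)"
    and "expectation (\<lambda>\<omega>. (\<Sum>k<n. Y k \<omega>)\<^sup>2) = (\<Sum>k<n. expectation (\<lambda>\<omega>. (Y k \<omega>)\<^sup>2))"
proof -
  have cross: "integrable M (\<lambda>\<omega>. Y j \<omega> * Y k \<omega>) \<and>
      expectation (\<lambda>\<omega>. Y j \<omega> * Y k \<omega>) = (if j = k then expectation (\<lambda>\<omega>. (Y k \<omega>)\<^sup>2) else 0)"
    if "j < n" "k < n" for j k
  proof (cases "j = k")
    case True
    then show ?thesis using sq[OF that(1)] by (simp add: power2_eq_square)
  next
    case False
    have i: "indep_vars (\<lambda>_. borel) Y {j, k}"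
      by (rule indep_vars_subset[OF indep]) (use that in auto)
    have m: "\<And>i. i \<in> {j, k} \<Longrightarrow> integrable M (Y i)" using int that by auto
    have "(\<lambda>\<omega>. \<Prod>i\<in>{j, k}. Y i \<omega>) = (\<lambda>\<omega>. Y j \<omega> * Y k \<omega>)" using False by auto
    with indep_vars_lebesgue_integral[OF _ i m] indep_vars_integrable[OF _ i m] zero[OF that(1)] False
    show ?thesis by simp
  qed
  have eq: "(\<lambda>\<omega>. (\<Sum>k<n. Y k \<omega>)\<^sup>2) = (\<lambda>\<omega>. \<Sum>j<n. \<Sum>k<n. Y j \<omega> * Y k \<omega>)"
    by (simp add: power2_eq_square sum_product)
  show "integrable M (\<lambda>\<omega>. (\<Sum>k<n. Y k \<omega>)\<^sup>2)"
    unfolding eq using cross by (intro Bochner_Integration.integrable_sum) auto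
  have "expectation (\<lambda>\<omega>. (\<Sum>k<n. Y k \<omega>)\<^sup>2) = (\<Sum>j<n. \<Sum>k<n. expectation (\<lambda>\<omega>. Y j \<omega> * Y k \<omega>))"
    unfolding eq using cross
    by (subst Bochner_Integration.integral_sum | auto intro!: Bochner_Integration.integrable_sum sum.cong)+
  also have "\<dots> = (\<Sum>j<n. expectation (\<lambda>\<omega>. (Y j \<omega>)\<^sup>2))"
    using cross by (intro sum.cong refl) (simp add: sum.delta)
  finally show "expectation (\<lambda>\<omega>. (\<Sum>k<n. Y k \<omega>)\<^sup>2) = (\<Sum>k<n. expectation (\<lambda>\<omega>. (Y k \<omega>)\<^sup>2))" .
qed

text \<open>The moments \<open>s\<^sup>2\<close> and \<open>3 * s ^ 4\<close> give the variance
  \<open>2 * s ^ 4\<close> of the square, the input to Chebyshev's inequality for the quadratic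
  variation.\<close>

lemma (in prob_space) normal_centred_square:
  assumes s: "0 < s" and X: "distributed M lborel X (normal_density 0 s)"
  shows "integrable M (\<lambda>\<omega>. (X \<omega>)\<^sup>2 - s\<^sup>2)" "expectation (\<lambda>\<omega>. (X \<omega>)\<^sup>2 - s\<^sup>2) = 0"
    "integrable M (\<lambda>\<omega>. ((X \<omega>)\<^sup>2 - s\<^sup>2)\<^sup>2)" "expectation (\<lambda>\<omega>. ((X \<omega>)\<^sup>2 - s\<^sup>2)\<^sup>2) = 2 * s ^ 4"
proof -
  have mom: "integrable M (\<lambda>\<omega>. X \<omega> ^ (2 * k))"
    "expectation (\<lambda>\<omega>. X \<omega> ^ (2 * k)) = fact (2 * k) / ((2 / s\<^sup>2) ^ k * fact k)" for k
  proof -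
    note hb = normal_moment_even[OF s, of 0 k, simplified]
    show "integrable M (\<lambda>\<omega>. X \<omega> ^ (2 * k))"
      using distributed_integrable[OF X, of "\<lambda>x. x ^ (2 * k)"] integrable.intros[OF hb] by simp
    show "expectation (\<lambda>\<omega>. X \<omega> ^ (2 * k)) = fact (2 * k) / ((2 / s\<^sup>2) ^ k * fact k)"
      using distributed_integral[OF X, of "\<lambda>x. x ^ (2 * k)"] has_bochner_integral_integral_eq[OF hb] by simp
  qed
  have m2: "integrable M (\<lambda>\<omega>. (X \<omega>)\<^sup>2)" "expectation (\<lambda>\<omega>. (X \<omega>)\<^sup>2) = s\<^sup>2"
    using mom[of 1] s by (simp_all add: power2_eq_square)
  have m4: "integrable M (\<lambda>\<omega>. (X \<omega>) ^ 4)" "expectation (\<lambda>\<omega>. (X \<omega>) ^ 4) = 3 * s ^ 4"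
    using mom[of 2] s by (simp_all add: field_simps fact_numeral)
  show "integrable M (\<lambda>\<omega>. (X \<omega>)\<^sup>2 - s\<^sup>2)" "expectation (\<lambda>\<omega>. (X \<omega>)\<^sup>2 - s\<^sup>2) = 0"
    using m2 by (simp_all add: prob_space)
  have eq: "(\<lambda>\<omega>. ((X \<omega>)\<^sup>2 - s\<^sup>2)\<^sup>2) = (\<lambda>\<omega>. X \<omega> ^ 4 - 2 * s\<^sup>2 * (X \<omega>)\<^sup>2 + s ^ 4)"
    by (auto simp: power2_eq_square power4_eq_xxxx algebra_simps)
  show "integrable M (\<lambda>\<omega>. ((X \<omega>)\<^sup>2 - s\<^sup>2)\<^sup>2)" "expectation (\<lambda>\<omega>. ((X \<omega>)\<^sup>2 - s\<^sup>2)\<^sup>2) = 2 * s ^ 4"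
    unfolding eq using m2 m4 by (simp_all add: prob_space power2_eq_square power4_eq_xxxx)
qed

lemma brownian_increment:
  assumes "brownian_motion M B" "0 \<le> s" "s < t"
  shows "distributed M lborel (\<lambda>\<omega>. B t \<omega> - B s \<omega>) (normal_density 0 (sqrt (t - s)))"
  using assms(1)[unfolded brownian_motion_def, THEN conjunct2, THEN conjunct2, THEN conjunct2, rule_format]
    assms(2,3) by simp

text \<open>The centred squares of the \<open>Suc n\<close> increments of length
  \<open>h = t / Suc n\<close> are independent with variance \<open>2 * h\<^sup>2\<close>, so their
  sum has variance \<open>2 * t\<^sup>2 / Suc n\<close>; Chebyshev's inequality concludes.\<close>

lemma (in prob_space) brownian_quadratic_variation:
  assumes bm: "brownian_motion M B" and t: "0 < t" and \<epsilon>: "0 < \<epsilon>"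
  shows "(\<lambda>n. prob {\<omega> \<in> space M. \<epsilon> <
      \<bar>(\<Sum>k<Suc n. (B (grid t n (Suc k)) \<omega> - B (grid t n k) \<omega>)\<^sup>2) - t\<bar>}) \<longlonglongrightarrow> 0"
proof (rule tendsto_sandwich[OF _ _ tendsto_const])
  have Bm: "B s \<in> borel_measurable M" if "0 \<le> s" for s
    using bm that by (simp add: brownian_motion_def)
  have Bg[measurable]: "B (grid t n k) \<in> borel_measurable M" for n k
    using Bm grid_nonneg t by simp
  let ?b = "\<lambda>n. 2 * t\<^sup>2 / \<epsilon>\<^sup>2 * inverse (real (Suc n))"
  show "\<forall>\<^sub>F n in sequentially. prob {\<omega> \<in> space M. \<epsilon> <
      \<bar>(\<Sum>k<Suc n. (B (grid t n (Suc k)) \<omega> - B (grid t n k) \<omega>)\<^sup>2) - t\<bar>} \<le> ?b n"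
  proof (intro always_eventually allI)
    fix n
    define h where "h = t / real (Suc n)"
    have h: "0 < h" using t by (simp add: h_def)
    define D where "D = (\<lambda>k \<omega>. B (grid t n (Suc k)) \<omega> - B (grid t n k) \<omega>)"
    define Y where "Y = (\<lambda>k \<omega>. (D k \<omega>)\<^sup>2 - (sqrt h)\<^sup>2)"
    define Z where "Z = (\<lambda>\<omega>. \<Sum>k<Suc n. Y k \<omega>)"
    have lt: "grid t n k < grid t n (Suc k)" for k
      using grid_diff[of t n k] h by (simp add: h_def)
    have "indep_increments M borel B" using bm by (simp add: brownian_motion_def)
    from this[unfolded indep_increments_def, rule_format, of "grid t n" "Suc n"]
    have indD: "indep_vars (\<lambda>_. borel) D {..<Suc n}"
      unfolding D_def using lt by simp
    have indY: "indep_vars (\<lambda>_. borel) Y {..<Suc n}"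
      unfolding Y_def by (rule indep_vars_compose2[OF indD]) simp
    have dD: "distributed M lborel (D k) (normal_density 0 (sqrt h))" for k
      using brownian_increment[OF bm grid_nonneg lt[of k]] t unfolding D_def h_def grid_diff by simp
    have s: "0 < sqrt h" using h by simp
    have nc: "integrable M (Y k)" "expectation (Y k) = 0" "integrable M (\<lambda>\<omega>. (Y k \<omega>)\<^sup>2)"
      "expectation (\<lambda>\<omega>. (Y k \<omega>)\<^sup>2) = 2 * sqrt h ^ 4" for k
      unfolding Y_def by (rule normal_centred_square[OF s dD])+
    note sq = expectation_square_sum_indep[OF indY]
    have sqi: "integrable M (\<lambda>\<omega>. (Z \<omega>)\<^sup>2)"
      unfolding Z_def by (rule sq(1)) (use nc in auto)
    have "expectation (\<lambda>\<omega>. (Z \<omega>)\<^sup>2) = (\<Sum>k<Suc n. expectation (\<lambda>\<omega>. (Y k \<omega>)\<^sup>2))"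
      unfolding Z_def by (rule sq(2)) (use nc in auto)
    also have "\<dots> = real (Suc n) * (2 * (sqrt h) ^ 4)"
      using nc(4) by (simp del: sum.lessThan_Suc)
    also have "\<dots> = 2 * t\<^sup>2 * inverse (real (Suc n))"
    proof -
      have "(sqrt h) ^ 4 = h\<^sup>2"
        using h by (simp add: power4_eq_xxxx power2_eq_square mult.assoc[symmetric])
      moreover have "real (Suc n) * h = t" by (simp add: h_def)
      ultimately have "real (Suc n) * (2 * (sqrt h) ^ 4) = 2 * t * h"
        by (simp add: power2_eq_square del: of_nat_Suc)
      then show ?thesis by (simp add: h_def power2_eq_square divide_inverse)
    qed
    finally have ez: "expectation (\<lambda>\<omega>. (Z \<omega>)\<^sup>2) = 2 * t\<^sup>2 * inverse (real (Suc n))" .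
    have Zi: "integrable M Z" unfolding Z_def using nc by auto
    have Z0: "expectation Z = 0"
      unfolding Z_def using nc by (subst Bochner_Integration.integral_sum) auto
    have Zm[measurable]: "Z \<in> borel_measurable M" using Zi by auto
    have Zeq: "Z \<omega> = (\<Sum>k<Suc n. (D k \<omega>)\<^sup>2) - t" for \<omega>
      unfolding Z_def Y_def sum_subtractf using h by (simp add: h_def del: sum.lessThan_Suc)
    have "prob {\<omega> \<in> space M. \<epsilon> < \<bar>Z \<omega>\<bar>} \<le> prob {\<omega> \<in> space M. \<epsilon> \<le> \<bar>Z \<omega> - expectation Z\<bar>}"
      by (rule finite_measure_mono) (auto simp: Z0)
    also have "\<dots> \<le> variance Z / \<epsilon>\<^sup>2"
      by (rule Chebyshev_inequality[OF Zm sqi \<epsilon>])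
    also have "\<dots> = ?b n" unfolding Z0 diff_0_right ez by (simp add: divide_inverse mult_ac)
    finally show "prob {\<omega> \<in> space M. \<epsilon> <
      \<bar>(\<Sum>k<Suc n. (B (grid t n (Suc k)) \<omega> - B (grid t n k) \<omega>)\<^sup>2) - t\<bar>} \<le> ?b n"
      unfolding Zeq D_def .
  qed
  have "?b \<longlonglongrightarrow> 2 * t\<^sup>2 / \<epsilon>\<^sup>2 * 0"
    by (intro tendsto_intros LIMSEQ_inverse_real_of_nat)
  then show "?b \<longlonglongrightarrow> 0" by simp
qed (simp add: always_eventually)

text \<open>Serves to extract one subsequence along which two sequences tend to 0
  simultaneously.\<close>

lemma (in prob_space) prob_abs_add_tendsto_0:
  fixes U V :: "nat \<Rightarrow> 'a \<Rightarrow> real"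
  assumes [measurable]: "\<And>n. U n \<in> borel_measurable M" "\<And>n. V n \<in> borel_measurable M"
    and U: "\<And>\<epsilon>. 0 < \<epsilon> \<Longrightarrow> (\<lambda>n. prob {\<omega> \<in> space M. \<epsilon> < \<bar>U n \<omega>\<bar>}) \<longlonglongrightarrow> 0"
    and V: "\<And>\<epsilon>. 0 < \<epsilon> \<Longrightarrow> (\<lambda>n. prob {\<omega> \<in> space M. \<epsilon> < \<bar>V n \<omega>\<bar>}) \<longlonglongrightarrow> 0"
    and \<epsilon>: "0 < \<epsilon>"
  shows "(\<lambda>n. prob {\<omega> \<in> space M. \<epsilon> < \<bar>\<bar>U n \<omega>\<bar> + \<bar>V n \<omega>\<bar>\<bar>}) \<longlonglongrightarrow> 0"
proof (rule tendsto_sandwich[OF _ _ tendsto_const])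
  let ?U = "\<lambda>n. {\<omega> \<in> space M. \<epsilon> / 2 < \<bar>U n \<omega>\<bar>}" and ?V = "\<lambda>n. {\<omega> \<in> space M. \<epsilon> / 2 < \<bar>V n \<omega>\<bar>}"
  have "prob {\<omega> \<in> space M. \<epsilon> < \<bar>\<bar>U n \<omega>\<bar> + \<bar>V n \<omega>\<bar>\<bar>} \<le> prob (?U n \<union> ?V n)" for n
    by (rule finite_measure_mono) auto
  also have "prob (?U n \<union> ?V n) \<le> prob (?U n) + prob (?V n)" for n
    by (rule measure_Un_le) measurable
  finally show "\<forall>\<^sub>F n in sequentially. prob {\<omega> \<in> space M. \<epsilon> < \<bar>\<bar>U n \<omega>\<bar> + \<bar>V n \<omega>\<bar>\<bar>}
      \<le> prob (?U n) + prob (?V n)"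
    by (intro always_eventually allI)
  show "(\<lambda>n. prob (?U n) + prob (?V n)) \<longlonglongrightarrow> 0"
    using tendsto_add[OF U[of "\<epsilon> / 2"] V[of "\<epsilon> / 2"]] \<epsilon> by simp
qed (simp add: always_eventually)

section \<open>Partitions for the Riemann sums\<close>

lemma grid_partition:
  assumes "0 \<le> t" shows "partitions_vanishing_mesh t Suc (grid t)"
proof -
  have "\<forall>\<^sub>F n in sequentially. \<forall>k<Suc n. grid t n (Suc k) - grid t n k < \<epsilon>" if "0 < \<epsilon>" for \<epsilon>
    using grid_mesh[OF that, of t] by eventually_elim (simp add: grid_diff)
  then show ?thesis
    unfolding partitions_vanishing_mesh_def using grid_mono_Suc[OF assms] by simp
qed

text \<open>The uniform grid of \<open>[0, s]\<close> followed by that of \<open>[s, t]\<close>: a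
  Riemann sum up to \<open>t\<close> then contains the one up to \<open>s\<close> on
  \<open>grid s n\<close> term by term, which allows the two limits to be compared.\<close>

definition split_grid :: "real \<Rightarrow> real \<Rightarrow> nat \<Rightarrow> nat \<Rightarrow> real" where
  "split_grid s t n k = (if k \<le> Suc n then grid s n k else s + grid (t - s) n (k - Suc n))"

lemma split_grid_partition:
  assumes "0 \<le> s" "s \<le> t"
  shows "partitions_vanishing_mesh t (\<lambda>n. Suc n + Suc n) (split_grid s t)"
proof -
  have step: "split_grid s t n (Suc k) - split_grid s t n k = s / real (Suc n) \<or>
      split_grid s t n (Suc k) - split_grid s t n k = (t - s) / real (Suc n)" for n k
  proof (cases "k \<le> n")
    case True
    then show ?thesis using grid_diff[of s n k] by (simp add: split_grid_def)
  next
    case False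
    \<comment> \<open>At the junction \<open>k = Suc n\<close> both branches of the definition give
      \<open>s\<close>.\<close>
    then have "split_grid s t n k = s + grid (t - s) n (k - Suc n)"
      by (cases "k = Suc n") (auto simp: split_grid_def)
    then show ?thesis
      using False grid_diff[of "t - s" n "k - Suc n"] by (simp add: split_grid_def Suc_diff_Suc)
  qed
  have le: "split_grid s t n k \<le> split_grid s t n (Suc k)" for n k
  proof -
    have "0 \<le> s / real (Suc n)" "0 \<le> (t - s) / real (Suc n)" using assms by auto
    then show ?thesis using step[of n k] by linarith
  qed
  have mesh: "\<forall>\<^sub>F n in sequentially. \<forall>k<Suc n + Suc n. split_grid s t n (Suc k) - split_grid s t n k < \<epsilon>"
    if "0 < \<epsilon>" for \<epsilon>
    using grid_mesh[OF that, of s] grid_mesh[OF that, of "t - s"]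
  proof eventually_elim
    case (elim n)
    then show ?case using step[of n] by metis
  qed
  have ends: "split_grid s t n 0 = 0" "split_grid s t n (Suc n + Suc n) = t" for n
    using grid_last[of "t - s" n] by (simp_all add: split_grid_def)
  show ?thesis
    unfolding partitions_vanishing_mesh_def using ends le mesh by blast
qed

lemma sum_split_grid:
  fixes G :: "real \<Rightarrow> real \<Rightarrow> 'a::comm_monoid_add"
  shows
  "(\<Sum>k<Suc n + Suc n. G (split_grid s t n k) (split_grid s t n (Suc k))) =
   (\<Sum>k<Suc n. G (grid s n k) (grid s n (Suc k))) +
   (\<Sum>k<Suc n. G (s + grid (t - s) n k) (s + grid (t - s) n (Suc k)))"
proof -
  have add: "(\<Sum>k<m + j. H k) = (\<Sum>k<m. H k) + (\<Sum>k<j. H (m + k))"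
    for H :: "nat \<Rightarrow> 'a" and m j
    by (induction j) (simp_all add: add.assoc)
  have A: "(\<Sum>k<Suc n. G (split_grid s t n k) (split_grid s t n (Suc k)))
      = (\<Sum>k<Suc n. G (grid s n k) (grid s n (Suc k)))"
    by (intro sum.cong) (auto simp: split_grid_def)
  have eq: "split_grid s t n (Suc n + k) = s + grid (t - s) n k" for k
    by (cases k) (auto simp: split_grid_def)
  have B: "(\<Sum>k<Suc n. G (split_grid s t n (Suc n + k)) (split_grid s t n (Suc (Suc n + k))))
      = (\<Sum>k<Suc n. G (s + grid (t - s) n k) (s + grid (t - s) n (Suc k)))"
    by (intro sum.cong refl) (simp only: eq add_Suc_right[symmetric])
  have "(\<Sum>k<Suc n + Suc n. G (split_grid s t n k) (split_grid s t n (Suc k)))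
    = (\<Sum>k<Suc n. G (split_grid s t n k) (split_grid s t n (Suc k)))
    + (\<Sum>k<Suc n. G (split_grid s t n (Suc n + k)) (split_grid s t n (Suc (Suc n + k))))"
    by (rule add)
  then show ?thesis unfolding A B .
qed

lemma sum_telescope_minus:
  fixes X :: "real \<Rightarrow> real"
  shows "(\<Sum>k<m. H k - (X (s (Suc k)) - X (s k))) = (\<Sum>k<m. H k) - (X (s m) - X (s 0))"
  by (subst sum_subtractf, subst sum_lessThan_telescope[of "\<lambda>k. X (s k)"], rule refl)

text \<open>
  With \<open>X = ln (P / p0)\<close> and \<open>C t = \<mu> t + \<sigma> B\<^sub>t - X\<^sub>t\<close>, the Riemann sums of \<open>1 / P\<close> against \<open>P\<close>,
  less the telescoping sum of \<open>X\<close>, are \<open>\<Sum> (exp \<Delta>X - 1 - \<Delta>X)\<close>. The summands are nonnegative, so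
  their limit \<open>C\<close> is nondecreasing; hence \<open>X\<close> has the quadratic variation of \<open>\<sigma> B\<close> and
  \<open>C t = \<sigma>\<^sup>2 t / 2\<close>.
\<close>

lemma price_process_eq:
  assumes "prob_space M" and bm: "brownian_motion M B" and p0: "0 < p0"
    and price: "price_process M \<mu> \<sigma> B p0 P"
  shows "AE \<omega> in M. \<forall>t\<ge>0. P t \<omega> = p0 * exp ((\<mu> - \<sigma>\<^sup>2 / 2) * t + \<sigma> * B t \<omega>)"
proof -
  interpret prob_space M by fact
  have Pm: "P t \<in> borel_measurable M" if "0 \<le> t" for t
    using price that by (simp add: price_process_def)
  have Bm: "B t \<in> borel_measurable M" if "0 \<le> t" for t
    using bm that by (simp add: brownian_motion_def)
  have P0: "P 0 \<omega> = p0" and Pc: "continuous_on {0..} (\<lambda>t. P t \<omega>)"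
    and Ppos: "0 \<le> t \<Longrightarrow> 0 < P t \<omega>" if "\<omega> \<in> space M" for \<omega> t
    using price that by (auto simp: price_process_def)
  have B0: "B 0 \<omega> = 0" and Bc: "continuous_on {0..} (\<lambda>t. B t \<omega>)" if "\<omega> \<in> space M" for \<omega>
    using bm that by (auto simp: brownian_motion_def)
  define X where "X = (\<lambda>t \<omega>. ln (P t \<omega> / p0))"
  define C where "C = (\<lambda>t \<omega>. \<mu> * t + \<sigma> * B t \<omega> - X t \<omega>)"
  define Q where "Q = (\<lambda>a :: real. exp a - 1 - a)"
  define S where "S = (\<lambda>m s \<omega>. \<Sum>k<(m::nat). Q (X (s (Suc k)) \<omega> - X (s k) \<omega>))"
  have Xm: "X t \<in> borel_measurable M" if "0 \<le> t" for t
    using Pm[OF that] unfolding X_def by measurable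
  have Cm: "C t \<in> borel_measurable M" if "0 \<le> t" for t
    using Xm[OF that] Bm[OF that] unfolding C_def by measurable
  have Xc: "continuous_on {0..} (\<lambda>t. X t \<omega>)" if "\<omega> \<in> space M" for \<omega>
    unfolding X_def using Pc[OF that] Ppos[OF that] p0
    by (intro continuous_intros) (auto simp: less_le)
  have Q0: "0 \<le> Q a" for a unfolding Q_def using exp_ge_add_one_self[of a] by linarith
  have Sm: "S m s \<in> borel_measurable M" if "\<And>k. k \<le> m \<Longrightarrow> 0 \<le> s k" for m s
    unfolding S_def Q_def using that Xm
    by (intro borel_measurable_sum borel_measurable_diff borel_measurable_exp
        borel_measurable_const measurable_compose[OF _ borel_measurable_exp]) auto
  \<comment> \<open>The exponential of an increment of \<open>X\<close> is a price ratio, so the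
    identity holds exactly on every partition; \<open>X\<close> starts at 0 because it is normalised
    by \<open>p0\<close>.\<close>
  have S_eq: "S m s \<omega> = (\<Sum>k<m. 1 / P (s k) \<omega> * (P (s (Suc k)) \<omega> - P (s k) \<omega>)) - X (s m) \<omega>"
    if "\<omega> \<in> space M" "s 0 = 0" "\<And>k. k \<le> m \<Longrightarrow> 0 \<le> s k" for m s \<omega>
  proof -
    have "exp (X (s (Suc k)) \<omega> - X (s k) \<omega>) - 1 = 1 / P (s k) \<omega> * (P (s (Suc k)) \<omega> - P (s k) \<omega>)"
      if k: "k < m" for k
    proof -
      have pos: "0 < P (s (Suc k)) \<omega>" "0 < P (s k) \<omega>"
        using Ppos[OF \<open>\<omega> \<in> space M\<close>] that(1) \<open>\<And>k. k \<le> m \<Longrightarrow> 0 \<le> s k\<close> k by auto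
      then have "exp (X (s (Suc k)) \<omega> - X (s k) \<omega>) = P (s (Suc k)) \<omega> / P (s k) \<omega>"
        unfolding X_def exp_diff using p0 by simp
      then show ?thesis using pos by (simp add: field_simps)
    qed
    then have "S m s \<omega> = (\<Sum>k<m. 1 / P (s k) \<omega> * (P (s (Suc k)) \<omega> - P (s k) \<omega>)
        - (X (s (Suc k)) \<omega> - X (s k) \<omega>))"
      unfolding S_def Q_def by (intro sum.cong) auto
    also have "\<dots> = (\<Sum>k<m. 1 / P (s k) \<omega> * (P (s (Suc k)) \<omega> - P (s k) \<omega>)) - (X (s m) \<omega> - X (s 0) \<omega>)"
      by (rule sum_telescope_minus[where X = "\<lambda>t. X t \<omega>"])
    finally show ?thesis using that P0[OF that(1)] p0 by (simp add: X_def)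
  qed
  have lim: "(\<lambda>n. prob {\<omega> \<in> space M. \<epsilon> < \<bar>S (m n) (s n) \<omega> - C t \<omega>\<bar>}) \<longlonglongrightarrow> 0"
    if t: "0 \<le> t" and part: "partitions_vanishing_mesh t m s" and \<epsilon>: "0 < \<epsilon>"
      and nn: "\<And>n k. k \<le> m n \<Longrightarrow> 0 \<le> s n k" for t m s \<epsilon>
  proof -
    have ends: "s n 0 = 0" "s n (m n) = t" for n
      using part by (auto simp: partitions_vanishing_mesh_def)
    have "has_ito_integral M (\<lambda>s \<omega>. 1 / P s \<omega>) P t (\<lambda>\<omega>. \<mu> * t + \<sigma> * B t \<omega>)"
      using price t by (simp add: price_process_def)
    then have "(\<lambda>n. measure M {\<omega> \<in> space M. \<epsilon> < \<bar>(\<Sum>k<m n. 1 / P (s n k) \<omega> *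
        (P (s n (Suc k)) \<omega> - P (s n k) \<omega>)) - (\<mu> * t + \<sigma> * B t \<omega>)\<bar>}) \<longlonglongrightarrow> 0"
      using part \<epsilon> unfolding has_ito_integral_def by blast
    moreover have "{\<omega> \<in> space M. \<epsilon> < \<bar>(\<Sum>k<m n. 1 / P (s n k) \<omega> *
        (P (s n (Suc k)) \<omega> - P (s n k) \<omega>)) - (\<mu> * t + \<sigma> * B t \<omega>)\<bar>}
      = {\<omega> \<in> space M. \<epsilon> < \<bar>S (m n) (s n) \<omega> - C t \<omega>\<bar>}" for n
      using S_eq[of _ "s n" "m n"] ends nn by (auto simp: C_def)
    ultimately show ?thesis by simp
  qed
  \<comment> \<open>The sum approximating \<open>C t\<close> exceeds the one approximating
    \<open>C s\<close> by the terms of the cells in \<open>[s, t]\<close>, each a value of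
    \<open>Q\<close>. A common subsequence makes both limits hold at the same sample point.\<close>
  have mono: "AE \<omega> in M. C s \<omega> \<le> C t \<omega>" if st: "0 \<le> s" "s \<le> t" for s t
  proof -
    define U where "U = (\<lambda>n \<omega>. S (Suc n) (grid s n) \<omega> - C s \<omega>)"
    define V where "V = (\<lambda>n \<omega>. S (Suc n + Suc n) (split_grid s t n) \<omega> - C t \<omega>)"
    have nn: "0 \<le> grid s n k" "0 \<le> split_grid s t n k" for n k
      using st grid_nonneg[of s n] grid_nonneg[of "t - s" n] by (auto simp: split_grid_def)
    have m: "U n \<in> borel_measurable M" "V n \<in> borel_measurable M" for n
      unfolding U_def V_def using st nn by (auto intro!: borel_measurable_diff Sm Cm)
    have t0: "0 \<le> t" using st by simp
    obtain r where r: "strict_mono r" "AE \<omega> in M. (\<lambda>n. \<bar>U (r n) \<omega>\<bar> + \<bar>V (r n) \<omega>\<bar>) \<longlonglongrightarrow> 0"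
    proof (rule tendsto_prob_AE_subseq[of "\<lambda>n \<omega>. \<bar>U n \<omega>\<bar> + \<bar>V n \<omega>\<bar>"])
      show "(\<lambda>\<omega>. \<bar>U n \<omega>\<bar> + \<bar>V n \<omega>\<bar>) \<in> borel_measurable M" for n using m[of n] by measurable
      show "(\<lambda>n. prob {\<omega> \<in> space M. \<epsilon> < \<bar>\<bar>U n \<omega>\<bar> + \<bar>V n \<omega>\<bar>\<bar>}) \<longlonglongrightarrow> 0" if "0 < \<epsilon>" for \<epsilon>
      proof (rule prob_abs_add_tendsto_0[OF m _ _ that])
        fix e :: real assume e: "0 < e"
        show "(\<lambda>n. prob {\<omega> \<in> space M. e < \<bar>U n \<omega>\<bar>}) \<longlonglongrightarrow> 0"
          unfolding U_def by (rule lim[OF st(1) grid_partition[OF st(1)] e nn(1)])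
        show "(\<lambda>n. prob {\<omega> \<in> space M. e < \<bar>V n \<omega>\<bar>}) \<longlonglongrightarrow> 0"
          unfolding V_def by (rule lim[OF t0 split_grid_partition[OF st] e nn(2)])
      qed
    qed auto
    from r(2) show ?thesis
    proof eventually_elim
      case (elim \<omega>)
      have "S (Suc n) (grid s n) \<omega> \<le> S (Suc n + Suc n) (split_grid s t n) \<omega>" for n
        unfolding S_def sum_split_grid[where G = "\<lambda>u v. Q (X v \<omega> - X u \<omega>)"]
        using Q0 by (simp add: sum_nonneg del: sum.lessThan_Suc)
      then have "C s \<omega> - C t \<omega> \<le> \<bar>U (r n) \<omega>\<bar> + \<bar>V (r n) \<omega>\<bar>" for n
        unfolding U_def V_def by (smt (verit))
      then have "C s \<omega> - C t \<omega> \<le> 0"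
        using elim by (intro LIMSEQ_le_const) auto
      then show ?case by simp
    qed
  qed
  \<comment> \<open>\<open>U\<close> exhibits \<open>C t\<close> as a limit of the sums
    \<open>S\<close>, \<open>V\<close> gives the quadratic variation of \<open>B\<close>; both are
    needed along the same subsequence in order to equate the first limit with half of the second,
    scaled by \<open>\<sigma>\<^sup>2\<close>.\<close>
  have fixed: "AE \<omega> in M. C t \<omega> = \<sigma>\<^sup>2 * t / 2" if t: "0 < t" for t
  proof -
    define U where "U = (\<lambda>n \<omega>. S (Suc n) (grid t n) \<omega> - C t \<omega>)"
    define V where "V = (\<lambda>n \<omega>. (\<Sum>k<Suc n. (B (grid t n (Suc k)) \<omega> - B (grid t n k) \<omega>)\<^sup>2) - t)"
    have t0: "0 \<le> t" using t by simp
    have nn: "0 \<le> grid t n k" for n k using t grid_nonneg[of t n] by auto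
    have m: "U n \<in> borel_measurable M" "V n \<in> borel_measurable M" for n
      unfolding U_def V_def using t nn Bm by (auto intro!: borel_measurable_diff Sm Cm
          borel_measurable_sum borel_measurable_power)
    obtain r where r: "strict_mono r" "AE \<omega> in M. (\<lambda>n. \<bar>U (r n) \<omega>\<bar> + \<bar>V (r n) \<omega>\<bar>) \<longlonglongrightarrow> 0"
    proof (rule tendsto_prob_AE_subseq[of "\<lambda>n \<omega>. \<bar>U n \<omega>\<bar> + \<bar>V n \<omega>\<bar>"])
      show "(\<lambda>\<omega>. \<bar>U n \<omega>\<bar> + \<bar>V n \<omega>\<bar>) \<in> borel_measurable M" for n using m[of n] by measurable
      show "(\<lambda>n. prob {\<omega> \<in> space M. \<epsilon> < \<bar>\<bar>U n \<omega>\<bar> + \<bar>V n \<omega>\<bar>\<bar>}) \<longlonglongrightarrow> 0" if "0 < \<epsilon>" for \<epsilon>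
      proof (rule prob_abs_add_tendsto_0[OF m _ _ that])
        fix e :: real assume e: "0 < e"
        show "(\<lambda>n. prob {\<omega> \<in> space M. e < \<bar>U n \<omega>\<bar>}) \<longlonglongrightarrow> 0"
          unfolding U_def by (rule lim[OF t0 grid_partition[OF t0] e nn])
        show "(\<lambda>n. prob {\<omega> \<in> space M. e < \<bar>V n \<omega>\<bar>}) \<longlonglongrightarrow> 0"
          unfolding V_def by (rule brownian_quadratic_variation[OF bm t e])
      qed
    qed auto
    \<comment> \<open>The null set in \<open>mono\<close> depends on the two times; the cells of all
      grids are countably many, so one null set suffices here.\<close>
    have "AE \<omega> in M. \<forall>n k. C (grid t n k) \<omega> \<le> C (grid t n (Suc k)) \<omega>"
      unfolding AE_all_countable using mono grid_mono_Suc[OF t0] nn by blast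
    with r(2) AE_space show ?thesis
    proof eventually_elim
      case (elim \<omega>)
      have Ulim: "(\<lambda>n. U (r n) \<omega>) \<longlonglongrightarrow> 0" and Vlim: "(\<lambda>n. V (r n) \<omega>) \<longlonglongrightarrow> 0"
        by (rule tendsto_rabs_zero_cancel, rule tendsto_sandwich[OF _ _ tendsto_const elim(1)], auto)+
      have "C t \<omega> = (\<sigma>\<^sup>2 * t) / 2"
      proof (rule exp_sum_eq_half_quadratic_variation[OF t0 r(1),
            where X = "\<lambda>u. X u \<omega>" and y = "\<lambda>u. \<sigma> * B u \<omega>" and C = "\<lambda>u. C u \<omega>" and \<mu> = \<mu>])
        show "continuous_on {0..t} (\<lambda>u. X u \<omega>)" "continuous_on {0..t} (\<lambda>u. \<sigma> * B u \<omega>)"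
          using Xc[OF elim(2)] Bc[OF elim(2)]
          by (auto intro!: continuous_intros elim!: continuous_on_subset)
        show "C u \<omega> = \<mu> * u + \<sigma> * B u \<omega> - X u \<omega>" for u by (simp add: C_def)
        show "C (grid t n k) \<omega> \<le> C (grid t n (Suc k)) \<omega>" for n k using elim(3) by blast
        show "(\<lambda>i. \<Sum>k<Suc (r i). exp (X (grid t (r i) (Suc k)) \<omega> - X (grid t (r i) k) \<omega>) - 1 -
            (X (grid t (r i) (Suc k)) \<omega> - X (grid t (r i) k) \<omega>)) \<longlonglongrightarrow> C t \<omega>"
          using tendsto_add[OF Ulim tendsto_const[of "C t \<omega>"]] unfolding U_def S_def Q_def by simp
        have "(\<lambda>i. \<sigma>\<^sup>2 * (V (r i) \<omega> + t)) \<longlonglongrightarrow> \<sigma>\<^sup>2 * (0 + t)"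
          by (intro tendsto_intros Vlim)
        then show "(\<lambda>i. \<Sum>k<Suc (r i). (\<sigma> * B (grid t (r i) (Suc k)) \<omega> - \<sigma> * B (grid t (r i) k) \<omega>)\<^sup>2)
            \<longlonglongrightarrow> \<sigma>\<^sup>2 * t"
          unfolding V_def by (simp add: sum_distrib_left right_diff_distrib[symmetric]
              power_mult_distrib del: sum.lessThan_Suc)
      qed
      then show ?case .
    qed
  qed
  \<comment> \<open>Rational times bring the null sets of \<open>fixed\<close> down to a single one;
    continuity of the paths then extends the identity to all times, time 0 included.\<close>
  have "AE \<omega> in M. \<forall>q::rat. 0 < q \<longrightarrow> C (of_rat q) \<omega> = \<sigma>\<^sup>2 * of_rat q / 2"
    unfolding AE_all_countable using fixed by (auto simp: zero_less_of_rat_iff)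
  with AE_space show ?thesis
  proof eventually_elim
    case (elim \<omega>)
    have Cc: "continuous_on {0..} (\<lambda>t. C t \<omega> - \<sigma>\<^sup>2 * t / 2)"
      unfolding C_def by (intro continuous_intros Bc Xc elim) auto
    have zero: "C t \<omega> - \<sigma>\<^sup>2 * t / 2 = 0" if "t \<in> {0..}" for t
    proof (rule continuous_constant_on_closure[of "{0<..} \<inter> \<rat>" "\<lambda>t. C t \<omega> - \<sigma>\<^sup>2 * t / 2"])
      have cl: "closure ({0<..} \<inter> \<rat>) = {0::real..}"
        using closure_open_Int_superset[of "{0::real<..}" \<rat>] Rats_closure_real by simp
      then show "t \<in> closure ({0<..} \<inter> \<rat>)" using that by simp
      show "continuous_on (closure ({0<..} \<inter> \<rat>)) (\<lambda>t. C t \<omega> - \<sigma>\<^sup>2 * t / 2)"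
        unfolding cl by (rule Cc)
      show "C x \<omega> - \<sigma>\<^sup>2 * x / 2 = 0" if "x \<in> {0<..} \<inter> \<rat>" for x
        using that elim(2) by (auto elim!: Rats_cases simp: zero_less_of_rat_iff)
    qed
    show ?case
    proof (intro allI impI)
      fix t :: real assume t: "0 \<le> t"
      have "X t \<omega> = (\<mu> - \<sigma>\<^sup>2 / 2) * t + \<sigma> * B t \<omega>"
        using zero[of t] t by (simp add: C_def left_diff_distrib)
      moreover have "exp (X t \<omega>) = P t \<omega> / p0"
        unfolding X_def using Ppos[OF elim(1) t] p0 by simp
      ultimately have "exp ((\<mu> - \<sigma>\<^sup>2 / 2) * t + \<sigma> * B t \<omega>) = P t \<omega> / p0" by simp
      then show "P t \<omega> = p0 * exp ((\<mu> - \<sigma>\<^sup>2 / 2) * t + \<sigma> * B t \<omega>)"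
        using p0 by simp
    qed
  qed
qed

section \<open>Independence and measurability\<close>

lemma (in prob_space) indep_random_elementsD:
  assumes "indep_random_elements M K X K' Y"
  shows "X \<in> measurable M K" "Y \<in> measurable M K'"
    and "A \<in> sets K \<Longrightarrow> A' \<in> sets K' \<Longrightarrow>
      prob ((X -` A \<inter> space M) \<inter> (Y -` A' \<inter> space M)) = prob (X -` A \<inter> space M) * prob (Y -` A' \<inter> space M)"
  using assms unfolding indep_random_elements_def indep_sets2_eq by blast+

lemma (in prob_space) indep_random_elementsI:
  assumes [measurable]: "X \<in> measurable M K" "Y \<in> measurable M K'"
    and "\<And>A A'. A \<in> sets K \<Longrightarrow> A' \<in> sets K' \<Longrightarrow>
      prob ((X -` A \<inter> space M) \<inter> (Y -` A' \<inter> space M)) = prob (X -` A \<inter> space M) * prob (Y -` A' \<inter> space M)"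
  shows "indep_random_elements M K X K' Y"
  using assms unfolding indep_random_elements_def indep_sets2_eq
  by (auto intro: measurable_sets)

lemma (in prob_space) distr_pair_indep_random_elements:
  assumes indep: "indep_random_elements M K X K' Y"
  shows "distr M (K \<Otimes>\<^sub>M K') (\<lambda>\<omega>. (X \<omega>, Y \<omega>)) = distr M K X \<Otimes>\<^sub>M distr M K' Y"
proof (rule sym, rule pair_measure_eqI)
  note [measurable] = indep_random_elementsD(1,2)[OF indep]
  show "sigma_finite_measure (distr M K X)" "sigma_finite_measure (distr M K' Y)"
    by (auto intro!: prob_space_imp_sigma_finite prob_space_distr)
  show "sets (distr M K X \<Otimes>\<^sub>M distr M K' Y) = sets (distr M (K \<Otimes>\<^sub>M K') (\<lambda>\<omega>. (X \<omega>, Y \<omega>)))"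
    by (simp cong: sets_pair_measure_cong)
  fix A B assume "A \<in> sets (distr M K X)" "B \<in> sets (distr M K' Y)"
  then have [measurable]: "A \<in> sets K" "B \<in> sets K'" by auto
  have "(\<lambda>\<omega>. (X \<omega>, Y \<omega>)) -` (A \<times> B) \<inter> space M = (X -` A \<inter> space M) \<inter> (Y -` B \<inter> space M)"
    by auto
  then show "emeasure (distr M K X) A * emeasure (distr M K' Y) B =
      emeasure (distr M (K \<Otimes>\<^sub>M K') (\<lambda>\<omega>. (X \<omega>, Y \<omega>))) (A \<times> B)"
    by (simp add: emeasure_distr emeasure_eq_measure indep_random_elementsD(3)[OF indep] ennreal_mult')
qed

lemma (in prob_space) indep_random_elements_compose:
  assumes indep: "indep_random_elements M K X K' Y"
    and g: "g \<in> measurable K H" and g': "g' \<in> measurable K' H'"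
  shows "indep_random_elements M H (\<lambda>\<omega>. g (X \<omega>)) H' (\<lambda>\<omega>. g' (Y \<omega>))"
proof -
  note m = indep_random_elementsD(1,2)[OF indep]
  show ?thesis
  proof (rule indep_random_elementsI)
    show "(\<lambda>\<omega>. g (X \<omega>)) \<in> measurable M H" "(\<lambda>\<omega>. g' (Y \<omega>)) \<in> measurable M H'"
      using m g g' by auto
    fix A A' assume A: "A \<in> sets H" "A' \<in> sets H'"
    have "(\<lambda>\<omega>. g (X \<omega>)) -` A \<inter> space M = X -` (g -` A \<inter> space K) \<inter> space M"
      "(\<lambda>\<omega>. g' (Y \<omega>)) -` A' \<inter> space M = Y -` (g' -` A' \<inter> space K') \<inter> space M"
      using measurable_space[OF m(1)] measurable_space[OF m(2)] by auto
    then show "prob (((\<lambda>\<omega>. g (X \<omega>)) -` A \<inter> space M) \<inter> ((\<lambda>\<omega>. g' (Y \<omega>)) -` A' \<inter> space M)) =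
        prob ((\<lambda>\<omega>. g (X \<omega>)) -` A \<inter> space M) * prob ((\<lambda>\<omega>. g' (Y \<omega>)) -` A' \<inter> space M)"
      using indep_random_elementsD(3)[OF indep measurable_sets[OF g A(1)] measurable_sets[OF g' A(2)]]
      by simp
  qed
qed

text \<open>Every event of the generated \<sigma>-algebra is a preimage under \<open>X\<close>, so
  the sample point itself can take the place of \<open>X\<close>.\<close>

lemma (in prob_space) indep_random_elements_vimage_left:
  assumes indep: "indep_random_elements M K X K' Y"
  shows "indep_random_elements M (vimage_algebra (space M) X K) (\<lambda>\<omega>. \<omega>) K' Y"
proof -
  have m: "X \<in> space M \<rightarrow> space K"
    using indep_random_elementsD(1)[OF indep] by (auto dest: measurable_space)
  show ?thesis
  proof (rule indep_random_elementsI)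
    show "(\<lambda>\<omega>. \<omega>) \<in> measurable M (vimage_algebra (space M) X K)"
      using indep_random_elementsD(1)[OF indep] by (intro measurable_vimage_algebra2) auto
    fix A A' assume A: "A \<in> sets (vimage_algebra (space M) X K)" "A' \<in> sets K'"
    then obtain S where S: "S \<in> sets K" "A = X -` S \<inter> space M"
      unfolding sets_vimage_algebra2[OF m] by auto
    have "(\<lambda>\<omega>. \<omega>) -` A \<inter> space M = X -` S \<inter> space M" using S(2) by auto
    then show "prob (((\<lambda>\<omega>. \<omega>) -` A \<inter> space M) \<inter> (Y -` A' \<inter> space M)) =
        prob ((\<lambda>\<omega>. \<omega>) -` A \<inter> space M) * prob (Y -` A' \<inter> space M)"
      using indep_random_elementsD(3)[OF indep S(1) A(2)] by simp
  qed (rule indep_random_elementsD(2)[OF indep])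
qed

lemma (in prob_space) indep_random_elements_sym:
  assumes "indep_random_elements M K X K' Y"
  shows "indep_random_elements M K' Y K X"
proof (rule indep_random_elementsI)
  fix A A' assume "A \<in> sets K'" "A' \<in> sets K"
  from indep_random_elementsD(3)[OF assms this(2,1)]
  show "prob ((Y -` A \<inter> space M) \<inter> (X -` A' \<inter> space M)) = prob (Y -` A \<inter> space M) * prob (X -` A' \<inter> space M)"
    by (simp only: Int_commute mult.commute)
qed (fact indep_random_elementsD[OF assms])+

text \<open>
  The second and third random elements enter \<open>F\<close> through the sample point itself, seen in the
  \<open>\<sigma>\<close>-algebra that each of them generates. So \<open>F\<close> may involve a path at a random time, which is
  not measurable on the product space of all paths.
\<close>

lemma (in prob_space) nn_integral_independent:
  fixes X :: "'a \<Rightarrow> 'b" and Y :: "'a \<Rightarrow> 'c" and Z :: "'a \<Rightarrow> 'd"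
    and KX :: "'b measure" and KY :: "'c measure" and KZ :: "'d measure"
  defines "FX \<equiv> vimage_algebra (space M) X KX"
  defines "FY \<equiv> vimage_algebra (space M) Y KY"
  assumes XY: "indep_random_elements M KX X KY Y"
    and ZXY: "indep_random_elements M KZ Z (KX \<Otimes>\<^sub>M KY) (\<lambda>\<omega>. (X \<omega>, Y \<omega>))"
    and F: "F \<in> borel_measurable (KZ \<Otimes>\<^sub>M (FX \<Otimes>\<^sub>M FY))"
  shows "(\<integral>\<^sup>+\<omega>. F (Z \<omega>, (\<omega>, \<omega>)) \<partial>M) =
    (\<integral>\<^sup>+\<omega>2. (\<integral>\<^sup>+\<omega>1. (\<integral>\<^sup>+u. F (u, (\<omega>1, \<omega>2)) \<partial>distr M KZ Z) \<partial>M) \<partial>M)"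
proof -
  note Zm = indep_random_elementsD(1)[OF ZXY]
  note Xm = indep_random_elementsD(1)[OF XY] and Ym = indep_random_elementsD(2)[OF XY]
  have idX: "(\<lambda>\<omega>. \<omega>) \<in> measurable M FX"
    unfolding FX_def using Xm by (intro measurable_vimage_algebra2) auto
  have idY: "(\<lambda>\<omega>. \<omega>) \<in> measurable M FY"
    unfolding FY_def using Ym by (intro measurable_vimage_algebra2) auto
  \<comment> \<open>The \<sigma>-algebra generated by the pair is fine enough to make the diagonal
    map \<open>\<omega> \<mapsto> (\<omega>, \<omega>)\<close> measurable into
    \<open>FX \<Otimes>\<^sub>M FY\<close>, so independence of \<open>Z\<close> from the pair passes
    to the diagonal.\<close>
  let ?V = "vimage_algebra (space M) (\<lambda>\<omega>. (X \<omega>, Y \<omega>)) (KX \<Otimes>\<^sub>M KY)"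
  have V: "(\<lambda>\<omega>. (X \<omega>, Y \<omega>)) \<in> measurable ?V (KX \<Otimes>\<^sub>M KY)"
    using Xm Ym by (intro measurable_vimage_algebra1) (auto simp: space_pair_measure dest: measurable_space)
  have idV: "(\<lambda>\<omega>. (\<omega>, \<omega>)) \<in> measurable ?V (FX \<Otimes>\<^sub>M FY)"
  proof (rule measurable_Pair)
    show "(\<lambda>\<omega>. \<omega>) \<in> measurable ?V FX"
      unfolding FX_def using measurable_compose[OF V measurable_fst]
      by (intro measurable_vimage_algebra2) auto
    show "(\<lambda>\<omega>. \<omega>) \<in> measurable ?V FY"
      unfolding FY_def using measurable_compose[OF V measurable_snd]
      by (intro measurable_vimage_algebra2) auto
  qed
  have "indep_random_elements M KZ Z ?V (\<lambda>\<omega>. \<omega>)"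
    by (rule indep_random_elements_sym[OF indep_random_elements_vimage_left[OF indep_random_elements_sym[OF ZXY]]])
  from indep_random_elements_compose[OF this measurable_ident_sets[OF refl] idV]
  have iZ: "indep_random_elements M KZ Z (FX \<Otimes>\<^sub>M FY) (\<lambda>\<omega>. (\<omega>, \<omega>))" by simp
  have iXY: "indep_random_elements M FX (\<lambda>\<omega>. \<omega>) FY (\<lambda>\<omega>. \<omega>)"
    unfolding FX_def FY_def
    by (rule indep_random_elements_sym[OF indep_random_elements_vimage_left[OF
          indep_random_elements_sym[OF indep_random_elements_vimage_left[OF XY]]]])
  define Q where "Q = distr M KZ Z"
  define LX where "LX = distr M FX (\<lambda>\<omega>. \<omega>)"
  define LY where "LY = distr M FY (\<lambda>\<omega>. \<omega>)"
  interpret Q: prob_space Q unfolding Q_def by (rule prob_space_distr[OF Zm])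
  interpret LX: prob_space LX unfolding LX_def by (rule prob_space_distr[OF idX])
  interpret LY: prob_space LY unfolding LY_def by (rule prob_space_distr[OF idY])
  interpret LXY: pair_sigma_finite LX LY ..
  interpret QLXY: pair_sigma_finite Q "LX \<Otimes>\<^sub>M LY" ..
  \<comment> \<open>The law of the diagonal is a product measure: the single sample point is
    replaced by independent copies, one for each source of randomness.\<close>
  have joint: "distr M (KZ \<Otimes>\<^sub>M (FX \<Otimes>\<^sub>M FY)) (\<lambda>\<omega>. (Z \<omega>, (\<omega>, \<omega>))) = Q \<Otimes>\<^sub>M (LX \<Otimes>\<^sub>M LY)"
    unfolding distr_pair_indep_random_elements[OF iZ] distr_pair_indep_random_elements[OF iXY]
      Q_def LX_def LY_def ..
  have F': "F \<in> borel_measurable (Q \<Otimes>\<^sub>M (LX \<Otimes>\<^sub>M LY))"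
    using F by (simp add: joint[symmetric])
  have F2: "(\<lambda>y. \<integral>\<^sup>+u. F (u, y) \<partial>Q) \<in> borel_measurable (LX \<Otimes>\<^sub>M LY)"
    using F' by measurable
  have "(\<integral>\<^sup>+\<omega>. F (Z \<omega>, (\<omega>, \<omega>)) \<partial>M) = integral\<^sup>N (Q \<Otimes>\<^sub>M (LX \<Otimes>\<^sub>M LY)) F"
    unfolding joint[symmetric]
    by (rule nn_integral_distr[symmetric]) (use Zm idX idY F in measurable)
  also have "\<dots> = (\<integral>\<^sup>+y. (\<integral>\<^sup>+u. F (u, y) \<partial>Q) \<partial>(LX \<Otimes>\<^sub>M LY))"
    using QLXY.nn_integral_snd[of F] F' by simp
  also have "\<dots> = (\<integral>\<^sup>+\<omega>2. (\<integral>\<^sup>+\<omega>1. (\<integral>\<^sup>+u. F (u, (\<omega>1, \<omega>2)) \<partial>Q) \<partial>LX) \<partial>LY)"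
    using LXY.nn_integral_snd[OF F2] by simp
  \<comment> \<open>\<open>LX\<close> and \<open>LY\<close> are \<open>M\<close> seen on smaller
    \<sigma>-algebras; the change of variables along the identity leads back to
    \<open>M\<close>.\<close>
  also have "\<dots> = (\<integral>\<^sup>+\<omega>2. (\<integral>\<^sup>+\<omega>1. (\<integral>\<^sup>+u. F (u, (\<omega>1, \<omega>2)) \<partial>Q) \<partial>LX) \<partial>M)"
    unfolding LY_def using F2
    by (intro nn_integral_distr[OF idY]) (simp add: LY_def)
  also have "\<dots> = (\<integral>\<^sup>+\<omega>2. (\<integral>\<^sup>+\<omega>1. (\<integral>\<^sup>+u. F (u, (\<omega>1, \<omega>2)) \<partial>Q) \<partial>M) \<partial>M)"
  proof (rule nn_integral_cong)
    fix \<omega>2 assume "\<omega>2 \<in> space M"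
    then have sp: "\<omega>2 \<in> space LY" using measurable_space[OF idY] by (simp add: LY_def)
    show "(\<integral>\<^sup>+\<omega>1. (\<integral>\<^sup>+u. F (u, (\<omega>1, \<omega>2)) \<partial>Q) \<partial>LX) = (\<integral>\<^sup>+\<omega>1. (\<integral>\<^sup>+u. F (u, (\<omega>1, \<omega>2)) \<partial>Q) \<partial>M)"
      unfolding LX_def
      by (rule nn_integral_distr[OF idX])
        (use measurable_compose[OF measurable_Pair2'[OF sp] F2] in \<open>simp add: LX_def\<close>)
  qed
  finally show ?thesis unfolding Q_def .
qed

text \<open>Rounding the time down to a multiple of \<open>1 / Suc n\<close> leaves countably many
  sections, hence a measurable map; continuity in time gives the limit. This is what makes a
  Brownian path at a random time measurable.\<close>

lemma borel_measurable_continuous_section: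
  fixes f :: "real \<Rightarrow> 'a \<Rightarrow> real"
  assumes [measurable]: "\<And>s. f s \<in> borel_measurable N"
    and cont: "\<And>\<omega>. \<omega> \<in> space N \<Longrightarrow> continuous_on UNIV (\<lambda>s. f s \<omega>)"
  shows "(\<lambda>(s, \<omega>). f s \<omega>) \<in> borel_measurable (borel \<Otimes>\<^sub>M N)"
proof (rule borel_measurable_LIMSEQ_real)
  let ?g = "\<lambda>n s. real_of_int \<lfloor>real (Suc n) * s\<rfloor> / real (Suc n)"
  show "(\<lambda>p. f (?g n (fst p)) (snd p)) \<in> borel_measurable (borel \<Otimes>\<^sub>M N)" for n
    by (rule measurable_compose_countable[of "\<lambda>i p. f (real_of_int i / real (Suc n)) (snd p)" _ _
          "\<lambda>p. \<lfloor>real (Suc n) * fst p\<rfloor>"]) measurable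
  fix p :: "real \<times> 'a" assume p: "p \<in> space (borel \<Otimes>\<^sub>M N)"
  have "(\<lambda>n. ?g n (fst p)) \<longlonglongrightarrow> fst p"
  proof (rule tendsto_sandwich[OF _ _ _ tendsto_const])
    have "?g n s \<le> s" "s - inverse (real (Suc n)) \<le> ?g n s" for n s
    proof -
      have n: "0 < real (Suc n)" by simp
      have "real_of_int \<lfloor>real (Suc n) * s\<rfloor> \<le> s * real (Suc n)"
        using of_int_floor_le[of "real (Suc n) * s"] by (simp only: mult.commute)
      then show "?g n s \<le> s" using n by (simp only: pos_divide_le_eq)
      have "(s - inverse (real (Suc n))) * real (Suc n) = s * real (Suc n) - 1"
        using n by (simp add: left_diff_distrib)
      also have "\<dots> \<le> real_of_int \<lfloor>real (Suc n) * s\<rfloor>"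
        using floor_correct[of "real (Suc n) * s"] by (simp only: mult.commute) linarith
      finally show "s - inverse (real (Suc n)) \<le> ?g n s" using n by (simp only: pos_le_divide_eq)
    qed
    then show "\<forall>\<^sub>F n in sequentially. ?g n (fst p) \<le> fst p"
      "\<forall>\<^sub>F n in sequentially. fst p - inverse (real (Suc n)) \<le> ?g n (fst p)" by simp_all
    have "(\<lambda>n. fst p - inverse (real (Suc n))) \<longlonglongrightarrow> fst p - 0"
      by (intro tendsto_intros LIMSEQ_inverse_real_of_nat)
    then show "(\<lambda>n. fst p - inverse (real (Suc n))) \<longlonglongrightarrow> fst p" by simp
  qed
  then show "(\<lambda>n. f (?g n (fst p)) (snd p)) \<longlonglongrightarrow> (case p of (s, \<omega>) \<Rightarrow> f s \<omega>)"
    using p cont[of "snd p"] continuous_on_tendsto_compose[of UNIV "\<lambda>s. f s (snd p)" "\<lambda>n. ?g n (fst p)" "fst p" sequentially]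
    by (auto simp: space_pair_measure split_beta)
qed

section \<open>The mispricing path\<close>

definition clamp_to :: "real \<Rightarrow> real \<Rightarrow> real" where
  "clamp_to \<gamma> x = max (min x \<gamma>) (- \<gamma>)"

text \<open>
  Here \<open>\<theta> 0\<close> is time 0 and \<open>\<theta> i\<close> is the \<open>i\<close>-th arrival, so \<open>post_arrival \<dots> i\<close> is the mispricing just
  after time \<open>\<theta> i\<close>, and \<open>pre_arrival \<dots> i\<close> the one just before \<open>\<theta> (Suc i)\<close>.
\<close>

primrec post_arrival ::
  "real \<Rightarrow> real \<Rightarrow> (real \<Rightarrow> real) \<Rightarrow> (nat \<Rightarrow> real) \<Rightarrow> real \<Rightarrow> nat \<Rightarrow> real" where
  "post_arrival \<sigma> \<gamma> b \<theta> u 0 = u"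
| "post_arrival \<sigma> \<gamma> b \<theta> u (Suc i) =
     clamp_to \<gamma> (post_arrival \<sigma> \<gamma> b \<theta> u i + \<sigma> * (b (\<theta> (Suc i)) - b (\<theta> i)))"

definition pre_arrival ::
  "real \<Rightarrow> real \<Rightarrow> (real \<Rightarrow> real) \<Rightarrow> (nat \<Rightarrow> real) \<Rightarrow> real \<Rightarrow> nat \<Rightarrow> real" where
  "pre_arrival \<sigma> \<gamma> b \<theta> u i = post_arrival \<sigma> \<gamma> b \<theta> u i + \<sigma> * (b (\<theta> (Suc i)) - b (\<theta> i))"

definition from_zero :: "(nat \<Rightarrow> real) \<Rightarrow> nat \<Rightarrow> real" where
  "from_zero a i = (if i = 0 then 0 else a i)"

lemma from_zero_0 [simp]: "from_zero a 0 = 0"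
  and from_zero_Suc [simp]: "from_zero a (Suc i) = a (Suc i)"
  by (simp_all add: from_zero_def)

lemma post_arrival_Suc_ge: "0 \<le> \<gamma> \<Longrightarrow> - \<gamma> \<le> post_arrival \<sigma> \<gamma> b \<theta> u (Suc i)"
  by (simp add: clamp_to_def)

lemma from_zero_strict_mono:
  assumes "0 < a 1" "\<forall>i\<ge>1. a i < a (Suc i)"
  shows "strict_mono (from_zero a)"
  using assms by (auto simp: strict_mono_Suc_iff from_zero_def)

text \<open>Between consecutive arrivals the path is an explicit function of the continuous
  \<open>b\<close>, so its left limit is that function at the right endpoint. Clamping it gives the
  starting value of the next interval, and the induction goes on.\<close>

lemma left_lim_mispricing:
  assumes path: "mispricing_path \<sigma> \<gamma> b a u z" and b: "continuous_on {0..} b"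
    and a: "0 < a 1" "\<forall>i\<ge>1. a i < a (Suc i)"
  shows "left_lim z (a (Suc i)) = pre_arrival \<sigma> \<gamma> b (from_zero a) u i"
proof -
  note sm = from_zero_strict_mono[OF a]
  have nonneg: "0 \<le> from_zero a i" for i
    using strict_mono_less_eq[OF sm, of 0 i] by (simp add: from_zero_def)
  \<comment> \<open>Conditional on the value at the left endpoint, because it is used both in the
    induction for that value and for the conclusion.\<close>
  have step: "left_lim z (a (Suc i)) = pre_arrival \<sigma> \<gamma> b (from_zero a) u i"
    if IH: "z (from_zero a i) = post_arrival \<sigma> \<gamma> b (from_zero a) u i" for i
  proof -
    let ?s = "from_zero a i" and ?t = "from_zero a (Suc i)"
    have lt: "?s < ?t" using sm by (simp add: strict_mono_Suc_iff)
    have "z t = post_arrival \<sigma> \<gamma> b (from_zero a) u i + \<sigma> * (b t - b ?s)" if "?s \<le> t" "t < ?t" for t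
    proof -
      have "\<not> (\<exists>j\<ge>1. ?s < a j \<and> a j \<le> t)"
      proof
        assume "\<exists>j\<ge>1. ?s < a j \<and> a j \<le> t"
        then obtain j where j: "j \<ge> 1" "?s < a j" "a j \<le> t" by blast
        then have "from_zero a i < from_zero a j" "from_zero a j < from_zero a (Suc i)"
          using that by (auto simp: from_zero_def)
        then show False
          using strict_mono_less[OF sm, of i j] strict_mono_less[OF sm, of j "Suc i"] by auto
      qed
      then show ?thesis
        using path that nonneg[of i] IH unfolding mispricing_path_def by metis
    qed
    then have ev: "\<forall>\<^sub>F t in at_left ?t. z t = post_arrival \<sigma> \<gamma> b (from_zero a) u i + \<sigma> * (b t - b ?s)"
      unfolding eventually_at_left[OF lt] using lt by (intro exI[of _ ?s]) auto
    \<comment> \<open>\<open>b\<close> is continuous relative to \<open>{0..}\<close> only; the left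
      neighbourhoods of a positive time eventually lie in that set.\<close>
    have "(b \<longlongrightarrow> b ?t) (at ?t within {0..})"
      using b nonneg[of "Suc i"] by (simp add: continuous_on_def)
    moreover have "at_left ?t \<le> at ?t within {0..}"
    proof (rule filter_leI)
      fix P assume "\<forall>\<^sub>F x in at ?t within {0..}. P x"
      then have "\<forall>\<^sub>F x in at ?t. x \<in> {0..} \<longrightarrow> P x" by (simp add: eventually_at_filter)
      then have "\<forall>\<^sub>F x in at_left ?t. x \<in> {0..} \<longrightarrow> P x"
        using eventually_at_split by blast
      moreover have "\<forall>\<^sub>F x in at_left ?t. x \<in> {0..}"
        unfolding eventually_at_left[OF lt] using lt nonneg[of i] by (intro exI[of _ ?s]) auto
      ultimately show "\<forall>\<^sub>F x in at_left ?t. P x" by eventually_elim auto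
    qed
    ultimately have "(b \<longlongrightarrow> b ?t) (at_left ?t)" by (meson filterlim_mono order_refl)
    then have "((\<lambda>t. post_arrival \<sigma> \<gamma> b (from_zero a) u i + \<sigma> * (b t - b ?s))
        \<longlongrightarrow> pre_arrival \<sigma> \<gamma> b (from_zero a) u i) (at_left ?t)"
      unfolding pre_arrival_def by (intro tendsto_intros)
    then have "(z \<longlongrightarrow> pre_arrival \<sigma> \<gamma> b (from_zero a) u i) (at_left ?t)"
      using tendsto_cong[OF ev] by simp
    then have "Lim (at_left ?t) z = pre_arrival \<sigma> \<gamma> b (from_zero a) u i"
      by (intro tendsto_Lim) auto
    then show ?thesis by (simp add: left_lim_def from_zero_def)
  qed
  have "z (from_zero a i) = post_arrival \<sigma> \<gamma> b (from_zero a) u i" for i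
  proof (induction i)
    case 0
    then show ?case using path by (simp add: mispricing_path_def from_zero_def)
  next
    case (Suc i)
    have "z (a (Suc i)) = clamp_to \<gamma> (left_lim z (a (Suc i)))"
      using path by (simp add: mispricing_path_def clamp_to_def)
    then show ?case using step[OF Suc] by (simp add: pre_arrival_def)
  qed
  then show ?thesis by (rule step)
qed

section \<open>Measurability of paths and arrival times\<close>

lemma measurable_vimage_trajectory:
  fixes X :: "real \<Rightarrow> 'a \<Rightarrow> 'b"
  assumes X: "trajectory X \<in> measurable M (PiM {0..} (\<lambda>_. K))" and t: "0 \<le> t"
  shows "X t \<in> measurable (vimage_algebra (space M) (trajectory X) (PiM {0..} (\<lambda>_. K))) K"
proof -
  have "trajectory X \<in> measurable (vimage_algebra (space M) (trajectory X) (PiM {0..} (\<lambda>_. K))) (PiM {0..} (\<lambda>_. K))"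
    using measurable_space[OF X] by (intro measurable_vimage_algebra1) auto
  from measurable_compose[OF this measurable_component_singleton[of t]]
  show ?thesis using t by simp
qed

lemma arrival_time_pos:
  assumes "arrival_times M N \<tau>" "\<omega> \<in> space M" "1 \<le> i"
  shows "0 < \<tau> i \<omega>"
  using strict_mono_less[OF from_zero_strict_mono[of "\<lambda>i. \<tau> i \<omega>"], of 0 i] assms
  by (simp add: arrival_times_def from_zero_def)

text \<open>The event that arrival \<open>i\<close> occurs by time \<open>t\<close> is
  \<open>i \<le> N t\<close>. The \<sigma>-algebra is left open so as to cover both that of
  \<open>M\<close> and the one generated by the path of \<open>N\<close>.\<close>

lemma borel_measurable_arrival_time:
  assumes arr: "arrival_times M N \<tau>"
    and sp: "space F = space M" and Nm: "\<And>t. 0 \<le> t \<Longrightarrow> N t \<in> measurable F (count_space UNIV)"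
  shows "(\<lambda>\<omega>. from_zero (\<lambda>i. \<tau> i \<omega>) i) \<in> borel_measurable F"
proof (cases "i = 0")
  case False
  then have i: "1 \<le> i" by simp
  have "\<tau> i \<in> borel_measurable F"
  proof (rule borel_measurableI_le)
    fix t
    show "{\<omega> \<in> space F. \<tau> i \<omega> \<le> t} \<in> sets F"
    proof (cases "0 \<le> t")
      case True
      then have "{\<omega> \<in> space F. \<tau> i \<omega> \<le> t} = {\<omega> \<in> space F. i \<le> N t \<omega>}"
        using arr i unfolding arrival_times_def sp by blast
      then show ?thesis using Nm[OF True] by simp
    next
      case False
      then have "{\<omega> \<in> space F. \<tau> i \<omega> \<le> t} = {}"
        using arrival_time_pos[OF arr _ i] unfolding sp by fastforce
      then show ?thesis by (simp only: sets.empty_sets)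
    qed
  qed
  then show ?thesis using False by (simp add: from_zero_def)
qed (simp add: from_zero_def)

section \<open>Poisson arrivals\<close>

lemma poisson_process_distr:
  assumes "poisson_process M rate N" "0 < T"
  shows "distr M (count_space UNIV) (N T) = measure_pmf (poisson_pmf (rate * T))"
proof -
  have "distr M (count_space UNIV) (\<lambda>\<omega>. N T \<omega> - N 0 \<omega>) = measure_pmf (poisson_pmf (rate * T))"
    using assms by (simp add: poisson_process_def)
  moreover have "distr M (count_space UNIV) (\<lambda>\<omega>. N T \<omega> - N 0 \<omega>) = distr M (count_space UNIV) (N T)"
    using assms(1) by (intro distr_cong) (auto simp: poisson_process_def)
  ultimately show ?thesis by simp
qed

text \<open>Since \<open>k - 1 \<le> k * (k - 1)\<close>, also at \<open>k = 0\<close> with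
  truncated subtraction, the second factorial moment \<open>m\<^sup>2\<close> is a bound. Its series
  is the exponential series shifted by two places.\<close>

lemma nn_integral_poisson_minus_1_le:
  assumes "0 < m"
  shows "(\<integral>\<^sup>+k. of_nat (k - 1) \<partial>measure_pmf (poisson_pmf m)) \<le> ennreal (m\<^sup>2)"
proof -
  let ?f = "\<lambda>k. real (k * (k - 1)) * (m ^ k / fact k * exp (- m))"
  have "(\<lambda>k. m ^ k / fact k * exp (- m) * m\<^sup>2) sums (exp m * exp (- m) * m\<^sup>2)"
    using exp_converges[of m] by (intro sums_mult2) (simp add: divide_inverse mult.commute)
  moreover have "?f (k + 2) = m ^ k / fact k * exp (- m) * m\<^sup>2" for k
  proof -
    define c where "c = real ((k + 2) * (k + 2 - 1))"
    have "c \<noteq> 0" unfolding c_def of_nat_eq_0_iff by simp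
    moreover have "fact (k + 2) = c * fact k" by (simp add: c_def algebra_simps)
    ultimately show ?thesis by (simp only: c_def[symmetric]) (simp add: power_add power2_eq_square)
  qed
  ultimately have "(\<lambda>k. ?f (k + 2)) sums m\<^sup>2" by (simp add: exp_minus_inverse)
  then have s: "?f sums m\<^sup>2"
    using sums_iff_shift[of ?f 2 "m\<^sup>2"] by (simp add: numeral_2_eq_2)
  have "(\<integral>\<^sup>+k. of_nat (k - 1) \<partial>measure_pmf (poisson_pmf m))
      \<le> (\<integral>\<^sup>+k. ennreal (real (k * (k - 1))) \<partial>measure_pmf (poisson_pmf m))"
  proof (rule nn_integral_mono)
    fix k :: nat
    have "k - 1 \<le> k * (k - 1)" by (cases k) auto
    then show "of_nat (k - 1) \<le> ennreal (real (k * (k - 1)))"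
      by (metis ennreal_of_nat_eq_real_of_nat of_nat_mono)
  qed
  also have "\<dots> = (\<integral>\<^sup>+k. ennreal (?f k) \<partial>count_space UNIV)"
    unfolding nn_integral_measure_pmf using assms
    by (intro nn_integral_cong) (simp add: ennreal_mult'[symmetric] mult.commute)
  also have "\<dots> = (\<Sum>k. ennreal (?f k))" by (rule nn_integral_count_space_nat)
  also have "\<dots> = ennreal (m\<^sup>2)"
    using s assms by (intro suminf_ennreal_eq) auto
  finally show ?thesis .
qed

lemma (in prob_space) prob_arrival_before:
  assumes poisson: "poisson_process M rate N" and arr: "arrival_times M N \<tau>"
    and "0 < rate" and T: "0 < T"
  shows "emeasure M {\<omega> \<in> space M. \<tau> 1 \<omega> \<le> T} = ennreal (1 - exp (- (rate * T)))"
proof -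
  have Nm: "N T \<in> measurable M (count_space UNIV)"
    using poisson T by (simp add: poisson_process_def)
  have "{\<omega> \<in> space M. \<tau> 1 \<omega> \<le> T} = {\<omega> \<in> space M. 1 \<le> N T \<omega>}"
    using arr T unfolding arrival_times_def by auto
  also have "\<dots> = N T -` (- {0}) \<inter> space M" by auto
  finally have "emeasure M {\<omega> \<in> space M. \<tau> 1 \<omega> \<le> T} = emeasure (poisson_pmf (rate * T)) (- {0})"
    using Nm by (simp add: poisson_process_distr[OF poisson T, symmetric] emeasure_distr)
  also have "\<dots> = ennreal (measure_pmf.prob (poisson_pmf (rate * T)) (UNIV - {0}))"
    by (simp add: measure_pmf.emeasure_eq_measure Compl_eq_Diff_UNIV)
  also have "measure_pmf.prob (poisson_pmf (rate * T)) (UNIV - {0}) = 1 - exp (- (rate * T))"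
    using assms(3) T
    by (subst measure_pmf.prob_compl[of "{0}", simplified]) (simp_all add: measure_pmf_single)
  finally show ?thesis .
qed

text \<open>Summed over \<open>i\<close>, the indicators of these events count the arrivals after
  the first one.\<close>

lemma (in prob_space) nn_integral_later_arrivals_le:
  assumes poisson: "poisson_process M rate N" and arr: "arrival_times M N \<tau>"
    and "0 < rate" and T: "0 < T"
  shows "(\<Sum>i. emeasure M {\<omega> \<in> space M. \<tau> (Suc (Suc i)) \<omega> \<le> T}) \<le> ennreal ((rate * T)\<^sup>2)"
proof -
  have Nm: "N T \<in> measurable M (count_space UNIV)"
    using poisson T by (simp add: poisson_process_def)
  \<comment> \<open>\<open>i + 2 \<le> N T\<close> is the same as \<open>i < N T - 1\<close>, with
    truncation covering the case without arrivals.\<close>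
  have set: "{\<omega> \<in> space M. \<tau> (Suc (Suc i)) \<omega> \<le> T} = {\<omega> \<in> space M. i < N T \<omega> - 1}" for i
    using arr T unfolding arrival_times_def by (auto simp: Suc_le_eq less_diff_conv)
  have m[measurable]: "{\<omega> \<in> space M. i < N T \<omega> - 1} \<in> events" for i using Nm by measurable
  have "(\<Sum>i. emeasure M {\<omega> \<in> space M. \<tau> (Suc (Suc i)) \<omega> \<le> T})
      = (\<Sum>i. \<integral>\<^sup>+\<omega>. indicator {\<omega> \<in> space M. i < N T \<omega> - 1} \<omega> \<partial>M)"
    unfolding set using m by (simp add: nn_integral_indicator)
  also have "\<dots> = (\<integral>\<^sup>+\<omega>. (\<Sum>i. indicator {\<omega> \<in> space M. i < N T \<omega> - 1} \<omega>) \<partial>M)"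
    by (rule nn_integral_suminf[symmetric]) measurable
  also have "\<dots> = (\<integral>\<^sup>+\<omega>. of_nat (N T \<omega> - 1) \<partial>M)"
  proof (rule nn_integral_cong)
    fix \<omega> assume "\<omega> \<in> space M"
    then have "(\<Sum>i. indicator {\<omega> \<in> space M. i < N T \<omega> - 1} \<omega> :: ennreal)
        = (\<Sum>i<N T \<omega> - 1. indicator {\<omega> \<in> space M. i < N T \<omega> - 1} \<omega>)"
      by (intro suminf_finite) auto
    also have "\<dots> = of_nat (N T \<omega> - 1)" using \<open>\<omega> \<in> space M\<close> by simp
    finally show "(\<Sum>i. indicator {\<omega> \<in> space M. i < N T \<omega> - 1} \<omega> :: ennreal) = of_nat (N T \<omega> - 1)" .
  qed
  also have "\<dots> = (\<integral>\<^sup>+k. of_nat (k - 1) \<partial>distr M (count_space UNIV) (N T))"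
    by (rule nn_integral_distr[OF Nm, symmetric]) simp
  also have "\<dots> \<le> ennreal ((rate * T)\<^sup>2)"
    unfolding poisson_process_distr[OF poisson T]
    using assms(3) T by (intro nn_integral_poisson_minus_1_le) simp
  finally show ?thesis .
qed

lemma tendsto_one_minus_exp_over:
  "((\<lambda>T. (1 - exp (- (r * T))) / T) \<longlongrightarrow> r) (at_right (0::real))"
proof -
  have "((\<lambda>T. 1 - exp (- (r * T))) has_real_derivative r) (at 0)"
    by (auto intro!: derivative_eq_intros)
  then have "((\<lambda>T. (1 - exp (- (r * T))) / T) \<longlongrightarrow> r) (at 0)"
    by (simp add: has_field_derivative_iff)
  then show ?thesis by (simp add: filterlim_at_split)
qed

text \<open>
  Given that the first arrival occurs by time \<open>T\<close>, the average of \<open>h\<close> over it lies between the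
  infimum and the supremum of \<open>h\<close> on \<open>(0, T]\<close>.
\<close>

lemma (in prob_space) first_arrival_limit:
  fixes h :: "real \<Rightarrow> ennreal"
  assumes poisson: "poisson_process M rate N" and arr: "arrival_times M N \<tau>" and rate: "0 < rate"
    and h: "(h \<longlongrightarrow> h0) (at_right 0)"
    and \<tau>m: "\<tau> 1 \<in> borel_measurable M"
  shows "((\<lambda>T. (\<integral>\<^sup>+\<omega>. h (\<tau> 1 \<omega>) * indicator {..T} (\<tau> 1 \<omega>) \<partial>M) / ennreal T)
    \<longlongrightarrow> ennreal rate * h0) (at_right 0)"
proof -
  define lo where "lo = (\<lambda>T. INF s\<in>{0<..T}. h s)"
  define hi where "hi = (\<lambda>T. SUP s\<in>{0<..T}. h s)"
  define p where "p = (\<lambda>T. ennreal ((1 - exp (- (rate * T))) / T))"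
  have ev: "\<forall>\<^sub>F T in at_right 0. \<forall>s\<in>{0<..T}. Q s" if "\<forall>\<^sub>F s in at_right 0. Q s" for Q :: "real \<Rightarrow> bool"
    using that unfolding eventually_at_right_field by (auto intro: less_le_trans)
  have pos: "\<forall>\<^sub>F T in at_right (0::real). 0 < T"
    using eventually_at_right_less[of "0::real"] by simp
  have lo_lim: "(lo \<longlongrightarrow> h0) (at_right 0)"
  proof (rule order_tendstoI)
    fix y assume "y < h0"
    \<comment> \<open>A strict bound on all values survives the infimum only as a weak one, hence
      the intermediate \<open>y'\<close>; likewise for the supremum.\<close>
    then obtain y' where y': "y < y'" "y' < h0" using dense by blast
    show "\<forall>\<^sub>F T in at_right 0. y < lo T"
      using ev[OF order_tendstoD(1)[OF h y'(2)]]
    proof eventually_elim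
      case (elim T)
      then have "y' \<le> lo T" unfolding lo_def by (intro INF_greatest) (auto intro: less_imp_le)
      then show ?case using y' by simp
    qed
  next
    fix y assume "h0 < y"
    show "\<forall>\<^sub>F T in at_right 0. lo T < y"
      using ev[OF order_tendstoD(2)[OF h \<open>h0 < y\<close>]] pos
    proof eventually_elim
      case (elim T)
      then have "lo T \<le> h T" unfolding lo_def by (intro INF_lower) auto
      then show ?case using elim by (auto intro: le_less_trans)
    qed
  qed
  have hi_lim: "(hi \<longlongrightarrow> h0) (at_right 0)"
  proof (rule order_tendstoI)
    fix y assume "h0 < y"
    then obtain y' where y': "h0 < y'" "y' < y" using dense by blast
    show "\<forall>\<^sub>F T in at_right 0. hi T < y"
      using ev[OF order_tendstoD(2)[OF h y'(1)]]
    proof eventually_elim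
      case (elim T)
      then have "hi T \<le> y'" unfolding hi_def by (intro SUP_least) (auto intro: less_imp_le)
      then show ?case using y' by simp
    qed
  next
    fix y assume "y < h0"
    show "\<forall>\<^sub>F T in at_right 0. y < hi T"
      using ev[OF order_tendstoD(1)[OF h \<open>y < h0\<close>]] pos
    proof eventually_elim
      case (elim T)
      then have "h T \<le> hi T" unfolding hi_def by (intro SUP_upper) auto
      then show ?case using elim by (auto intro: less_le_trans)
    qed
  qed
  have p_lim: "(p \<longlongrightarrow> ennreal rate) (at_right 0)"
    unfolding p_def by (intro tendsto_ennrealI tendsto_one_minus_exp_over)
  \<comment> \<open>\<open>h0\<close> may be infinite; multiplication in \<open>ennreal\<close> is
    still continuous there, as \<open>rate\<close> is finite and positive.\<close>
  have prod: "((\<lambda>T. p T * k T) \<longlongrightarrow> ennreal rate * h0) (at_right 0)"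
    if "(k \<longlongrightarrow> h0) (at_right 0)" for k
    using that p_lim rate by (intro tendsto_mult_ennreal) auto
  have m[measurable]: "{\<omega> \<in> space M. \<tau> 1 \<omega> \<le> T} \<in> events" for T using \<tau>m by measurable
  have const: "(\<integral>\<^sup>+\<omega>. c * indicator {..T} (\<tau> 1 \<omega>) \<partial>M) / ennreal T = p T * c" if T: "0 < T" for T c
  proof -
    have "(\<integral>\<^sup>+\<omega>. c * indicator {..T} (\<tau> 1 \<omega>) \<partial>M) = (\<integral>\<^sup>+\<omega>. c * indicator {\<omega> \<in> space M. \<tau> 1 \<omega> \<le> T} \<omega> \<partial>M)"
      by (intro nn_integral_cong) (auto simp: indicator_def)
    also have "\<dots> = c * ennreal (1 - exp (- (rate * T)))"
      unfolding nn_integral_cmult_indicator[OF m] prob_arrival_before[OF poisson arr rate T] ..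
    also have "\<dots> / ennreal T = c * p T"
      unfolding p_def ennreal_times_divide[symmetric] using T rate by (simp add: divide_ennreal)
    finally show ?thesis by (simp add: mult.commute)
  qed
  \<comment> \<open>Comparison with the constants \<open>lo T\<close> and \<open>hi T\<close> uses
    only monotonicity of the integral, so \<open>h\<close> may be an arbitrary function.\<close>
  show ?thesis
  proof (rule tendsto_sandwich[OF _ _ prod[OF lo_lim] prod[OF hi_lim]])
    show "\<forall>\<^sub>F T in at_right 0. p T * lo T \<le> (\<integral>\<^sup>+\<omega>. h (\<tau> 1 \<omega>) * indicator {..T} (\<tau> 1 \<omega>) \<partial>M) / ennreal T"
      using pos
    proof eventually_elim
      case (elim T)
      show ?case
        unfolding const[OF elim, symmetric] lo_def using arrival_time_pos[OF arr, of _ 1]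
        by (intro divide_right_mono_ennreal nn_integral_mono)
          (auto simp: indicator_def intro!: INF_lower)
    qed
    show "\<forall>\<^sub>F T in at_right 0. (\<integral>\<^sup>+\<omega>. h (\<tau> 1 \<omega>) * indicator {..T} (\<tau> 1 \<omega>) \<partial>M) / ennreal T \<le> p T * hi T"
      using pos
    proof eventually_elim
      case (elim T)
      show ?case
        unfolding const[OF elim, symmetric] hi_def using arrival_time_pos[OF arr, of _ 1]
        by (intro divide_right_mono_ennreal nn_integral_mono)
          (auto simp: indicator_def intro!: SUP_upper)
    qed
  qed
qed

section \<open>Brownian expectations\<close>

text \<open>The majorant has to be integrable only if the limit is: otherwise Fatou's lemma already
  forces the integrals to infinity.\<close>

lemma nn_integral_tendsto_dominated_or_infinite:
  fixes u :: "nat \<Rightarrow> 'a \<Rightarrow> ennreal"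
  assumes [measurable]: "\<And>i. u i \<in> borel_measurable M" "u' \<in> borel_measurable M" "w \<in> borel_measurable M"
    and bound: "\<And>j. AE x in M. u j x \<le> w x"
    and w: "(\<integral>\<^sup>+x. u' x \<partial>M) < \<infinity> \<Longrightarrow> (\<integral>\<^sup>+x. w x \<partial>M) < \<infinity>"
    and lim: "AE x in M. (\<lambda>i. u i x) \<longlonglongrightarrow> u' x"
  shows "(\<lambda>i. \<integral>\<^sup>+x. u i x \<partial>M) \<longlonglongrightarrow> (\<integral>\<^sup>+x. u' x \<partial>M)"
proof (cases "(\<integral>\<^sup>+x. u' x \<partial>M) < \<infinity>")
  case True
  show ?thesis
    by (rule nn_integral_dominated_convergence[OF _ _ _ bound w[OF True] lim]) measurable
next
  case False
  then have top: "(\<integral>\<^sup>+x. u' x \<partial>M) = \<top>" by (simp add: less_top[symmetric])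
  have "AE x in M. u' x = liminf (\<lambda>n. u n x)"
    using lim by eventually_elim (simp add: lim_imp_Liminf)
  then have "(\<integral>\<^sup>+x. u' x \<partial>M) = (\<integral>\<^sup>+x. liminf (\<lambda>n. u n x) \<partial>M)"
    by (rule nn_integral_cong_AE)
  also have "\<dots> \<le> liminf (\<lambda>n. integral\<^sup>N M (u n))" by (rule nn_integral_liminf) measurable
  finally have li: "liminf (\<lambda>n. integral\<^sup>N M (u n)) = \<top>" unfolding top by (simp add: top_unique)
  have "limsup (\<lambda>n. integral\<^sup>N M (u n)) = \<top>"
    using Liminf_le_Limsup[of sequentially "\<lambda>n. integral\<^sup>N M (u n)"] li by (simp add: top_unique)
  then show ?thesis unfolding top using li by (intro Liminf_eq_Limsup) auto
qed

section \<open>Gaussian exponentials and Brownian scaling\<close>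

lemma brownian_distributed:
  assumes "brownian_motion M B" "0 < s"
  shows "distributed M lborel (B s) (normal_density 0 (sqrt s))"
proof -
  have "distributed M lborel (\<lambda>\<omega>. B s \<omega> - B 0 \<omega>) (normal_density 0 (sqrt (s - 0)))"
    by (rule brownian_increment[OF assms(1) order_refl assms(2)])
  moreover have "distr M lborel (\<lambda>\<omega>. B s \<omega> - B 0 \<omega>) = distr M lborel (B s)"
    using assms(1) by (intro distr_cong) (auto simp: brownian_motion_def)
  moreover have "B s \<in> borel_measurable M" using assms by (simp add: brownian_motion_def)
  ultimately show ?thesis by (simp add: distributed_def)
qed

text \<open>Completing the square turns the tilted density into a shifted normal density. Time 0 is
  separate because the law is then a point mass.\<close>

lemma (in prob_space) brownian_nn_integral_exp:
  assumes bm: "brownian_motion M B" and s: "0 \<le> s"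
  shows "(\<integral>\<^sup>+\<omega>. ennreal (exp (c * B s \<omega>)) \<partial>M) = ennreal (exp (c\<^sup>2 * s / 2))"
proof (cases "s = 0")
  case True
  have "(\<integral>\<^sup>+\<omega>. ennreal (exp (c * B s \<omega>)) \<partial>M) = (\<integral>\<^sup>+\<omega>. 1 \<partial>M)"
    using bm True by (intro nn_integral_cong) (auto simp: brownian_motion_def)
  then show ?thesis using True by (simp add: emeasure_space_1)
next
  case False
  then have s: "0 < s" using s by simp
  have eq: "normal_density 0 (sqrt s) x * exp (c * x) = exp (c\<^sup>2 * s / 2) * normal_density (c * s) (sqrt s) x" for x
  proof -
    have "- (x\<^sup>2 / (2 * s)) + c * x = c\<^sup>2 * s / 2 + - ((x - c * s)\<^sup>2 / (2 * s))"
      using s by (simp add: field_simps power2_eq_square)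
    then have "exp (- (x\<^sup>2 / (2 * s))) * exp (c * x) = exp (c\<^sup>2 * s / 2) * exp (- ((x - c * s)\<^sup>2 / (2 * s)))"
      unfolding exp_add[symmetric] by simp
    then show ?thesis
      unfolding normal_density_def using s by (simp only: real_sqrt_pow2 less_imp_le diff_0_right
          minus_divide_left mult.assoc mult.left_commute[of "exp (c\<^sup>2 * s / 2)"])
  qed
  have "(\<integral>\<^sup>+\<omega>. ennreal (exp (c * B s \<omega>)) \<partial>M) =
      (\<integral>\<^sup>+x. ennreal (normal_density 0 (sqrt s) x) * ennreal (exp (c * x)) \<partial>lborel)"
    by (rule distributed_nn_integral[OF brownian_distributed[OF bm s], symmetric]) simp
  also have "\<dots> = (\<integral>\<^sup>+x. ennreal (exp (c\<^sup>2 * s / 2)) * ennreal (normal_density (c * s) (sqrt s) x) \<partial>lborel)"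
    by (intro nn_integral_cong) (simp add: ennreal_mult'[symmetric] eq)
  also have "\<dots> = ennreal (exp (c\<^sup>2 * s / 2)) * (\<integral>\<^sup>+x. ennreal (normal_density (c * s) (sqrt s) x) \<partial>lborel)"
    by (rule nn_integral_cmult) simp
  also have "(\<integral>\<^sup>+x. ennreal (normal_density (c * s) (sqrt s) x) \<partial>lborel) = 1"
    using s integral_normal_density[of "sqrt s" "c * s"] integrable_normal_density[of "sqrt s" "c * s"]
    by (subst nn_integral_eq_integral) auto
  finally show ?thesis by simp
qed

text \<open>Replaces the varying variable \<open>B s\<close> by multiples of the fixed
  \<open>B 1\<close>, so that for \<open>s\<close> tending to 0 there is pointwise convergence and a
  single majorant.\<close>

lemma (in prob_space) brownian_scaling:
  assumes bm: "brownian_motion M B" and s: "0 < s" and J: "J \<in> borel_measurable borel"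
  shows "(\<integral>\<^sup>+\<omega>. J (B s \<omega>) \<partial>M) = (\<integral>\<^sup>+\<omega>. J (sqrt s * B 1 \<omega>) \<partial>M)"
proof -
  have "distributed M lborel (\<lambda>\<omega>. 0 + sqrt s * B 1 \<omega>) (normal_density (0 + sqrt s * 0) (\<bar>sqrt s\<bar> * sqrt 1))"
    by (rule normal_density_affine) (use brownian_distributed[OF bm, of 1] s in auto)
  then have "distributed M lborel (\<lambda>\<omega>. sqrt s * B 1 \<omega>) (normal_density 0 (sqrt s))"
    using s by simp
  from distributed_nn_integral[OF this, of J] distributed_nn_integral[OF brownian_distributed[OF bm s], of J]
  show ?thesis using J by simp
qed

text \<open>
  The first arrival at time \<open>s\<close> sees the log price and the mispricing both shifted by \<open>\<sigma> B\<^sub>s\<close>.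
\<close>

lemma (in prob_space) shifted_expectation_limit:
  fixes g :: "real \<Rightarrow> real \<Rightarrow> real" and Q :: "real measure"
  assumes bm: "brownian_motion M B" and Q: "prob_space Q" "sets Q = sets borel"
    and gm: "(\<lambda>p. g (fst p) (snd p)) \<in> borel_measurable (borel \<Otimes>\<^sub>M borel)"
    and C: "0 \<le> C"
    and bound: "\<And>b u. g b (u + b) \<le> C * (1 + exp b) + (g 0 u + C)"
    and g0: "\<And>u. 0 \<le> g 0 u"
    and cont: "AE u in Q. isCont (\<lambda>b. g b (u + b)) 0"
  shows "((\<lambda>s. \<integral>\<^sup>+\<omega>. \<integral>\<^sup>+u. ennreal (g (\<sigma> * B s \<omega>) (u + \<sigma> * B s \<omega>)) \<partial>Q \<partial>M)
    \<longlongrightarrow> (\<integral>\<^sup>+u. ennreal (g 0 u) \<partial>Q)) (at_right 0)"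
proof -
  interpret Q: prob_space Q by fact
  note [measurable_cong] = Q(2)
  note [measurable] = gm
  have [measurable]: "g b \<in> borel_measurable borel" for b
    using measurable_compose[OF measurable_Pair1'[of b borel borel] gm] by simp
  define J where "J = (\<lambda>b. \<integral>\<^sup>+u. ennreal (g b (u + b)) \<partial>Q)"
  have shear: "(\<lambda>p. (fst p, snd p + fst p)) \<in> borel \<Otimes>\<^sub>M Q \<rightarrow>\<^sub>M borel \<Otimes>\<^sub>M borel" by measurable
  have Jm[measurable]: "J \<in> borel_measurable borel"
    unfolding J_def using measurable_compose[OF shear gm] by (intro Q.borel_measurable_nn_integral) (simp add: split_beta)
  have J0: "J 0 = (\<integral>\<^sup>+u. ennreal (g 0 u) \<partial>Q)" by (simp add: J_def)
  have J_le: "J b \<le> ennreal (C * (1 + exp b) + C) + J 0" for b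
  proof -
    have "J b \<le> (\<integral>\<^sup>+u. ennreal (C * (1 + exp b) + C) + ennreal (g 0 u) \<partial>Q)"
      unfolding J_def
    proof (rule nn_integral_mono)
      fix u
      have "g b (u + b) \<le> (C * (1 + exp b) + C) + g 0 u" using bound[of b u] by linarith
      then show "ennreal (g b (u + b)) \<le> ennreal (C * (1 + exp b) + C) + ennreal (g 0 u)"
        using C g0 by (simp add: ennreal_plus[symmetric] ennreal_leI del: ennreal_plus)
    qed
    also have "\<dots> = ennreal (C * (1 + exp b) + C) + J 0"
      by (subst nn_integral_add) (auto simp: Q.emeasure_space_1 J0)
    finally show ?thesis .
  qed
  \<comment> \<open>Continuity of \<open>J\<close> at 0, also when \<open>J 0\<close> is infinite:
    the majorant is \<open>g 0 u\<close> plus a constant, hence integrable exactly when the limit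
    is.\<close>
  have J_lim: "(\<lambda>n. J (b n)) \<longlonglongrightarrow> J 0" if b: "b \<longlonglongrightarrow> 0" for b
  proof -
    obtain K where K: "\<And>n. \<bar>b n\<bar> \<le> K"
      using convergent_imp_Bseq[OF convergentI[OF b]] by (auto simp: Bseq_def)
    show ?thesis unfolding J0 unfolding J_def
    proof (rule nn_integral_tendsto_dominated_or_infinite[where w = "\<lambda>u. ennreal (C * (1 + exp K) + C) + ennreal (g 0 u)"])
      show "AE u in Q. ennreal (g (b j) (u + b j)) \<le> ennreal (C * (1 + exp K) + C) + ennreal (g 0 u)" for j
      proof (rule AE_I2)
        fix u
        have "b j \<le> K" using K[of j] by simp
        then have "C * (1 + exp (b j)) \<le> C * (1 + exp K)"
          using C by (intro mult_left_mono) auto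
        then have "g (b j) (u + b j) \<le> (C * (1 + exp K) + C) + g 0 u"
          using bound[of "b j" u] by linarith
        then show "ennreal (g (b j) (u + b j)) \<le> ennreal (C * (1 + exp K) + C) + ennreal (g 0 u)"
          using C g0 by (simp add: ennreal_plus[symmetric] ennreal_leI del: ennreal_plus)
      qed
      assume "(\<integral>\<^sup>+u. ennreal (g 0 u) \<partial>Q) < \<infinity>"
      then show "(\<integral>\<^sup>+u. ennreal (C * (1 + exp K) + C) + ennreal (g 0 u) \<partial>Q) < \<infinity>"
        by (subst nn_integral_add) (auto simp: Q.emeasure_space_1)
    next
      show "AE u in Q. (\<lambda>i. ennreal (g (b i) (u + b i))) \<longlonglongrightarrow> ennreal (g 0 u)"
        using cont
      proof eventually_elim
        case (elim u)
        then have "(\<lambda>i. g (b i) (u + b i)) \<longlonglongrightarrow> g 0 (u + 0)"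
          using b by (rule isCont_tendsto_compose)
        then show ?case by (intro tendsto_ennrealI) simp
      qed
    qed measurable
  qed
  have Bm[measurable]: "B 1 \<in> borel_measurable M" using bm by (simp add: brownian_motion_def)
  have fold_J: "(\<integral>\<^sup>+u. ennreal (g b (u + b)) \<partial>Q) = J b" for b by (simp add: J_def)
  show ?thesis unfolding J0[symmetric] fold_J
  proof (rule tendsto_at_right_sequentially[of 0 1])
    fix S :: "nat \<Rightarrow> real"
    assume S: "\<And>n. 0 < S n" "\<And>n. S n < 1" "S \<longlonglongrightarrow> 0"
    have eq: "(\<integral>\<^sup>+\<omega>. J (\<sigma> * B (S n) \<omega>) \<partial>M) = (\<integral>\<^sup>+\<omega>. J (\<sigma> * (sqrt (S n) * B 1 \<omega>)) \<partial>M)" for n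
      by (rule brownian_scaling[OF bm S(1), of "\<lambda>x. J (\<sigma> * x)"]) measurable
    \<comment> \<open>As \<open>S n < 1\<close>, the exponent is at most
      \<open>\<bar>\<sigma> * B 1 \<omega>\<bar>\<close>, and
      \<open>exp \<bar>x\<bar> \<le> exp x + exp (- x)\<close> yields a majorant free of
      \<open>n\<close> with finite Gaussian means.\<close>
    let ?w = "\<lambda>\<omega>. ennreal C * (ennreal (exp (\<sigma> * B 1 \<omega>)) + ennreal (exp (- \<sigma> * B 1 \<omega>))) + (ennreal (2 * C) + J 0)"
    have "(\<lambda>n. \<integral>\<^sup>+\<omega>. J (\<sigma> * (sqrt (S n) * B 1 \<omega>)) \<partial>M) \<longlonglongrightarrow> (\<integral>\<^sup>+\<omega>. J 0 \<partial>M)"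
    proof (rule nn_integral_tendsto_dominated_or_infinite[where w = ?w])
      show "AE \<omega> in M. J (\<sigma> * (sqrt (S j) * B 1 \<omega>)) \<le> ?w \<omega>" for j
      proof (rule AE_I2)
        fix \<omega>
        let ?b = "\<sigma> * (sqrt (S j) * B 1 \<omega>)"
        have "?b \<le> \<bar>\<sigma> * B 1 \<omega>\<bar>"
        proof -
          have "?b \<le> \<bar>?b\<bar>" by simp
          also have "\<dots> = sqrt (S j) * \<bar>\<sigma> * B 1 \<omega>\<bar>" using S(1)[of j] by (simp add: abs_mult)
          also have "\<dots> \<le> 1 * \<bar>\<sigma> * B 1 \<omega>\<bar>"
            using S(2)[of j] by (intro mult_right_mono) auto
          finally show ?thesis by simp
        qed
        then have "exp ?b \<le> exp \<bar>\<sigma> * B 1 \<omega>\<bar>" by simp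
        also have "\<dots> \<le> exp (\<sigma> * B 1 \<omega>) + exp (- \<sigma> * B 1 \<omega>)" by (simp add: abs_if)
        finally have "C * exp ?b \<le> C * (exp (\<sigma> * B 1 \<omega>) + exp (- \<sigma> * B 1 \<omega>))"
          using C by (rule mult_left_mono)
        then have "C * (1 + exp ?b) + C \<le> C * (exp (\<sigma> * B 1 \<omega>) + exp (- \<sigma> * B 1 \<omega>)) + 2 * C"
          by (simp add: algebra_simps)
        then have "ennreal (C * (1 + exp ?b) + C) \<le> ennreal (C * (exp (\<sigma> * B 1 \<omega>) + exp (- \<sigma> * B 1 \<omega>)) + 2 * C)"
          by (rule ennreal_leI)
        also have "\<dots> = ennreal C * (ennreal (exp (\<sigma> * B 1 \<omega>)) + ennreal (exp (- \<sigma> * B 1 \<omega>))) + ennreal (2 * C)"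
          using C by (simp add: ennreal_plus ennreal_mult del: exp_minus)
        finally have "ennreal (C * (1 + exp ?b) + C) + J 0 \<le> \<dots> + J 0" by (rule add_right_mono)
        from order_trans[OF J_le[of ?b] this] show "J ?b \<le> ?w \<omega>" by (simp only: add.assoc)
      qed
      assume "(\<integral>\<^sup>+\<omega>. J 0 \<partial>M) < \<infinity>"
      then have "J 0 < \<infinity>" by (simp add: emeasure_space_1)
      moreover have "(\<integral>\<^sup>+\<omega>. ?w \<omega> \<partial>M) = ennreal C * (ennreal (exp (\<sigma>\<^sup>2 / 2)) + ennreal (exp (\<sigma>\<^sup>2 / 2))) + (ennreal (2 * C) + J 0)"
        using brownian_nn_integral_exp[OF bm, of 1 \<sigma>] brownian_nn_integral_exp[OF bm, of 1 "- \<sigma>"]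
        by (simp add: nn_integral_add nn_integral_cmult emeasure_space_1)
      ultimately show "(\<integral>\<^sup>+\<omega>. ?w \<omega> \<partial>M) < \<infinity>"
        by (simp add: ennreal_mult_less_top)
    next
      show "AE \<omega> in M. (\<lambda>i. J (\<sigma> * (sqrt (S i) * B 1 \<omega>))) \<longlonglongrightarrow> J 0"
      proof (intro AE_I2 J_lim)
        fix \<omega>
        have "(\<lambda>i. \<sigma> * (sqrt (S i) * B 1 \<omega>)) \<longlonglongrightarrow> \<sigma> * (sqrt 0 * B 1 \<omega>)"
          by (intro tendsto_intros S(3))
        then show "(\<lambda>i. \<sigma> * (sqrt (S i) * B 1 \<omega>)) \<longlonglongrightarrow> 0" by simp
      qed
    qed measurable
    then show "(\<lambda>n. \<integral>\<^sup>+\<omega>. J (\<sigma> * B (S n) \<omega>) \<partial>M) \<longlonglongrightarrow> J 0"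
      unfolding eq by (simp add: emeasure_space_1)
  qed simp
qed

section \<open>The rate of a general payoff per arrival\<close>

lemma post_arrival_cong:
  "(\<And>i. b (\<theta> i) = b' (\<theta> i)) \<Longrightarrow> post_arrival \<sigma> \<gamma> b \<theta> u i = post_arrival \<sigma> \<gamma> b' \<theta> u i"
  by (induction i) simp_all

lemma pre_arrival_cong:
  "(\<And>i. b (\<theta> i) = b' (\<theta> i)) \<Longrightarrow> pre_arrival \<sigma> \<gamma> b \<theta> u i = pre_arrival \<sigma> \<gamma> b' \<theta> u i"
  using post_arrival_cong[of b \<theta> b'] by (simp add: pre_arrival_def)

text \<open>
  \<open>g b v\<close> stands for the contribution of an arrival at log price \<open>b\<close> (relative to \<open>p0\<close>) and mispricing \<open>v\<close>.
  The pool's own log price \<open>b - v\<close> is constant between arrivals, and at most the log price at the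
  preceding arrival plus \<open>\<gamma>\<close>; this is why the only part of \<open>g\<close> that may grow fast in \<open>v\<close> has to
  be controlled at time 0 only.
\<close>

lemma arrival_rate_limit:
  fixes g :: "real \<Rightarrow> real \<Rightarrow> real" and D :: "real \<Rightarrow> real"
  assumes "prob_space M" and rate: "0 < rate" and \<gamma>: "0 < \<gamma>"
    and bm: "brownian_motion M B"
    and poisson: "poisson_process M rate N"
    and arr: "arrival_times M N \<tau>"
    and BN: "indep_random_elements M B_space (trajectory B) N_space (trajectory N)"
    and zBN: "indep_random_elements M borel z0
                (B_space \<Otimes>\<^sub>M N_space) (\<lambda>\<omega>. (trajectory B \<omega>, trajectory N \<omega>))"
    and gm: "(\<lambda>p. g (fst p) (snd p)) \<in> borel_measurable (borel \<Otimes>\<^sub>M borel)"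
    and g0: "\<And>b v. 0 \<le> g b v" and C: "0 \<le> C"
    and bound: "\<And>b v. g b v \<le> C * (1 + exp b) + D (b - v)"
    and D: "mono D" "\<And>v. D v \<le> C * (1 + exp v)" "\<And>u. D (- u) \<le> g 0 u + C"
    and cont: "AE u in distr M borel z0. isCont (\<lambda>b. g b (u + b)) 0"
  shows "((\<lambda>T. (\<integral>\<^sup>+\<omega>. (\<Sum>i<N T \<omega>. ennreal (g (\<sigma> * B (\<tau> (Suc i) \<omega>) \<omega>)
      (pre_arrival \<sigma> \<gamma> (\<lambda>s. B s \<omega>) (from_zero (\<lambda>i. \<tau> i \<omega>)) (z0 \<omega>) i))) \<partial>M) / ennreal T)
    \<longlongrightarrow> ennreal rate * (\<integral>\<^sup>+u. ennreal (g 0 u) \<partial>distr M borel z0)) (at_right 0)"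
proof -
  interpret prob_space M by fact
  define Q where "Q = distr M borel z0"
  have z0m: "z0 \<in> borel_measurable M" by (rule indep_random_elementsD(1)[OF zBN])
  interpret Q: prob_space Q unfolding Q_def by (rule prob_space_distr[OF z0m])
  define FB where "FB = vimage_algebra (space M) (trajectory B) B_space"
  define FN where "FN = vimage_algebra (space M) (trajectory N) N_space"
  have sp: "space FB = space M" "space FN = space M" by (simp_all add: FB_def FN_def)
  define \<theta> where "\<theta> = (\<lambda>i \<omega>. from_zero (\<lambda>i. \<tau> i \<omega>) i)"
  \<comment> \<open>Extended to negative times by its value at 0, the path is continuous on the
    whole line, as the joint measurability requires.\<close>
  define b where "b = (\<lambda>\<omega> s. B (max 0 s) \<omega>)"
  \<comment> \<open>Coordinates: the initial mispricing, a sample point read through the Brownian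
    path, and one read through the arrival process.\<close>
  define S3 where "S3 = (borel :: real measure) \<Otimes>\<^sub>M (FB \<Otimes>\<^sub>M FN)"
  have Nm: "N t \<in> measurable FN (count_space UNIV)" if "0 \<le> t" for t
    unfolding FN_def by (rule measurable_vimage_trajectory[OF indep_random_elementsD(2)[OF BN] that])
  have \<theta>m[measurable]: "\<theta> i \<in> borel_measurable FN" for i
    unfolding \<theta>_def by (rule borel_measurable_arrival_time[OF arr sp(2) Nm])
  have \<theta>mM: "\<theta> i \<in> borel_measurable M" for i
    unfolding \<theta>_def by (rule borel_measurable_arrival_time[OF arr refl]) (use poisson in \<open>simp add: poisson_process_def\<close>)
  have \<theta>0: "0 \<le> \<theta> i \<omega>" if "\<omega> \<in> space M" for i \<omega>
    using arrival_time_pos[OF arr that] by (cases i) (auto simp: \<theta>_def intro: less_imp_le)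
  have b0: "b \<omega> 0 = 0" if "\<omega> \<in> space M" for \<omega>
    using bm that by (simp add: b_def brownian_motion_def)
  have bjm: "(\<lambda>(s, \<omega>). b \<omega> s) \<in> borel_measurable (borel \<Otimes>\<^sub>M FB)"
  proof (rule borel_measurable_continuous_section)
    show "(\<lambda>\<omega>. b \<omega> s) \<in> borel_measurable FB" for s
      unfolding b_def FB_def
      by (rule measurable_vimage_trajectory[OF indep_random_elementsD(1)[OF BN]]) simp
    fix \<omega> assume "\<omega> \<in> space FB"
    then have "continuous_on {0..} (\<lambda>s. B s \<omega>)" using bm by (simp add: sp brownian_motion_def)
    then show "continuous_on UNIV (\<lambda>s. b \<omega> s)"
      unfolding b_def by (rule continuous_on_compose2) (auto intro!: continuous_intros)
  qed
  have b\<theta>m[measurable]: "(\<lambda>p. b (fst (snd p)) (\<theta> i (snd (snd p)))) \<in> borel_measurable S3" for i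
  proof -
    have "(\<lambda>p. (\<theta> i (snd (snd p)), fst (snd p))) \<in> measurable S3 (borel \<Otimes>\<^sub>M FB)"
      unfolding S3_def by measurable
    from measurable_compose[OF this bjm] show ?thesis by simp
  qed
  have um[measurable]: "(\<lambda>p. fst p) \<in> borel_measurable S3" unfolding S3_def by measurable
  have \<theta>S[measurable]: "(\<lambda>p. \<theta> i (snd (snd p))) \<in> borel_measurable S3" for i
    unfolding S3_def by measurable
  have postm[measurable]: "(\<lambda>p. post_arrival \<sigma> \<gamma> (b (fst (snd p))) (\<lambda>i. \<theta> i (snd (snd p))) (fst p) i)
      \<in> borel_measurable S3" for i
    by (induction i) (simp_all add: clamp_to_def)
  have prem[measurable]: "(\<lambda>p. pre_arrival \<sigma> \<gamma> (b (fst (snd p))) (\<lambda>i. \<theta> i (snd (snd p))) (fst p) i)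
      \<in> borel_measurable S3" for i
    unfolding pre_arrival_def by measurable
  define G where "G = (\<lambda>i u \<omega>1 \<omega>2. g (\<sigma> * b \<omega>1 (\<theta> (Suc i) \<omega>2))
      (pre_arrival \<sigma> \<gamma> (b \<omega>1) (\<lambda>i. \<theta> i \<omega>2) u i))"
  have Gm[measurable]: "(\<lambda>p. G i (fst p) (fst (snd p)) (snd (snd p))) \<in> borel_measurable S3" for i
  proof -
    have "(\<lambda>p. (\<sigma> * b (fst (snd p)) (\<theta> (Suc i) (snd (snd p))),
        pre_arrival \<sigma> \<gamma> (b (fst (snd p))) (\<lambda>i. \<theta> i (snd (snd p))) (fst p) i)) \<in> measurable S3 (borel \<Otimes>\<^sub>M borel)"
      by measurable
    from measurable_compose[OF this gm] show ?thesis unfolding G_def by simp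
  qed
  \<comment> \<open>The mean contribution of arrival \<open>Suc i\<close>, with the three
    independent sources integrated separately. For fixed \<open>\<omega>2\<close> the arrival times
    are constants.\<close>
  define I where "I = (\<lambda>T i. \<integral>\<^sup>+\<omega>2. (\<integral>\<^sup>+\<omega>1. (\<integral>\<^sup>+u. ennreal (G i u \<omega>1 \<omega>2) *
      indicator {..T} (\<theta> (Suc i) \<omega>2) \<partial>Q) \<partial>M) \<partial>M)"
  define E where "E = (\<lambda>T. \<integral>\<^sup>+\<omega>. (\<Sum>i<N T \<omega>. ennreal (g (\<sigma> * B (\<tau> (Suc i) \<omega>) \<omega>)
      (pre_arrival \<sigma> \<gamma> (\<lambda>s. B s \<omega>) (from_zero (\<lambda>i. \<tau> i \<omega>)) (z0 \<omega>) i))) \<partial>M)"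
  have idm: "(\<lambda>\<omega>. (z0 \<omega>, \<omega>, \<omega>)) \<in> measurable M S3"
    unfolding S3_def FB_def FN_def using z0m indep_random_elementsD(1,2)[OF BN]
    by (intro measurable_Pair measurable_vimage_algebra2) auto
  have E_eq: "E T = (\<Sum>i. I T i)" if T: "0 < T" for T
  proof -
    have "E T = (\<integral>\<^sup>+\<omega>. (\<Sum>i. ennreal (G i (z0 \<omega>) \<omega> \<omega>) * indicator {..T} (\<theta> (Suc i) \<omega>)) \<partial>M)"
      unfolding E_def
    proof (rule nn_integral_cong)
      fix \<omega> assume \<omega>: "\<omega> \<in> space M"
      have in_iff: "\<theta> (Suc i) \<omega> \<le> T \<longleftrightarrow> i < N T \<omega>" for i
        using arr \<omega> T by (simp add: \<theta>_def arrival_times_def Suc_le_eq)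
      have "(\<Sum>i. ennreal (G i (z0 \<omega>) \<omega> \<omega>) * indicator {..T} (\<theta> (Suc i) \<omega>))
          = (\<Sum>i<N T \<omega>. ennreal (G i (z0 \<omega>) \<omega> \<omega>) * indicator {..T} (\<theta> (Suc i) \<omega>))"
        by (intro suminf_finite) (auto simp: in_iff)
      also have "\<dots> = (\<Sum>i<N T \<omega>. ennreal (g (\<sigma> * B (\<tau> (Suc i) \<omega>) \<omega>)
          (pre_arrival \<sigma> \<gamma> (\<lambda>s. B s \<omega>) (from_zero (\<lambda>i. \<tau> i \<omega>)) (z0 \<omega>) i)))"
      proof (rule sum.cong[OF refl])
        fix i assume i: "i \<in> {..<N T \<omega>}"
        have eqb: "b \<omega> (\<theta> j \<omega>) = B (\<theta> j \<omega>) \<omega>" for j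
          using \<theta>0[OF \<omega>, of j] by (simp add: b_def max_def)
        then have "pre_arrival \<sigma> \<gamma> (b \<omega>) (\<lambda>i. \<theta> i \<omega>) (z0 \<omega>) i
            = pre_arrival \<sigma> \<gamma> (\<lambda>s. B s \<omega>) (\<lambda>i. \<theta> i \<omega>) (z0 \<omega>) i"
          by (intro pre_arrival_cong)
        moreover have "(\<lambda>i. \<theta> i \<omega>) = from_zero (\<lambda>i. \<tau> i \<omega>)" by (simp add: \<theta>_def)
        moreover have "\<theta> (Suc i) \<omega> = \<tau> (Suc i) \<omega>" by (simp add: \<theta>_def)
        ultimately show "ennreal (G i (z0 \<omega>) \<omega> \<omega>) * indicator {..T} (\<theta> (Suc i) \<omega>) =
            ennreal (g (\<sigma> * B (\<tau> (Suc i) \<omega>) \<omega>)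
              (pre_arrival \<sigma> \<gamma> (\<lambda>s. B s \<omega>) (from_zero (\<lambda>i. \<tau> i \<omega>)) (z0 \<omega>) i))"
          using i in_iff[of i] eqb[of "Suc i"] by (simp add: G_def)
      qed
      finally show "(\<Sum>i<N T \<omega>. ennreal (g (\<sigma> * B (\<tau> (Suc i) \<omega>) \<omega>)
          (pre_arrival \<sigma> \<gamma> (\<lambda>s. B s \<omega>) (from_zero (\<lambda>i. \<tau> i \<omega>)) (z0 \<omega>) i)))
        = (\<Sum>i. ennreal (G i (z0 \<omega>) \<omega> \<omega>) * indicator {..T} (\<theta> (Suc i) \<omega>))" by simp
    qed
    also have "\<dots> = (\<Sum>i. \<integral>\<^sup>+\<omega>. ennreal (G i (z0 \<omega>) \<omega> \<omega>) * indicator {..T} (\<theta> (Suc i) \<omega>) \<partial>M)"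
    proof (rule nn_integral_suminf)
      fix i
      have "(\<lambda>\<omega>. G i (z0 \<omega>) \<omega> \<omega>) \<in> borel_measurable M"
        using measurable_compose[OF idm Gm[of i]] by simp
      then show "(\<lambda>\<omega>. ennreal (G i (z0 \<omega>) \<omega> \<omega>) * indicator {..T} (\<theta> (Suc i) \<omega>)) \<in> borel_measurable M"
        using \<theta>mM[of "Suc i"] by measurable
    qed
    also have "\<dots> = (\<Sum>i. I T i)"
    proof (rule suminf_cong)
      fix i
      have "(\<lambda>p. ennreal (G i (fst p) (fst (snd p)) (snd (snd p))) * indicator {..T} (\<theta> (Suc i) (snd (snd p))))
          \<in> borel_measurable S3"
        by measurable
      from nn_integral_independent[OF BN zBN this[unfolded S3_def FB_def FN_def]]
      show "(\<integral>\<^sup>+\<omega>. ennreal (G i (z0 \<omega>) \<omega> \<omega>) * indicator {..T} (\<theta> (Suc i) \<omega>) \<partial>M) = I T i"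
        by (simp add: I_def Q_def)
    qed
    finally show ?thesis .
  qed
  define h where "h = (\<lambda>s. \<integral>\<^sup>+\<omega>. \<integral>\<^sup>+u. ennreal (g (\<sigma> * B s \<omega>) (u + \<sigma> * B s \<omega>)) \<partial>Q \<partial>M)"
  \<comment> \<open>Before the first arrival there is no clamping, and the path starts at 0, so the
    mispricing is the initial one plus \<open>\<sigma> * B\<close>.\<close>
  have I0: "I T 0 = (\<integral>\<^sup>+\<omega>. h (\<tau> 1 \<omega>) * indicator {..T} (\<tau> 1 \<omega>) \<partial>M)" for T
    unfolding I_def
  proof (rule nn_integral_cong)
    fix \<omega>2 assume \<omega>2: "\<omega>2 \<in> space M"
    have \<theta>1: "\<theta> (Suc 0) \<omega>2 = \<tau> 1 \<omega>2" "\<theta> 0 \<omega>2 = 0" by (simp_all add: \<theta>_def)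
    have "(\<integral>\<^sup>+\<omega>1. (\<integral>\<^sup>+u. ennreal (G 0 u \<omega>1 \<omega>2) \<partial>Q) \<partial>M) = h (\<tau> 1 \<omega>2)"
      unfolding h_def
    proof (intro nn_integral_cong)
      fix \<omega>1 u assume "\<omega>1 \<in> space M"
      then show "ennreal (G 0 u \<omega>1 \<omega>2) = ennreal (g (\<sigma> * B (\<tau> 1 \<omega>2) \<omega>1) (u + \<sigma> * B (\<tau> 1 \<omega>2) \<omega>1))"
        using b0[of \<omega>1] arrival_time_pos[OF arr \<omega>2, of 1] unfolding G_def pre_arrival_def \<theta>1
        by (simp add: b_def max_def)
    qed
    then show "(\<integral>\<^sup>+\<omega>1. (\<integral>\<^sup>+u. ennreal (G 0 u \<omega>1 \<omega>2) * indicator {..T} (\<theta> (Suc 0) \<omega>2) \<partial>Q) \<partial>M)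
        = h (\<tau> 1 \<omega>2) * indicator {..T} (\<tau> 1 \<omega>2)"
      unfolding \<theta>1 by (cases "\<tau> 1 \<omega>2 \<le> T") simp_all
  qed
  \<comment> \<open>The 2 collects the constants of the two growth bounds,
    \<open>exp (\<sigma>\<^sup>2 / 2)\<close> bounds the mean of \<open>exp (\<sigma> * B r)\<close>
    for \<open>r \<le> 1\<close>, and \<open>exp \<gamma>\<close> stems from the clamped
    mispricing.\<close>
  define c where "c = ennreal (C * (2 + exp (\<sigma>\<^sup>2 / 2) + exp \<gamma> * exp (\<sigma>\<^sup>2 / 2)))"
  have later: "I T (Suc i) \<le> c * emeasure M {\<omega> \<in> space M. \<tau> (Suc (Suc i)) \<omega> \<le> T}" if T: "T \<le> 1" for T i
  proof -
    have inner: "(\<integral>\<^sup>+\<omega>1. (\<integral>\<^sup>+u. ennreal (G (Suc i) u \<omega>1 \<omega>2) \<partial>Q) \<partial>M) \<le> c"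
      if \<omega>2: "\<omega>2 \<in> space M" and le: "\<theta> (Suc (Suc i)) \<omega>2 \<le> 1" for \<omega>2
    proof -
      define s t where "s = \<theta> (Suc i) \<omega>2" and "t = \<theta> (Suc (Suc i)) \<omega>2"
      have s0: "0 \<le> s" and t0: "0 \<le> t" using \<theta>0[OF \<omega>2] by (auto simp: s_def t_def)
      have "s \<le> t" using arr \<omega>2 by (auto simp: s_def t_def \<theta>_def arrival_times_def intro: less_imp_le)
      then have s1: "s \<le> 1" and t1: "t \<le> 1" using le by (auto simp: t_def)
      have Bsm[measurable]: "B s \<in> borel_measurable M" "B t \<in> borel_measurable M"
        using bm s0 t0 by (simp_all add: brownian_motion_def)
      have K: "(\<integral>\<^sup>+\<omega>. ennreal (exp (\<sigma> * B r \<omega>)) \<partial>M) \<le> ennreal (exp (\<sigma>\<^sup>2 / 2))" if "0 \<le> r" "r \<le> 1" for r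
        unfolding brownian_nn_integral_exp[OF bm that(1)]
        using that mult_left_le[of r "\<sigma>\<^sup>2"] by (intro ennreal_leI) simp
      have "(\<integral>\<^sup>+\<omega>1. (\<integral>\<^sup>+u. ennreal (G (Suc i) u \<omega>1 \<omega>2) \<partial>Q) \<partial>M) \<le>
        (\<integral>\<^sup>+\<omega>1. (\<integral>\<^sup>+u. ennreal (C * (2 + exp (\<sigma> * B t \<omega>1) + exp \<gamma> * exp (\<sigma> * B s \<omega>1))) \<partial>Q) \<partial>M)"
      proof (intro nn_integral_mono ennreal_leI)
        fix \<omega>1 u
        let ?post = "post_arrival \<sigma> \<gamma> (b \<omega>1) (\<lambda>i. \<theta> i \<omega>2) u (Suc i)"
        have bs: "b \<omega>1 s = B s \<omega>1" "b \<omega>1 t = B t \<omega>1" using s0 t0 by (simp_all add: b_def max_def)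
        have "- \<gamma> \<le> ?post" by (rule post_arrival_Suc_ge) (use \<gamma> in simp)
        \<comment> \<open>The increment up to \<open>t\<close> cancels: the pool's log price is
          still the one left by the preceding arrival.\<close>
        then have pool: "\<sigma> * B t \<omega>1 - (?post + \<sigma> * (B t \<omega>1 - B s \<omega>1)) \<le> \<gamma> + \<sigma> * B s \<omega>1"
          by (simp add: right_diff_distrib)
        have "G (Suc i) u \<omega>1 \<omega>2 = g (\<sigma> * B t \<omega>1) (?post + \<sigma> * (B t \<omega>1 - B s \<omega>1))"
          unfolding G_def pre_arrival_def s_def[symmetric] t_def[symmetric] bs ..
        also have "\<dots> \<le> C * (1 + exp (\<sigma> * B t \<omega>1)) + D (\<sigma> * B t \<omega>1 - (?post + \<sigma> * (B t \<omega>1 - B s \<omega>1)))"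
          by (rule bound)
        also have "D (\<sigma> * B t \<omega>1 - (?post + \<sigma> * (B t \<omega>1 - B s \<omega>1))) \<le> D (\<gamma> + \<sigma> * B s \<omega>1)"
          using D(1) pool by (rule monoD)
        also have "\<dots> \<le> C * (1 + exp (\<gamma> + \<sigma> * B s \<omega>1))" by (rule D(2))
        finally show "G (Suc i) u \<omega>1 \<omega>2 \<le> C * (2 + exp (\<sigma> * B t \<omega>1) + exp \<gamma> * exp (\<sigma> * B s \<omega>1))"
          by (simp add: exp_add algebra_simps)
      qed
      also have "\<dots> = (\<integral>\<^sup>+\<omega>1. ennreal C * (2 + ennreal (exp (\<sigma> * B t \<omega>1)) + ennreal (exp \<gamma>) * ennreal (exp (\<sigma> * B s \<omega>1))) \<partial>M)"
        using C by (intro nn_integral_cong) (simp add: Q.emeasure_space_1 ennreal_mult ennreal_plus)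
      also have "\<dots> = ennreal C * (2 + (\<integral>\<^sup>+\<omega>1. ennreal (exp (\<sigma> * B t \<omega>1)) \<partial>M) +
          ennreal (exp \<gamma>) * (\<integral>\<^sup>+\<omega>1. ennreal (exp (\<sigma> * B s \<omega>1)) \<partial>M))"
        by (simp add: nn_integral_add nn_integral_cmult emeasure_space_1)
      also have "\<dots> \<le> ennreal C * (2 + ennreal (exp (\<sigma>\<^sup>2 / 2)) + ennreal (exp \<gamma>) * ennreal (exp (\<sigma>\<^sup>2 / 2)))"
        by (intro mult_left_mono add_mono K s0 s1 t0 t1) auto
      also have "\<dots> = c" unfolding c_def using C by (simp add: ennreal_mult ennreal_plus)
      finally show ?thesis .
    qed
    have "I T (Suc i) \<le> (\<integral>\<^sup>+\<omega>2. c * indicator {\<omega> \<in> space M. \<tau> (Suc (Suc i)) \<omega> \<le> T} \<omega>2 \<partial>M)"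
      unfolding I_def
    proof (rule nn_integral_mono)
      fix \<omega>2 assume \<omega>2: "\<omega>2 \<in> space M"
      have "\<theta> (Suc (Suc i)) \<omega>2 = \<tau> (Suc (Suc i)) \<omega>2" by (simp add: \<theta>_def)
      then show "(\<integral>\<^sup>+\<omega>1. (\<integral>\<^sup>+u. ennreal (G (Suc i) u \<omega>1 \<omega>2) * indicator {..T} (\<theta> (Suc (Suc i)) \<omega>2) \<partial>Q) \<partial>M)
          \<le> c * indicator {\<omega> \<in> space M. \<tau> (Suc (Suc i)) \<omega> \<le> T} \<omega>2"
        using inner[OF \<omega>2] \<omega>2 T by (cases "\<tau> (Suc (Suc i)) \<omega>2 \<le> T") auto
    qed
    also have "\<dots> = c * emeasure M {\<omega> \<in> space M. \<tau> (Suc (Suc i)) \<omega> \<le> T}"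
      using \<theta>mM[of "Suc (Suc i)"] by (intro nn_integral_cmult_indicator) (simp add: \<theta>_def)
    finally show ?thesis .
  qed
  define R where "R = (\<lambda>T. \<Sum>i. I T (Suc i))"
  have R_le: "R T \<le> c * ennreal ((rate * T)\<^sup>2)" if T: "0 < T" "T \<le> 1" for T
  proof -
    have "R T \<le> (\<Sum>i. c * emeasure M {\<omega> \<in> space M. \<tau> (Suc (Suc i)) \<omega> \<le> T})"
      unfolding R_def by (intro suminf_le later[OF T(2)]) auto
    also have "\<dots> \<le> c * ennreal ((rate * T)\<^sup>2)"
      by (simp add: nn_integral_later_arrivals_le[OF poisson arr rate T(1)] mult_left_mono)
    finally show ?thesis .
  qed
  have pos: "\<forall>\<^sub>F T in at_right (0::real). 0 < T \<and> T < 1"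
    unfolding eventually_at_right_field by (intro exI[of _ 1]) auto
  have R_lim: "((\<lambda>T. R T / ennreal T) \<longlongrightarrow> 0) (at_right 0)"
  proof (rule tendsto_sandwich[OF _ _ tendsto_const])
    show "\<forall>\<^sub>F T in at_right 0. R T / ennreal T \<le> c * ennreal (rate\<^sup>2 * T)"
      using pos
    proof eventually_elim
      case (elim T)
      then have "R T / ennreal T \<le> c * ennreal ((rate * T)\<^sup>2) / ennreal T"
        by (intro divide_right_mono_ennreal R_le) auto
      also have "\<dots> = c * ennreal (rate\<^sup>2 * T)"
        unfolding ennreal_times_divide[symmetric] using elim
        by (simp add: divide_ennreal power2_eq_square mult_ac)
      finally show ?case .
    qed
    have "((\<lambda>T. rate\<^sup>2 * T) \<longlongrightarrow> rate\<^sup>2 * 0) (at_right 0)" by (intro tendsto_intros)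
    then have "((\<lambda>T. c * ennreal (rate\<^sup>2 * T)) \<longlongrightarrow> c * ennreal 0) (at_right 0)"
      by (intro tendsto_mult_ennreal tendsto_ennrealI tendsto_const) (auto simp: c_def)
    then show "((\<lambda>T. c * ennreal (rate\<^sup>2 * T)) \<longlongrightarrow> 0) (at_right 0)" by simp
  qed simp
  have h_lim: "(h \<longlongrightarrow> (\<integral>\<^sup>+u. ennreal (g 0 u) \<partial>Q)) (at_right 0)"
    unfolding h_def
  proof (rule shifted_expectation_limit[OF bm _ _ gm C])
    show "prob_space Q" "sets Q = sets borel" by (auto simp: Q_def intro: prob_space_distr[OF z0m])
    show "g \<beta> (u + \<beta>) \<le> C * (1 + exp \<beta>) + (g 0 u + C)" for \<beta> u
      using bound[of \<beta> "u + \<beta>"] D(3)[of u] by simp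
    show "AE u in Q. isCont (\<lambda>b. g b (u + b)) 0" unfolding Q_def by (rule cont)
  qed (rule g0)
  have \<tau>1m: "\<tau> 1 \<in> borel_measurable M" using \<theta>mM[of 1] by (simp add: \<theta>_def)
  have "((\<lambda>T. I T 0 / ennreal T + R T / ennreal T) \<longlongrightarrow> ennreal rate * (\<integral>\<^sup>+u. ennreal (g 0 u) \<partial>Q) + 0) (at_right 0)"
    unfolding I0 by (intro tendsto_add R_lim first_arrival_limit[OF poisson arr rate h_lim \<tau>1m])
  then have "((\<lambda>T. E T / ennreal T) \<longlongrightarrow> ennreal rate * (\<integral>\<^sup>+u. ennreal (g 0 u) \<partial>Q) + 0) (at_right 0)"
  proof (rule Lim_transform_eventually)
    show "\<forall>\<^sub>F T in at_right 0. I T 0 / ennreal T + R T / ennreal T = E T / ennreal T"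
      using pos
    proof eventually_elim
      case (elim T)
      \<comment> \<open>The first arrival is split off; only this term survives division by
        \<open>T\<close>.\<close>
      have "E T = I T 0 + R T"
        using E_eq[of T] elim suminf_offset[of "I T" 1] by (simp add: R_def add.commute)
      then show ?case by (simp add: add_divide_distrib_ennreal)
    qed
  qed
  then show ?thesis unfolding E_def Q_def by simp
qed

section \<open>Reserves, profits and fees\<close>

lemma pool_value_eq:
  assumes "optimal_reserves f L p x y"
  shows "pool_value f L p = p * x + y"
  unfolding pool_value_def using assms
  by (intro cInf_eq_minimum) (force simp: optimal_reserves_def)+

text \<open>Envelope theorem: \<open>q x\<^sup>*(p) + y\<^sup>*(p) - V(q) \<ge> 0\<close> with equality at \<open>q = p\<close>.\<close>

lemma deriv_pool_value:
  assumes opt: "\<And>p. 0 \<le> p \<Longrightarrow> optimal_reserves f L p (xs p) (ys p)"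
    and p: "0 < p" and der: "(pool_value f L has_real_derivative d) (at p)"
  shows "xs p = d"
proof -
  let ?\<phi> = "\<lambda>q. q * xs p + ys p - pool_value f L q"
  have "(?\<phi> has_real_derivative xs p - d) (at p)"
    using der by (auto intro!: derivative_eq_intros)
  moreover have "?\<phi> p \<le> ?\<phi> q" if "\<bar>p - q\<bar> < p" for q
  proof -
    have q: "0 \<le> q" using that by auto
    have "?\<phi> p = 0" using pool_value_eq[OF opt[of p]] p by simp
    moreover have "0 \<le> ?\<phi> q"
      using pool_value_eq[OF opt[OF q]] optimal_reserves_exchange(1)[OF opt[OF q] opt[of p]] p by simp
    ultimately show ?thesis by simp
  qed
  ultimately have "xs p - d = 0" using p by (intro DERIV_local_min[of ?\<phi> _ p p]) auto
  then show ?thesis by simp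
qed

text \<open>The envelope identity makes \<open>xs\<close> the derivative of the pool value, which is
  itself differentiable; then \<open>ys\<close> is the pool value minus
  \<open>p * xs p\<close>.\<close>

lemma
  assumes opt: "\<And>p. 0 \<le> p \<Longrightarrow> optimal_reserves f L p (xs p) (ys p)"
    and smooth: "twice_cont_diff_on {0<..} (pool_value f L)"
  shows continuous_on_xs: "continuous_on {0<..} xs"
    and continuous_on_ys: "continuous_on {0<..} ys"
proof -
  obtain V' V'' where
    V': "\<And>x. 0 < x \<Longrightarrow> (pool_value f L has_real_derivative V' x) (at x)" and
    V'': "\<And>x. 0 < x \<Longrightarrow> (V' has_real_derivative V'' x) (at x)"
    using smooth unfolding twice_cont_diff_on_def by auto
  have xV: "xs p = V' p" if "0 < p" for p
    by (rule deriv_pool_value[OF opt that V'[OF that]])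
  have "continuous_on {0<..} V'"
    using V'' by (intro DERIV_continuous_on[of _ _ V'']) (auto intro: has_field_derivative_at_within)
  then show xc: "continuous_on {0<..} xs"
    by (rule continuous_on_eq) (simp add: xV)
  have "continuous_on {0<..} (pool_value f L)"
    using V' by (intro DERIV_continuous_on[of _ _ V']) (auto intro: has_field_derivative_at_within)
  then have "continuous_on {0<..} (\<lambda>p. pool_value f L p - p * xs p)"
    using xc by (intro continuous_intros)
  then show "continuous_on {0<..} ys"
    by (rule continuous_on_eq) (use pool_value_eq[OF opt] in auto)
qed

text \<open>The jump sits at \<open>b = c - u\<close>, away from 0, so the indicator is locally
  constant there.\<close>

lemma isCont_indicator_shift:
  fixes u :: real
  assumes "u \<noteq> c"
  shows "isCont (\<lambda>b. indicator {z. c < z} (u + b) :: real) 0"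
    and "isCont (\<lambda>b. indicator {z. z < c} (u + b) :: real) 0"
proof -
  have ev: "\<forall>\<^sub>F b in nhds 0. \<bar>b\<bar> < \<bar>u - c\<bar>"
    unfolding eventually_nhds_metric using assms by (intro exI[of _ "\<bar>u - c\<bar>"]) auto
  then have "\<forall>\<^sub>F b in nhds 0. indicator {z. c < z} (u + b) = (indicator {z. c < z} u :: real)"
    by eventually_elim (auto simp: indicator_def)
  from isCont_cong[OF this] show "isCont (\<lambda>b. indicator {z. c < z} (u + b) :: real) 0" by simp
  from ev have "\<forall>\<^sub>F b in nhds 0. indicator {z. z < c} (u + b) = (indicator {z. z < c} u :: real)"
    by eventually_elim (auto simp: indicator_def)
  from isCont_cong[OF this] show "isCont (\<lambda>b. indicator {z. z < c} (u + b) :: real) 0" by simp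
qed

section \<open>Reserves, profits and fees in logarithmic prices\<close>

locale amm_pool =
  fixes f :: "real \<Rightarrow> real \<Rightarrow> real" and L :: real and xs ys :: "real \<Rightarrow> real" and p0 \<gamma> :: real
  assumes opt: "\<And>p. 0 \<le> p \<Longrightarrow> optimal_reserves f L p (xs p) (ys p)"
    and smooth: "twice_cont_diff_on {0<..} (pool_value f L)"
    and p0: "0 < p0" and \<gamma>: "0 < \<gamma>"
begin

definition X :: "real \<Rightarrow> real" where "X r = xs (p0 * exp r)"
definition Y :: "real \<Rightarrow> real" where "Y r = ys (p0 * exp r)"

lemma opt_exp: "optimal_reserves f L (p0 * exp r) (X r) (Y r)"
  unfolding X_def Y_def using p0 by (intro opt) simp

lemma nonneg: "0 \<le> X r" "0 \<le> Y r" "0 \<le> xs 0" "0 \<le> ys 0"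
  using opt_exp[of r] opt[of 0] by (auto simp: optimal_reserves_def feasible_def)

text \<open>Since an optimum exists at price 0, \<open>x\<^sup>*\<close> is bounded and \<open>y\<^sup>*\<close> grows at most linearly.\<close>

lemma X_le: "X r \<le> xs 0"
  using optimal_reserves_mono(1)[OF opt[of 0] opt_exp[of r]] p0 by simp

lemma Y_le: "Y r \<le> p0 * exp r * xs 0 + ys 0"
proof -
  have "p0 * exp r * X r + Y r \<le> p0 * exp r * xs 0 + ys 0"
    by (rule optimal_reserves_exchange(1)[OF opt_exp opt]) simp
  moreover have "0 \<le> p0 * exp r * X r" using p0 nonneg by simp
  ultimately show ?thesis by simp
qed

lemma X_antimono: "r \<le> s \<Longrightarrow> X s \<le> X r"
  using optimal_reserves_mono(1)[OF opt_exp[of r] opt_exp[of s]] p0 by (cases "r = s") auto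

lemma Y_mono: "r \<le> s \<Longrightarrow> Y r \<le> Y s"
  using optimal_reserves_mono(2)[OF opt_exp[of r] opt_exp[of s]] p0 by (cases "r = s") auto

lemma continuous_XY: "continuous_on UNIV X" "continuous_on UNIV Y"
  unfolding X_def Y_def
  by (rule continuous_on_compose2[OF continuous_on_xs[OF opt smooth]]
      continuous_on_compose2[OF continuous_on_ys[OF opt smooth]];
      use p0 in \<open>auto intro!: continuous_intros\<close>)+

lemma isCont_XY: "isCont X r" "isCont Y r"
  using continuous_XY by (auto simp: continuous_on_eq_continuous_at)

lemma measurable_XY [measurable]: "X \<in> borel_measurable borel" "Y \<in> borel_measurable borel"
  using continuous_XY by (auto intro: borel_measurable_continuous_onI)

lemma pool_price: "p0 * exp b * exp v = p0 * exp (b + v)"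
  by (simp add: exp_add)

lemma A_plus_eq: "A_plus xs ys \<gamma> (p0 * exp b) v =
    (p0 * exp b * (X (b - v) - X (b - \<gamma>)) + exp \<gamma> * (Y (b - v) - Y (b - \<gamma>))) * indicator {z. \<gamma> < z} v"
  unfolding A_plus_def pool_price by (simp add: X_def Y_def)

lemma A_minus_eq: "A_minus xs ys \<gamma> (p0 * exp b) v =
    (exp \<gamma> * (p0 * exp b) * (X (b - v) - X (b + \<gamma>)) + (Y (b - v) - Y (b + \<gamma>))) * indicator {z. z < - \<gamma>} v"
  unfolding A_minus_def pool_price by (simp add: X_def Y_def)

lemma F_plus_eq: "F_plus ys \<gamma> (p0 * exp b) v =
    - (exp \<gamma> - 1) * (Y (b - v) - Y (b - \<gamma>)) * indicator {z. \<gamma> < z} v"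
  unfolding F_plus_def pool_price by (simp add: Y_def)

lemma F_minus_eq: "F_minus xs \<gamma> (p0 * exp b) v =
    - (exp \<gamma> - 1) * (p0 * exp b) * (X (b - v) - X (b + \<gamma>)) * indicator {z. z < - \<gamma>} v"
  unfolding F_minus_def pool_price by (simp add: X_def)

lemma pos_price: "0 < p0 * exp b"
  using p0 by simp

lemmas nonneg_rates =
  A_plus_nonneg[OF opt pos_price \<gamma>] A_minus_nonneg[OF opt pos_price \<gamma>]
  F_plus_nonneg[OF opt pos_price \<gamma>] F_minus_nonneg[OF opt pos_price \<gamma>]

lemma A_total_nonneg: "0 \<le> A_total xs ys \<gamma> (p0 * exp b) v"
  and F_total_nonneg: "0 \<le> F_total xs ys \<gamma> (p0 * exp b) v"
  using nonneg_rates by (simp_all add: A_total_def F_total_def)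

lemma A_total_measurable:
  "(\<lambda>p. A_total xs ys \<gamma> (p0 * exp (fst p)) (snd p)) \<in> borel_measurable (borel \<Otimes>\<^sub>M borel)"
  unfolding A_total_def A_plus_eq A_minus_eq by measurable

lemma F_total_measurable:
  "(\<lambda>p. F_total xs ys \<gamma> (p0 * exp (fst p)) (snd p)) \<in> borel_measurable (borel \<Otimes>\<^sub>M borel)"
  unfolding F_total_def F_plus_eq F_minus_eq by measurable

lemma rates_measurable_section:
  "A_plus xs ys \<gamma> p0 \<in> borel_measurable borel" "A_minus xs ys \<gamma> p0 \<in> borel_measurable borel"
  "F_plus ys \<gamma> p0 \<in> borel_measurable borel" "F_minus xs \<gamma> p0 \<in> borel_measurable borel"
proof -
  have "(\<lambda>v. A_plus xs ys \<gamma> (p0 * exp 0) v) \<in> borel_measurable borel" unfolding A_plus_eq by measurable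
  moreover have "(\<lambda>v. A_minus xs ys \<gamma> (p0 * exp 0) v) \<in> borel_measurable borel" unfolding A_minus_eq by measurable
  moreover have "(\<lambda>v. F_plus ys \<gamma> (p0 * exp 0) v) \<in> borel_measurable borel" unfolding F_plus_eq by measurable
  moreover have "(\<lambda>v. F_minus xs \<gamma> (p0 * exp 0) v) \<in> borel_measurable borel" unfolding F_minus_eq by measurable
  ultimately show "A_plus xs ys \<gamma> p0 \<in> borel_measurable borel" "A_minus xs ys \<gamma> p0 \<in> borel_measurable borel"
    "F_plus ys \<gamma> p0 \<in> borel_measurable borel" "F_minus xs \<gamma> p0 \<in> borel_measurable borel" by simp_all
qed

text \<open>Shifting price and mispricing together leaves the pool's log price at
  \<open>- u\<close>, so its reserves are constants in \<open>b\<close>. The reserves at the edges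
  of the band move continuously, and the indicators jump only at
  \<open>\<plusminus>\<gamma>\<close>.\<close>

lemma isCont_total:
  assumes "u \<noteq> \<gamma>" "u \<noteq> - \<gamma>"
  shows "isCont (\<lambda>b. A_total xs ys \<gamma> (p0 * exp b) (u + b)) 0"
    and "isCont (\<lambda>b. F_total xs ys \<gamma> (p0 * exp b) (u + b)) 0"
proof -
  have XY: "isCont (\<lambda>b. X (b - \<gamma>)) 0" "isCont (\<lambda>b. Y (b - \<gamma>)) 0"
    "isCont (\<lambda>b. X (b + \<gamma>)) 0" "isCont (\<lambda>b. Y (b + \<gamma>)) 0"
    by (rule isCont_o2[OF _ isCont_XY(1)] isCont_o2[OF _ isCont_XY(2)]; intro continuous_intros)+
  show "isCont (\<lambda>b. A_total xs ys \<gamma> (p0 * exp b) (u + b)) 0"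
    unfolding A_total_def A_plus_eq A_minus_eq
    by (simp only: diff_add_eq_diff_diff_swap diff_self diff_0)
      (intro continuous_intros XY isCont_indicator_shift assms)
  show "isCont (\<lambda>b. F_total xs ys \<gamma> (p0 * exp b) (u + b)) 0"
    unfolding F_total_def F_plus_eq F_minus_eq
    by (simp only: diff_add_eq_diff_diff_swap diff_self diff_0)
      (intro continuous_intros XY isCont_indicator_shift assms)
qed

text \<open>One constant for all growth bounds: the summand with factor 2 serves the two fees, the
  terms in \<open>xs 0\<close> and \<open>ys 0\<close> the growth of profits and of
  \<open>Y\<close>, and \<open>Y \<gamma>\<close> the converse estimate of \<open>Y\<close> by the
  profit.\<close>

definition bound_const :: real where
  "bound_const = 2 * exp \<gamma> * (p0 * xs 0 + ys 0) + p0 * xs 0 + ys 0 + Y \<gamma>"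

lemma bound_const_nonneg: "0 \<le> bound_const"
  unfolding bound_const_def using nonneg p0 by (auto intro!: add_nonneg_nonneg mult_nonneg_nonneg)

lemma bound_const_ge:
  "p0 * xs 0 \<le> bound_const" "p0 * xs 0 + ys 0 \<le> bound_const" "exp \<gamma> * (p0 * xs 0) + Y \<gamma> \<le> bound_const"
  "2 * exp \<gamma> * (p0 * xs 0 + ys 0) \<le> bound_const"
proof -
  have n: "0 \<le> p0 * xs 0" "0 \<le> exp \<gamma> * (p0 * xs 0)" "0 \<le> exp \<gamma> * ys 0"
    using nonneg p0 by auto
  show "p0 * xs 0 \<le> bound_const" "p0 * xs 0 + ys 0 \<le> bound_const"
    "exp \<gamma> * (p0 * xs 0) + Y \<gamma> \<le> bound_const"
    "2 * exp \<gamma> * (p0 * xs 0 + ys 0) \<le> bound_const"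
    using n nonneg(2)[of \<gamma>] nonneg(4) unfolding bound_const_def by (auto simp: algebra_simps)
qed

text \<open>Monotonicity of the reserves disposes of one difference on each side: that of
  \<open>Y\<close> is nonpositive for \<open>v > \<gamma>\<close>, that of \<open>X\<close> for
  \<open>v < - \<gamma>\<close>. What remains is a multiple of the price, respectively
  \<open>Y (b - v)\<close>.\<close>

lemma A_total_le: "A_total xs ys \<gamma> (p0 * exp b) v \<le> bound_const * (1 + exp b) + Y (b - v)"
proof -
  have C: "0 \<le> bound_const * (1 + exp b)" using bound_const_nonneg by (simp add: add_nonneg_nonneg)
  have Ye: "0 \<le> Y (b - v)" by (rule nonneg)
  consider "\<gamma> < v" | "v < - \<gamma>" | "- \<gamma> \<le> v" "v \<le> \<gamma>" by linarith
  then show ?thesis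
  proof cases
    case 1
    have "A_total xs ys \<gamma> (p0 * exp b) v =
        p0 * exp b * (X (b - v) - X (b - \<gamma>)) + exp \<gamma> * (Y (b - v) - Y (b - \<gamma>))"
      using 1 \<gamma> by (simp add: A_total_def A_plus_eq A_minus_eq)
    also have "\<dots> \<le> p0 * exp b * xs 0 + exp \<gamma> * 0"
      using 1 p0 X_le[of "b - v"] nonneg(1)[of "b - \<gamma>"] Y_mono[of "b - v" "b - \<gamma>"]
      by (intro add_mono mult_left_mono) auto
    also have "\<dots> = p0 * xs 0 * exp b" by simp
    also have "\<dots> \<le> bound_const * (1 + exp b)"
      using bound_const_ge(1) bound_const_nonneg by (intro mult_mono) auto
    finally show ?thesis using Ye by simp
  next
    case 2
    have "A_total xs ys \<gamma> (p0 * exp b) v =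
        exp \<gamma> * (p0 * exp b) * (X (b - v) - X (b + \<gamma>)) + (Y (b - v) - Y (b + \<gamma>))"
      using 2 \<gamma> by (simp add: A_total_def A_plus_eq A_minus_eq)
    also have "\<dots> \<le> 0 + Y (b - v)"
      using 2 p0 X_antimono[of "b + \<gamma>" "b - v"] nonneg(2)[of "b + \<gamma>"]
      by (intro add_mono mult_nonneg_nonpos) auto
    finally show ?thesis using C by simp
  next
    case 3
    then have "A_total xs ys \<gamma> (p0 * exp b) v = 0" by (simp add: A_total_def A_plus_eq A_minus_eq)
    then show ?thesis using C Ye by simp
  qed
qed

lemma Y_le_const: "Y v \<le> bound_const * (1 + exp v)"
proof -
  have "Y v \<le> p0 * xs 0 * exp v + ys 0" using Y_le[of v] by (simp add: mult_ac)
  also have "\<dots> \<le> (p0 * xs 0 + ys 0) * (1 + exp v)"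
    using nonneg p0 by (simp add: algebra_simps)
  also have "\<dots> \<le> bound_const * (1 + exp v)"
    using bound_const_ge(2) by (intro mult_right_mono) (auto simp: add_nonneg_nonneg)
  finally show ?thesis .
qed

text \<open>For \<open>u < - \<gamma>\<close> the profit contains \<open>Y (- u)\<close> with
  coefficient one and everything else is bounded below; elsewhere
  \<open>Y (- u) \<le> Y \<gamma>\<close>. Hence a finite mean profit makes \<open>Y (- u)\<close>
  integrable.\<close>

lemma Y_le_A_total: "Y (- u) \<le> A_total xs ys \<gamma> (p0 * exp 0) u + bound_const"
proof (cases "u < - \<gamma>")
  case True
  have eq: "A_total xs ys \<gamma> (p0 * exp 0) u =
      exp \<gamma> * p0 * (X (- u) - X \<gamma>) + (Y (- u) - Y \<gamma>)"
    using True \<gamma> unfolding A_total_def A_plus_eq A_minus_eq by simp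
  have "exp \<gamma> * p0 * (- xs 0) \<le> exp \<gamma> * p0 * (X (- u) - X \<gamma>)"
    using p0 X_le[of \<gamma>] nonneg(1)[of "- u"] by (intro mult_left_mono) auto
  then show ?thesis unfolding eq using bound_const_ge(3) by (simp add: mult.assoc)
next
  case False
  then have "Y (- u) \<le> Y \<gamma>" by (intro Y_mono) simp
  moreover have "0 \<le> exp \<gamma> * (p0 * xs 0)" using nonneg p0 by simp
  ultimately show ?thesis using A_total_nonneg[of 0 u] bound_const_ge(3) by simp
qed

lemma F_total_le: "F_total xs ys \<gamma> (p0 * exp b) v \<le> bound_const * (1 + exp b)"
proof -
  have e: "0 \<le> exp \<gamma> - 1" using \<gamma> by simp
  have "F_plus ys \<gamma> (p0 * exp b) v \<le> exp \<gamma> * (p0 * xs 0 + ys 0) * (1 + exp b)"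
  proof -
    have "F_plus ys \<gamma> (p0 * exp b) v \<le> (exp \<gamma> - 1) * Y (b - \<gamma>)"
    proof (cases "\<gamma> < v")
      case True
      then have "F_plus ys \<gamma> (p0 * exp b) v = (exp \<gamma> - 1) * (Y (b - \<gamma>) - Y (b - v))"
        unfolding F_plus_eq by (simp add: algebra_simps)
      also have "\<dots> \<le> (exp \<gamma> - 1) * Y (b - \<gamma>)"
        using e nonneg(2)[of "b - v"] by (intro mult_left_mono) auto
      finally show ?thesis .
    qed (use e nonneg(2)[of "b - \<gamma>"] in \<open>simp add: F_plus_eq\<close>)
    also have "\<dots> \<le> exp \<gamma> * ((p0 * xs 0 + ys 0) * (1 + exp b))"
    proof (intro mult_mono)
      have "Y (b - \<gamma>) \<le> Y b" using \<gamma> by (intro Y_mono) simp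
      also have "\<dots> \<le> p0 * xs 0 * exp b + ys 0" using Y_le[of b] by (simp add: mult_ac)
      also have "\<dots> \<le> (p0 * xs 0 + ys 0) * (1 + exp b)" using nonneg p0 by (simp add: algebra_simps)
      finally show "Y (b - \<gamma>) \<le> (p0 * xs 0 + ys 0) * (1 + exp b)" .
    qed (use nonneg in auto)
    finally show ?thesis by (simp add: mult.assoc)
  qed
  moreover have "F_minus xs \<gamma> (p0 * exp b) v \<le> exp \<gamma> * (p0 * xs 0 + ys 0) * (1 + exp b)"
  proof -
    have "F_minus xs \<gamma> (p0 * exp b) v = (exp \<gamma> - 1) * (p0 * exp b * (X (b + \<gamma>) - X (b - v))) * indicator {z. z < - \<gamma>} v"
      unfolding F_minus_eq by (simp add: algebra_simps)
    also have "\<dots> \<le> exp \<gamma> * (p0 * exp b * xs 0) * 1"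
    proof (cases "v < - \<gamma>")
      case True
      then have "0 \<le> X (b + \<gamma>) - X (b - v)" using X_antimono[of "b + \<gamma>" "b - v"] by simp
      then show ?thesis
        using e p0 X_le[of "b + \<gamma>"] nonneg(1)[of "b - v"] nonneg(3)
        by (intro mult_mono) (auto simp: indicator_def)
    qed (use p0 nonneg in simp)
    also have "\<dots> = exp \<gamma> * (p0 * xs 0) * exp b" by simp
    also have "\<dots> \<le> exp \<gamma> * (p0 * xs 0 + ys 0) * (1 + exp b)"
      using nonneg p0 by (intro mult_mono) auto
    finally show ?thesis .
  qed
  ultimately have "F_total xs ys \<gamma> (p0 * exp b) v \<le> 2 * exp \<gamma> * (p0 * xs 0 + ys 0) * (1 + exp b)"
    by (simp add: F_total_def)
  also have "\<dots> \<le> bound_const * (1 + exp b)"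
    using bound_const_ge(4) by (intro mult_right_mono) (auto simp: add_nonneg_nonneg)
  finally show ?thesis .
qed

end

section \<open>The stationary distribution and the main result\<close>

lemma stationary_density_nonneg:
  assumes "0 < \<sigma>" "0 < rate" "0 < \<gamma>"
  shows "0 \<le> stationary_density \<sigma> rate \<gamma> z"
  using assms by (auto simp: stationary_density_def stat_eta_def exponential_density_def
      intro!: mult_nonneg_nonneg divide_nonneg_nonneg add_nonneg_nonneg)

lemma stationary_density_measurable [measurable]:
  "stationary_density \<sigma> rate \<gamma> \<in> borel_measurable borel"
  unfolding stationary_density_def exponential_density_def by measurable

lemma AE_stationary_dist_neq: "AE u in stationary_dist \<sigma> rate \<gamma>. u \<noteq> c \<and> u \<noteq> d"
proof -
  have "AE u in lborel. u \<noteq> c \<and> u \<noteq> d"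
    using AE_lborel_singleton[of c] AE_lborel_singleton[of d] by eventually_elim simp
  then have "AE u in lborel. 0 < ennreal (stationary_density \<sigma> rate \<gamma> u) \<longrightarrow> u \<noteq> c \<and> u \<noteq> d"
    by eventually_elim simp
  then show ?thesis unfolding stationary_dist_def by (subst AE_density) simp_all
qed

text \<open>The uniform part contributes nothing, since both functions vanish on the band. The
  substitutions \<open>u = x + \<gamma>\<close> and \<open>u = - x - \<gamma>\<close> carry the two
  exponential tails to the same half line.\<close>

lemma nn_integral_stationary_dist:
  fixes Gp Gm :: "real \<Rightarrow> real"
  assumes pos: "0 < \<sigma>" "0 < rate" "0 < \<gamma>"
    and [measurable]: "Gp \<in> borel_measurable borel" "Gm \<in> borel_measurable borel"
    and nonneg: "\<And>u. 0 \<le> Gp u" "\<And>u. 0 \<le> Gm u"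
    and zero: "\<And>u. u \<le> \<gamma> \<Longrightarrow> Gp u = 0" "\<And>u. - \<gamma> \<le> u \<Longrightarrow> Gm u = 0"
  shows "ennreal rate * (\<integral>\<^sup>+u. ennreal (Gp u + Gm u) \<partial>stationary_dist \<sigma> rate \<gamma>) =
    ennreal (rate * P_trade \<sigma> rate \<gamma> * (sqrt (2 * rate) / \<sigma>)) *
    (\<integral>\<^sup>+x\<in>{0..}. ennreal ((Gp (x + \<gamma>) + Gm (- x - \<gamma>)) / 2 * exp (- sqrt (2 * rate) * x / \<sigma>)) \<partial>lborel)"
proof -
  define k where "k = sqrt (2 * rate) / \<sigma>"
  define c where "c = P_trade \<sigma> rate \<gamma> * k"
  have k: "0 < k" using pos by (simp add: k_def)
  have P: "P_trade \<sigma> rate \<gamma> = 1 / (1 + stat_eta \<sigma> rate \<gamma>)"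
    by (simp add: P_trade_def stat_eta_def)
  have c0: "0 \<le> c" unfolding c_def P_trade_def using pos k by auto
  let ?d = "stationary_density \<sigma> rate \<gamma>"
  have dens: "?d z = c * (exp (- k * x) / 2)" if "0 < x" "\<bar>z\<bar> = x + \<gamma>" for x z
    using that pos unfolding stationary_density_def c_def P exponential_density_def k_def[symmetric]
    by (simp add: mult_ac)
  \<comment> \<open>For \<open>x \<le> 0\<close> the density has another form, but there
    \<open>G = 0\<close>; this includes \<open>x = 0\<close>, which the indicator counts in.\<close>
  have weight: "?d z * G = c * (G / 2 * exp (- k * x)) * indicator {0..} x"
    if "\<bar>z\<bar> = \<bar>x + \<gamma>\<bar>" "x \<le> 0 \<Longrightarrow> G = 0" for z x G
    using that dens[of x z] pos by (cases "0 < x") auto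
  \<comment> \<open>The shape \<open>\<gamma> + 1 * x\<close> is that of the affine change of
    variables used below.\<close>
  have p: "?d (\<gamma> + 1 * x) * Gp (\<gamma> + 1 * x) = c * (Gp (x + \<gamma>) / 2 * exp (- k * x)) * indicator {0..} x" for x
    using weight[of "\<gamma> + 1 * x" x "Gp (x + \<gamma>)"] zero(1)[of "x + \<gamma>"] by (simp add: add.commute)
  have m: "?d (- \<gamma> + - 1 * x) * Gm (- \<gamma> + - 1 * x) = c * (Gm (- x - \<gamma>) / 2 * exp (- k * x)) * indicator {0..} x" for x
  proof -
    have "- \<gamma> + - 1 * x = - x - \<gamma>" by simp
    moreover have "\<bar>- x - \<gamma>\<bar> = \<bar>x + \<gamma>\<bar>" by arith
    ultimately show ?thesis using weight[of "- x - \<gamma>" x "Gm (- x - \<gamma>)"] zero(2)[of "- x - \<gamma>"] by (simp only:)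
  qed
  have "(\<integral>\<^sup>+u. ennreal (Gp u + Gm u) \<partial>stationary_dist \<sigma> rate \<gamma>) =
      (\<integral>\<^sup>+u. ennreal (?d u * Gp u) + ennreal (?d u * Gm u) \<partial>lborel)"
    unfolding stationary_dist_def using stationary_density_nonneg[OF pos] nonneg
    by (subst nn_integral_density) (auto intro!: nn_integral_cong simp: ennreal_mult'[symmetric]
        ennreal_plus[symmetric] distrib_left simp del: ennreal_plus)
  also have "\<dots> = (\<integral>\<^sup>+u. ennreal (?d u * Gp u) \<partial>lborel) + (\<integral>\<^sup>+u. ennreal (?d u * Gm u) \<partial>lborel)"
    by (rule nn_integral_add) measurable
  also have "(\<integral>\<^sup>+u. ennreal (?d u * Gp u) \<partial>lborel) =
      (\<integral>\<^sup>+x. ennreal (c * (Gp (x + \<gamma>) / 2 * exp (- k * x)) * indicator {0..} x) \<partial>lborel)"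
    using nn_integral_real_affine[of "\<lambda>u. ennreal (?d u * Gp u)" 1 \<gamma>] unfolding p by simp
  also have "(\<integral>\<^sup>+u. ennreal (?d u * Gm u) \<partial>lborel) =
      (\<integral>\<^sup>+x. ennreal (c * (Gm (- x - \<gamma>) / 2 * exp (- k * x)) * indicator {0..} x) \<partial>lborel)"
    using nn_integral_real_affine[of "\<lambda>u. ennreal (?d u * Gm u)" "- 1" "- \<gamma>"] unfolding m by simp
  also have "(\<integral>\<^sup>+x. ennreal (c * (Gp (x + \<gamma>) / 2 * exp (- k * x)) * indicator {0..} x) \<partial>lborel) +
      (\<integral>\<^sup>+x. ennreal (c * (Gm (- x - \<gamma>) / 2 * exp (- k * x)) * indicator {0..} x) \<partial>lborel) =
      (\<integral>\<^sup>+x. ennreal (c * (Gp (x + \<gamma>) / 2 * exp (- k * x)) * indicator {0..} x) +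
        ennreal (c * (Gm (- x - \<gamma>) / 2 * exp (- k * x)) * indicator {0..} x) \<partial>lborel)"
    by (rule nn_integral_add[symmetric]) measurable
  also have "\<dots> = (\<integral>\<^sup>+x. ennreal c * (ennreal ((Gp (x + \<gamma>) + Gm (- x - \<gamma>)) / 2 *
      exp (- sqrt (2 * rate) * x / \<sigma>)) * indicator {0..} x) \<partial>lborel)"
  proof (rule nn_integral_cong)
    fix x :: real
    have e: "- k * x = - sqrt (2 * rate) * x / \<sigma>" by (simp add: k_def)
    show "ennreal (c * (Gp (x + \<gamma>) / 2 * exp (- k * x)) * indicator {0..} x) +
        ennreal (c * (Gm (- x - \<gamma>) / 2 * exp (- k * x)) * indicator {0..} x) =
        ennreal c * (ennreal ((Gp (x + \<gamma>) + Gm (- x - \<gamma>)) / 2 *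
          exp (- sqrt (2 * rate) * x / \<sigma>)) * indicator {0..} x)"
      unfolding e using c0 nonneg
      by (cases "0 \<le> x") (simp_all add: ennreal_plus[symmetric] ennreal_mult'[symmetric]
          add_divide_distrib distrib_left distrib_right del: ennreal_plus)
  qed
  also have "\<dots> = ennreal c * (\<integral>\<^sup>+x\<in>{0..}. ennreal ((Gp (x + \<gamma>) + Gm (- x - \<gamma>)) / 2 *
      exp (- sqrt (2 * rate) * x / \<sigma>)) \<partial>lborel)"
    by (rule nn_integral_cmult) measurable
  finally show ?thesis
    using pos c0 by (simp add: mult.assoc[symmetric] ennreal_mult'[symmetric] c_def k_def)
qed

theorem theorem2:
  fixes M :: "'a measure"
    and \<sigma> rate \<gamma> \<mu> p0 L :: real
    and B :: "real \<Rightarrow> 'a \<Rightarrow> real"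
    and N :: "real \<Rightarrow> 'a \<Rightarrow> nat"
    and \<tau> :: "nat \<Rightarrow> 'a \<Rightarrow> real"
    and P z :: "real \<Rightarrow> 'a \<Rightarrow> real"
    and z0 :: "'a \<Rightarrow> real"
    and f :: "real \<Rightarrow> real \<Rightarrow> real"
    and xs ys :: "real \<Rightarrow> real"
  assumes prob: "prob_space M"
    and pos: "0 < \<sigma>" "0 < rate" "0 < \<gamma>" "0 < p0"
    and drift: "\<mu> = \<sigma>\<^sup>2 / 2"
    and bm: "brownian_motion M B"
    and poisson: "poisson_process M rate N"
    and arrivals: "arrival_times M N \<tau>"
    and indep_B_N: "indep_random_elements M B_space (trajectory B) N_space (trajectory N)"
    and indep_z0: "indep_random_elements M borel z0
                     (B_space \<Otimes>\<^sub>M N_space) (\<lambda>\<omega>. (trajectory B \<omega>, trajectory N \<omega>))"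
    and z0_stationary: "distr M borel z0 = stationary_dist \<sigma> rate \<gamma>"
    and price: "price_process M \<mu> \<sigma> B p0 P"
    and mispricing: "\<And>\<omega>. \<omega> \<in> space M \<Longrightarrow>
          mispricing_path \<sigma> \<gamma> (\<lambda>t. B t \<omega>) (\<lambda>i. \<tau> i \<omega>) (z0 \<omega>) (\<lambda>t. z t \<omega>)"
    and optimal: "\<And>p. 0 \<le> p \<Longrightarrow> optimal_reserves f L p (xs p) (ys p)"
    and smooth: "twice_cont_diff_on {0<..} (pool_value f L)"
    and square_integrable: "\<And>t. 0 \<le> t \<Longrightarrow>
          (\<integral>\<^sup>+\<omega>. (\<integral>\<^sup>+s\<in>{0..t}. ennreal ((xs (P s \<omega>))\<^sup>2 * (P s \<omega>)\<^sup>2) \<partial>lborel) \<partial>M) < \<infinity>"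
  shows "((\<lambda>T. (\<integral>\<^sup>+\<omega>. ennreal (cumulative (A_total xs ys \<gamma>) N \<tau> P z T \<omega>) \<partial>M) / ennreal T)
            \<longlongrightarrow> ennreal rate * (\<integral>\<^sup>+u. ennreal (A_total xs ys \<gamma> p0 u) \<partial>stationary_dist \<sigma> rate \<gamma>))
          (at_right 0)
       \<and> ennreal rate * (\<integral>\<^sup>+u. ennreal (A_total xs ys \<gamma> p0 u) \<partial>stationary_dist \<sigma> rate \<gamma>)
          = ennreal (rate * P_trade \<sigma> rate \<gamma> * (sqrt (2 * rate) / \<sigma>))
            * (\<integral>\<^sup>+x\<in>{0..}. ennreal ((A_plus xs ys \<gamma> p0 (x + \<gamma>) + A_minus xs ys \<gamma> p0 (- x - \<gamma>)) / 2
                               * exp (- sqrt (2 * rate) * x / \<sigma>)) \<partial>lborel)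
       \<and> ((\<lambda>T. (\<integral>\<^sup>+\<omega>. ennreal (cumulative (F_total xs ys \<gamma>) N \<tau> P z T \<omega>) \<partial>M) / ennreal T)
            \<longlongrightarrow> ennreal rate * (\<integral>\<^sup>+u. ennreal (F_total xs ys \<gamma> p0 u) \<partial>stationary_dist \<sigma> rate \<gamma>))
          (at_right 0)
       \<and> ennreal rate * (\<integral>\<^sup>+u. ennreal (F_total xs ys \<gamma> p0 u) \<partial>stationary_dist \<sigma> rate \<gamma>)
          = ennreal (rate * P_trade \<sigma> rate \<gamma> * (sqrt (2 * rate) / \<sigma>))
            * (\<integral>\<^sup>+x\<in>{0..}. ennreal ((F_plus ys \<gamma> p0 (x + \<gamma>) + F_minus xs \<gamma> p0 (- x - \<gamma>)) / 2
                               * exp (- sqrt (2 * rate) * x / \<sigma>)) \<partial>lborel)"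
proof -
  interpret amm_pool f L xs ys p0 \<gamma>
    by unfold_locales (use optimal smooth pos in auto)
  \<comment> \<open>Stated for a general payoff \<open>G\<close>, so that profits and fees differ
    only in the choice of \<open>D\<close>.\<close>
  have limit: "((\<lambda>T. (\<integral>\<^sup>+\<omega>. ennreal (cumulative G N \<tau> P z T \<omega>) \<partial>M) / ennreal T)
      \<longlongrightarrow> ennreal rate * (\<integral>\<^sup>+u. ennreal (G p0 u) \<partial>stationary_dist \<sigma> rate \<gamma>)) (at_right 0)"
    if meas: "(\<lambda>p. G (p0 * exp (fst p)) (snd p)) \<in> borel_measurable (borel \<Otimes>\<^sub>M borel)"
      and nonneg: "\<And>b v. 0 \<le> G (p0 * exp b) v"
      and bound: "\<And>b v. G (p0 * exp b) v \<le> bound_const * (1 + exp b) + D (b - v)"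
      and D: "mono D" "\<And>v. D v \<le> bound_const * (1 + exp v)" "\<And>u. D (- u) \<le> G (p0 * exp 0) u + bound_const"
      and cont: "\<And>u. u \<noteq> \<gamma> \<Longrightarrow> u \<noteq> - \<gamma> \<Longrightarrow> isCont (\<lambda>b. G (p0 * exp b) (u + b)) 0"
    for G D
  proof -
    have "AE u in distr M borel z0. isCont (\<lambda>b. G (p0 * exp b) (u + b)) 0"
      unfolding z0_stationary using AE_stationary_dist_neq[of \<gamma> "- \<gamma>"]
      by eventually_elim (use cont in blast)
    note lim = arrival_rate_limit[where g = "\<lambda>b. G (p0 * exp b)", OF prob pos(2,3) bm poisson arrivals
        indep_B_N indep_z0 meas nonneg bound_const_nonneg bound D this, of \<sigma>]
    have eq: "(\<integral>\<^sup>+\<omega>. ennreal (cumulative G N \<tau> P z T \<omega>) \<partial>M) =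
        (\<integral>\<^sup>+\<omega>. (\<Sum>i<N T \<omega>. ennreal (G (p0 * exp (\<sigma> * B (\<tau> (Suc i) \<omega>) \<omega>))
          (pre_arrival \<sigma> \<gamma> (\<lambda>s. B s \<omega>) (from_zero (\<lambda>i. \<tau> i \<omega>)) (z0 \<omega>) i))) \<partial>M)" for T
    proof (rule nn_integral_cong_AE)
      show "AE \<omega> in M. ennreal (cumulative G N \<tau> P z T \<omega>) =
        (\<Sum>i<N T \<omega>. ennreal (G (p0 * exp (\<sigma> * B (\<tau> (Suc i) \<omega>) \<omega>))
          (pre_arrival \<sigma> \<gamma> (\<lambda>s. B s \<omega>) (from_zero (\<lambda>i. \<tau> i \<omega>)) (z0 \<omega>) i)))"
        using price_process_eq[OF prob bm pos(4) price] AE_space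
      proof eventually_elim
        case (elim \<omega>)
        \<comment> \<open>With this drift the linear term of the exponent,
          \<open>\<mu> - \<sigma>\<^sup>2 / 2\<close>, vanishes.\<close>
        have price_eq: "P (\<tau> (Suc i) \<omega>) \<omega> = p0 * exp (\<sigma> * B (\<tau> (Suc i) \<omega>) \<omega>)" for i
          using elim(1) arrival_time_pos[OF arrivals elim(2), of "Suc i"] by (simp add: drift less_imp_le)
        have left: "left_lim (\<lambda>t. z t \<omega>) (\<tau> (Suc i) \<omega>) =
            pre_arrival \<sigma> \<gamma> (\<lambda>s. B s \<omega>) (from_zero (\<lambda>i. \<tau> i \<omega>)) (z0 \<omega>) i" for i
          using bm arrivals elim(2)
          by (intro left_lim_mispricing[where a = "\<lambda>i. \<tau> i \<omega>", OF mispricing[OF elim(2)]])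
            (auto simp: brownian_motion_def arrival_times_def)
        have "cumulative G N \<tau> P z T \<omega> = (\<Sum>i<N T \<omega>. G (p0 * exp (\<sigma> * B (\<tau> (Suc i) \<omega>) \<omega>))
            (pre_arrival \<sigma> \<gamma> (\<lambda>s. B s \<omega>) (from_zero (\<lambda>i. \<tau> i \<omega>)) (z0 \<omega>) i))"
          unfolding cumulative_def One_nat_def sum.atLeast1_atMost_eq by (simp only: price_eq left)
        then show ?case by (simp add: sum_ennreal nonneg)
      qed
    qed
    show ?thesis using lim unfolding eq z0_stationary by simp
  qed
  have nn: "0 \<le> A_plus xs ys \<gamma> p0 u" "0 \<le> A_minus xs ys \<gamma> p0 u" "0 \<le> F_plus ys \<gamma> p0 u" "0 \<le> F_minus xs \<gamma> p0 u" for u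
    using nonneg_rates[of 0 u] by simp_all
  have "((\<lambda>T. (\<integral>\<^sup>+\<omega>. ennreal (cumulative (A_total xs ys \<gamma>) N \<tau> P z T \<omega>) \<partial>M) / ennreal T)
      \<longlongrightarrow> ennreal rate * (\<integral>\<^sup>+u. ennreal (A_total xs ys \<gamma> p0 u) \<partial>stationary_dist \<sigma> rate \<gamma>)) (at_right 0)"
    by (rule limit[where D = Y])
      (intro A_total_measurable A_total_nonneg A_total_le monoI Y_mono Y_le_const Y_le_A_total isCont_total; assumption)+
  \<comment> \<open>With \<open>D = 0\<close> the comparison of \<open>D\<close> with the payoff at
    time 0 is immediate.\<close>
  moreover have "((\<lambda>T. (\<integral>\<^sup>+\<omega>. ennreal (cumulative (F_total xs ys \<gamma>) N \<tau> P z T \<omega>) \<partial>M) / ennreal T)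
      \<longlongrightarrow> ennreal rate * (\<integral>\<^sup>+u. ennreal (F_total xs ys \<gamma> p0 u) \<partial>stationary_dist \<sigma> rate \<gamma>)) (at_right 0)"
    by (rule limit[where D = "\<lambda>_. 0"])
      (use bound_const_nonneg F_total_nonneg[of 0] F_total_le in
        \<open>auto intro!: F_total_measurable F_total_nonneg isCont_total monoI mult_nonneg_nonneg add_nonneg_nonneg\<close>)
  ultimately show ?thesis
    using nn_integral_stationary_dist[OF pos(1-3) rates_measurable_section(1,2) nn(1,2)]
      nn_integral_stationary_dist[OF pos(1-3) rates_measurable_section(3,4) nn(3,4)] pos(3)
    by (simp add: A_total_def F_total_def A_plus_def A_minus_def F_plus_def F_minus_def)
qed

end
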